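(* Let $(X,x)$ be a $5$-dimensional isolated hypersurface singularity belonging to one of the six analytic types $\mathsf{E}_{19},\mathsf{E}_{21},\mathsf{E}_{18},\mathcal{O}_6,\mathcal{C}_{cub},\mathsf{E}_{20}$ listed in the context. Then its local minimal exponent is $\widetilde{\alpha}_x(X)=\frac73$.
   Context: Work over $\mathbb{C}$. A hypersurface germ $(X,x)$ of dimension $5$ (in a smooth $6$-dimensional germ) is of one of the types below if its local equation is analytically equivalent to $u_1^2+\dots+u_{6-c}^2+g(z_1,\dots,z_c)$, where $g$ is the indicated germ in $c$ variables, with parameters such that $g$ has an isolated singularity: - $\mathsf{E}_{19}$: $g=X^2Y+Y^4+XZ^3$ (quasi-homogeneous of degree $24$ with weights $(9,6,5)$); - $\mathsf{E}_{21}$: $g=tX^6+X^3Y^2+X^2YZ+XZ^2+Y^4$, $t\in\mathbb{C}^\times$ (degree $12$, weights $(2,3,5)$); - $\mathsf{E}_{18}$: $g=Z^3+X^4+tX^2Y^2+Y^4$ (degree $12$, weights $(3,3,4)$); - $\mathcal{O}_6$: $g=\prod_{i=1}^6L_i(X,Y)$ with pairwise non-proportional linear forms $L_i$ (degree $6$, weights $(1,1)$); - $\mathcal{C}_{cub}$: $g=\sum_{i=0}^4c_iL_i(X_1,X_2,X_3,X_4)^3$, $L_i$ generic linear forms, $(c_0:\dots:c_4)\in\mathbb{P}^4$ (degree $3$, weights $(1,1,1,1)$); - $\mathsf{E}_{20}$: $g=Y^3+Z^3+X^6+t_1X^2Y^2+t_2X^2YZ+t_3Y^2Z+t_4X^4Y+t_5X^4Z$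 (degree $6$, weights $(1,2,2)$). The local minimal exponent $\widetilde{\alpha}_x(X)$ is the negative of the largest root of the reduced Bernstein--Sato polynomial $b_f(s)/(s+1)$ of a local equation $f$ of $X$ at $x$. *)

theory Defs
  imports "HOL-Analysis.Analysis" "HOL-Computational_Algebra.Polynomial"
begin

section \<open>Holomorphic functions of several variables\<close>

definition partial_deriv :: "'n::finite \<Rightarrow> (complex^'n \<Rightarrow> complex) \<Rightarrow> complex^'n \<Rightarrow> complex" where
  "partial_deriv i f z = deriv (\<lambda>t. f (z + axis i t)) 0"

definition mv_holomorphic_on :: "(complex^'n::finite \<Rightarrow> complex) \<Rightarrow> (complex^'n) set \<Rightarrow> bool" where
  "mv_holomorphic_on f U \<longleftrightarrow>
     (\<forall>z\<in>U. \<exists>D. (f has_derivative D) (at z) \<and> (\<forall>c v. D (c *s v) = c * D v))"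

definition holomorphic_map_on ::
    "(complex^'n::finite \<Rightarrow> complex^'m::finite) \<Rightarrow> (complex^'n) set \<Rightarrow> bool" where
  "holomorphic_map_on \<phi> U \<longleftrightarrow> (\<forall>j. mv_holomorphic_on (\<lambda>z. \<phi> z $ j) U)"

section \<open>Hypersurface germs\<close>

text \<open>A hypersurface germ is given by a local equation \<open>f\<close> near a point \<open>x\<close>.  Its singular locus
  is the common zero set of \<open>f\<close> and its partial derivatives.\<close>

definition isolated_singularity :: "(complex^'n::finite \<Rightarrow> complex) \<Rightarrow> complex^'n \<Rightarrow> bool" where
  "isolated_singularity f x \<longleftrightarrow>
     f x = 0 \<and> (\<forall>i. partial_deriv i f x = 0) \<and>
     (\<exists>U. open U \<and> x \<in> U \<and> mv_holomorphic_on f U \<and>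
        (\<forall>z\<in>U. f z = 0 \<and> (\<forall>i. partial_deriv i f z = 0) \<longrightarrow> z = x))"

text \<open>A local equation of a hypersurface germ is determined only up to a unit, so equivalence of
  equations is taken up to a biholomorphic change of coordinates \<open>\<phi>\<close> (with inverse \<open>\<psi>\<close>) and
  a nowhere vanishing holomorphic factor \<open>e\<close>.\<close>

definition analytically_equivalent ::
    "(complex^'n::finite \<Rightarrow> complex) \<Rightarrow> complex^'n \<Rightarrow>
     (complex^'m::finite \<Rightarrow> complex) \<Rightarrow> complex^'m \<Rightarrow> bool" where
  "analytically_equivalent f x g y \<longleftrightarrow>
     (\<exists>U V \<phi> \<psi> e. open U \<and> x \<in> U \<and> open V \<and> y \<in> V \<and>
        holomorphic_map_on \<phi> U \<and> holomorphic_map_on \<psi> V \<and>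
        \<phi> ` U = V \<and> \<psi> ` V = U \<and> (\<forall>z\<in>U. \<psi> (\<phi> z) = z) \<and> (\<forall>w\<in>V. \<phi> (\<psi> w) = w) \<and> \<phi> x = y \<and>
        mv_holomorphic_on e U \<and> (\<forall>z\<in>U. e z \<noteq> 0) \<and>
        (\<forall>z\<in>U. f z = e z * g (\<phi> z)))"

section \<open>Bernstein--Sato polynomial and minimal exponent\<close>

text \<open>Elements of \<open>O\<^sub>x[1/f, s] f\<^sup>s\<close> are written \<open>h f\<^sup>s\<close>, with \<open>h\<close> regarded as a function on the
  complement of \<open>f = 0\<close> near \<open>x\<close> for each complex value of \<open>s\<close>; no branch of \<open>f\<^sup>s\<close> is chosen.
  Identities of polynomials in \<open>s\<close> are tested at all \<open>s\<close> in the infinite field of complex numbers.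
  The rule below is \<open>\<partial>\<^sub>i (h f\<^sup>s) = (\<partial>\<^sub>i h + s (\<partial>\<^sub>i f / f) h) f\<^sup>s\<close>.\<close>

definition twisted_deriv ::
    "(complex^'n::finite \<Rightarrow> complex) \<Rightarrow> complex \<Rightarrow> 'n \<Rightarrow>
     (complex^'n \<Rightarrow> complex) \<Rightarrow> complex^'n \<Rightarrow> complex" where
  "twisted_deriv f s i h z =
     partial_deriv i h z + s * (partial_deriv i f z / f z) * h z"

text \<open>The functional equation \<open>P f\<^sup>s\<^sup>+\<^sup>1 = b(s) f\<^sup>s\<close> for a germ at \<open>x\<close> of a holomorphic differential
  operator \<open>P = \<Sum> s\<^sup>k a\<^sub>k\<^sub>w(z) \<partial>\<^sup>w\<close> depending polynomially on \<open>s\<close>.  Here \<open>w = [i\<^sub>1, \<dots>, i\<^sub>m]\<close>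
  is a word in the coordinate indices and \<open>\<partial>\<^sup>w = \<partial>\<^sub>i\<^sub>1 \<dots> \<partial>\<^sub>i\<^sub>m\<close>; as partial derivatives
  commute, words and multi-indices give the same operators.
  The starting element \<open>f\<^sup>s\<^sup>+\<^sup>1 = f \<cdot> f\<^sup>s\<close> is represented by \<open>h = f\<close>.\<close>

definition bernstein_equation ::
    "(complex^'n::finite \<Rightarrow> complex) \<Rightarrow> complex^'n \<Rightarrow> complex poly \<Rightarrow> bool" where
  "bernstein_equation f x b \<longleftrightarrow>
     (\<exists>U N W a. open U \<and> x \<in> U \<and> mv_holomorphic_on f U \<and> finite W \<and>
        (\<forall>k\<le>N. \<forall>w\<in>W. mv_holomorphic_on (a k w) U) \<and>
        (\<forall>s. \<forall>z\<in>U. f z \<noteq> 0 \<longrightarrow>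
           (\<Sum>w\<in>W. \<Sum>k\<le>N. s ^ k * a (k::nat) w z * foldr (twisted_deriv f s) w f z) = poly b s))"

definition bernstein_sato_poly ::
    "(complex^'n::finite \<Rightarrow> complex) \<Rightarrow> complex^'n \<Rightarrow> complex poly" where
  "bernstein_sato_poly f x =
     (THE b. lead_coeff b = 1 \<and> bernstein_equation f x b \<and>
        (\<forall>c. c \<noteq> 0 \<and> bernstein_equation f x c \<longrightarrow> degree b \<le> degree c))"

definition reduced_bernstein_sato_poly ::
    "(complex^'n::finite \<Rightarrow> complex) \<Rightarrow> complex^'n \<Rightarrow> complex poly" where
  "reduced_bernstein_sato_poly f x = bernstein_sato_poly f x div [:1, 1:]"

text \<open>By Kashiwara all roots are rational, so it is enough to range over real roots.\<close>

definition minimal_exponent :: "(complex^'n::finite \<Rightarrow> complex) \<Rightarrow> complex^'n \<Rightarrow> real" where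
  "minimal_exponent f x =
     - Max {r::real. poly (reduced_bernstein_sato_poly f x) (complex_of_real r) = 0}"

section \<open>The six analytic types\<close>

text \<open>The sum \<open>u\<^sub>1\<^sup>2 + \<dots> + u\<^sub>k\<^sup>2 + g(z\<^sub>1, \<dots>, z\<^sub>c)\<close>, with \<open>k = CARD('k)\<close> and \<open>c = CARD('c)\<close>, on
  the space with coordinates indexed by the disjoint union of the two index sets.\<close>

definition add_squares ::
    "(complex^'c::finite \<Rightarrow> complex) \<Rightarrow> complex^('k::finite + 'c) \<Rightarrow> complex" where
  "add_squares g v = (\<Sum>i\<in>UNIV. (v $ Inl i)\<^sup>2) + g (\<chi> j. v $ Inr j)"

definition has_type ::
    "'k::finite itself \<Rightarrow> (complex^'c::finite \<Rightarrow> complex) set \<Rightarrow>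
     (complex^'n::finite \<Rightarrow> complex) \<Rightarrow> complex^'n \<Rightarrow> bool" where
  "has_type _ G f x \<longleftrightarrow>
     (\<exists>g\<in>G. isolated_singularity g 0 \<and>
        analytically_equivalent f x (add_squares g :: complex^('k + 'c) \<Rightarrow> complex) 0)"

definition linear_form :: "complex^'c::finite \<Rightarrow> complex^'c \<Rightarrow> complex" where
  "linear_form l v = (\<Sum>j\<in>UNIV. l $ j * v $ j)"

definition E19 :: "(complex^3 \<Rightarrow> complex) set" where
  "E19 = {\<lambda>v. let X = v $ 1; Y = v $ 2; Z = v $ 3 in X^2 * Y + Y^4 + X * Z^3}"

definition E21 :: "(complex^3 \<Rightarrow> complex) set" where
  "E21 = {(\<lambda>v. let X = v $ 1; Y = v $ 2; Z = v $ 3 in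
             t * X^6 + X^3 * Y^2 + X^2 * Y * Z + X * Z^2 + Y^4) | t. t \<noteq> 0}"

definition E18 :: "(complex^3 \<Rightarrow> complex) set" where
  "E18 = {(\<lambda>v. let X = v $ 1; Y = v $ 2; Z = v $ 3 in
             Z^3 + X^4 + t * X^2 * Y^2 + Y^4) | t. True}"

definition O6 :: "(complex^2 \<Rightarrow> complex) set" where
  "O6 = {(\<lambda>v. \<Prod>i\<in>{1..6}. linear_form (L i) v) | L :: nat \<Rightarrow> complex^2.
           \<forall>i\<in>{1..6}. \<forall>j\<in>{1..6}. i \<noteq> j \<longrightarrow> (\<forall>c. L i \<noteq> c *s L j)}"

text \<open>Genericity of the five linear forms means general position: any four of them are
  linearly independent.  The coefficients \<open>c\<close> are homogeneous coordinates of a point of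
  projective 4-space, hence not all zero.\<close>

definition Ccub :: "(complex^4 \<Rightarrow> complex) set" where
  "Ccub = {(\<lambda>v. \<Sum>i\<le>4. c i * (linear_form (L i) v)^3) | (c :: nat \<Rightarrow> complex) (L :: nat \<Rightarrow> complex^4).
             inj_on L {..4} \<and> (\<forall>k\<le>4. vec.independent (L ` ({..4} - {k}))) \<and> (\<exists>i\<le>4. c i \<noteq> 0)}"

definition E20 :: "(complex^3 \<Rightarrow> complex) set" where
  "E20 = {(\<lambda>v. let X = v $ 1; Y = v $ 2; Z = v $ 3 in
             Y^3 + Z^3 + X^6 + t1 * X^2 * Y^2 + t2 * X^2 * Y * Z + t3 * Y^2 * Z
               + t4 * X^4 * Y + t5 * X^4 * Z) | t1 t2 t3 t4 t5. True}"

end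

theory Submission
  imports "HOL-Complex_Analysis.Conformal_Mappings" "HOL-Library.Poly_Mapping"
    "HOL-Computational_Algebra.Fundamental_Theorem_Algebra" "HOL-Real_Asymp.Real_Asymp" Defs
begin

text \<open>
  Each of the six germs is weighted homogeneous, and so is its sum with the squares. After scaling the
  weights so that the equation \<open>f\<close> has degree 1, their sum \<open>\<alpha>\<close> is \<open>7/3\<close> in all six cases. The proof shows
  for every weighted homogeneous polynomial \<open>f\<close> whose gradient vanishes only at the origin, with \<open>\<alpha> > 1\<close>,
  that the minimal exponent is \<open>\<alpha>\<close>.  The minimal exponent depends only on the set of polynomials \<open>b\<close>
  that admit a functional equation \<open>P f\<^sup>s\<^sup>+\<^sup>1 = b(s) f\<^sup>s\<close>, and this set does not change under an analytic
  equivalence: the chain rule and the inverse Jacobian matrix transport the operators, and a unit factor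
  only adds its logarithmic derivative, multiplied by \<open>s\<close>, to each derivation
  (\<open>minimal_exponent_analytically_equivalent\<close>). This set of polynomials is an ideal and the Bernstein-Sato polynomial
  generates it, so three facts suffice.

  \<^item> There is an equation with \<open>b(s) = (s + 1) q(s)\<close> in which all roots of \<open>q\<close> are real and at most \<open>-\<alpha>\<close>
    (\<open>bernstein_equation_exists\<close>). For a monomial \<open>u\<close> of weight \<open>\<rho>\<close> Euler's identity gives
    \<open>(s + \<alpha> + \<rho>) u f\<^sup>s = \<Sum> \<partial>\<^sub>i (w\<^sub>i z\<^sub>i u f\<^sup>s)\<close>, which trades \<open>u\<close> for monomials of larger degree. By the Nullstellensatz
    monomials of large degree lie in the Jacobian ideal, and there \<open>(s + 1) (\<partial>\<^sub>i f) f\<^sup>s = \<partial>\<^sub>i f\<^sup>s\<^sup>+\<^sup>1\<close>.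

  \<^item> Every \<open>b\<close> vanishes at \<open>-1\<close>, because there \<open>f\<^sup>s\<^sup>+\<^sup>1 = 1\<close> is killed by all derivations and \<open>b(-1)\<close> becomes a
    multiple of \<open>f\<close> (\<open>bernstein_root_minus_1\<close>).

  \<^item> Every \<open>b\<close> vanishes at \<open>-\<alpha>\<close> (\<open>bernstein_root_alpha\<close>). Integration by parts turns the equation at \<open>s = -\<alpha>\<close> into
    \<open>c f\<^sup>s = Q f\<^sup>s\<^sup>+\<^sup>1 + \<Sum> \<partial>\<^sub>i (p\<^sub>i f\<^sup>s\<^sup>-\<^sup>m)\<close> with \<open>c = b(-\<alpha>)\<close>. Clearing denominators and keeping
    the part of weight \<open>m + 1\<close> leaves the polynomial relation
    \<open>c f\<^sup>m\<^sup>+\<^sup>1 = f div p - (\<alpha> + m) \<Sum> p\<^sub>i \<partial>\<^sub>i f\<close>, since \<open>Q f\<^sup>m\<^sup>+\<^sup>2\<close> is too heavy.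
    With Euler's identity this is a syzygy of the partial derivatives of \<open>f\<close>. They form a regular sequence, so the
    syzygy is given by an antisymmetric matrix. Its divergence yields the same relation for \<open>m - 1\<close>, and for \<open>m = 0\<close>
    evaluation at the origin gives \<open>c = 0\<close>.

  That the syzygies of the gradient are the antisymmetric ones is an instance of the depth sensitivity of the Koszul
  complex (\<open>koszul_acyclic_mod\<close>): by the Nullstellensatz the Jacobian ideal contains powers of the coordinates, which
  form a regular sequence of the same length.
\<close>

section \<open>Gradients of holomorphic functions\<close>

text \<open>Complex differentiability with the partial derivatives as data. In this form the product rule,
  the chain rule and limits become rules about families of coefficients.\<close>
definition has_gradient ::
    "(complex^'n::finite \<Rightarrow> complex) \<Rightarrow> ('n \<Rightarrow> complex) \<Rightarrow> complex^'n \<Rightarrow> bool" where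
  "has_gradient f c z \<longleftrightarrow> (f has_derivative (\<lambda>v. \<Sum>i\<in>UNIV. v $ i * c i)) (at z)"

lemma has_gradient_line:
  fixes p q :: "complex^'n::finite"
  assumes "has_gradient f c (p + t *s q)"
  shows "((\<lambda>t. f (p + t *s q)) has_field_derivative (\<Sum>i\<in>UNIV. q $ i * c i)) (at t)"
proof -
  have lin: "bounded_linear (\<lambda>t::complex. t *s q)"
    by (intro linear_conv_bounded_linear[THEN iffD1] linearI)
       (auto simp: vec_eq_iff algebra_simps)
  have "((\<lambda>t. p + t *s q) has_derivative (\<lambda>h. h *s q)) (at t)"
    using has_derivative_add[OF has_derivative_const bounded_linear_imp_has_derivative[OF lin]]
    by simp
  from has_derivative_compose[OF this assms[unfolded has_gradient_def]]
  have "((\<lambda>t. f (p + t *s q)) has_derivative (\<lambda>h. \<Sum>i\<in>UNIV. (h *s q) $ i * c i)) (at t)" .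
  then show ?thesis unfolding has_field_derivative_def
    by (rule has_derivative_eq_rhs) (simp add: fun_eq_iff sum_distrib_left mult_ac)
qed

lemma axis_eq_scale: "axis i t = t *s axis i (1::complex)"
  by (simp add: vec_eq_iff axis_def)

lemma has_gradient_axis:
  assumes "has_gradient f c (z + axis i t)"
  shows "((\<lambda>t. f (z + axis i t)) has_field_derivative c i) (at t)"
proof -
  have "(\<Sum>j\<in>UNIV. axis i 1 $ j * c j) = c i"
    by (simp add: axis_def if_distrib[of "\<lambda>x. x * _"] cong: if_cong)
  with has_gradient_line[of f c z t "axis i 1"] assms show ?thesis
    unfolding axis_eq_scale[symmetric] by simp
qed

lemma has_gradient_imp_partial_deriv:
  "has_gradient f c z \<Longrightarrow> partial_deriv i f z = c i"
  unfolding partial_deriv_def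
  by (rule DERIV_imp_deriv, rule has_gradient_axis) (simp add: axis_eq_scale[of i 0])

text \<open>A complex linear functional is determined by its values on the coordinate vectors.\<close>
lemma complex_derivative_iff_has_gradient:
  "(\<exists>D. (f has_derivative D) (at z) \<and> (\<forall>c v. D (c *s v) = c * D v)) \<longleftrightarrow> (\<exists>c. has_gradient f c z)"
proof
  assume "\<exists>D. (f has_derivative D) (at z) \<and> (\<forall>c v. D (c *s v) = c * D v)"
  then obtain D where D: "(f has_derivative D) (at z)" "\<And>c v. D (c *s v) = c * D v" by blast
  interpret bounded_linear D using D(1) by (rule has_derivative_bounded_linear)
  have "D = (\<lambda>v. \<Sum>i\<in>UNIV. v $ i * D (axis i 1))"
  proof
    fix v show "D v = (\<Sum>i\<in>UNIV. v $ i * D (axis i 1))"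
      using sum[of "\<lambda>i. v $ i *s axis i 1" UNIV] by (simp only: D(2) basis_expansion)
  qed
  with D(1) show "\<exists>c. has_gradient f c z" unfolding has_gradient_def by metis
next
  assume "\<exists>c. has_gradient f c z"
  then obtain c where "has_gradient f c z" ..
  then show "\<exists>D. (f has_derivative D) (at z) \<and> (\<forall>c v. D (c *s v) = c * D v)"
    unfolding has_gradient_def
    by (intro exI[of _ "\<lambda>v. \<Sum>i\<in>UNIV. v $ i * c i"]) (auto simp: sum_distrib_left mult_ac)
qed

lemma mv_holomorphic_on_iff:
  "mv_holomorphic_on f U \<longleftrightarrow> (\<forall>z\<in>U. has_gradient f (\<lambda>i. partial_deriv i f z) z)"
proof -
  have "(\<exists>c. has_gradient f c z) \<longleftrightarrow> has_gradient f (\<lambda>i. partial_deriv i f z) z" for z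
  proof
    assume "\<exists>c. has_gradient f c z"
    then obtain c where c: "has_gradient f c z" ..
    have "c = (\<lambda>i. partial_deriv i f z)"
      using has_gradient_imp_partial_deriv[OF c] by auto
    with c show "has_gradient f (\<lambda>i. partial_deriv i f z) z" by simp
  qed auto
  then show ?thesis
    unfolding mv_holomorphic_on_def complex_derivative_iff_has_gradient by simp
qed

lemma mv_holomorphic_onI:
  "(\<And>z. z \<in> U \<Longrightarrow> has_gradient f (c z) z) \<Longrightarrow> mv_holomorphic_on f U"
  unfolding mv_holomorphic_on_def complex_derivative_iff_has_gradient by blast

lemma mv_holomorphic_onD:
  "mv_holomorphic_on f U \<Longrightarrow> z \<in> U \<Longrightarrow> has_gradient f (\<lambda>i. partial_deriv i f z) z"
  by (simp add: mv_holomorphic_on_iff)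

lemma mv_holomorphic_on_subset:
  "mv_holomorphic_on f U \<Longrightarrow> V \<subseteq> U \<Longrightarrow> mv_holomorphic_on f V"
  unfolding mv_holomorphic_on_def by blast

lemma has_gradient_const: "has_gradient (\<lambda>z. k) (\<lambda>i. 0) z"
  by (simp add: has_gradient_def)

lemma has_gradient_coord: "has_gradient (\<lambda>z. z $ j) (\<lambda>i. if i = j then 1 else 0) z"
  unfolding has_gradient_def
  by (rule has_derivative_eq_rhs[OF bounded_linear_imp_has_derivative[OF bounded_linear_vec_nth]])
     (auto simp: if_distrib cong: if_cong)

lemma has_gradient_add:
  assumes "has_gradient f c z" "has_gradient g d z"
  shows "has_gradient (\<lambda>z. f z + g z) (\<lambda>i. c i + d i) z"
  unfolding has_gradient_def
  by (rule has_derivative_eq_rhs[OF has_derivative_add[OF assms[unfolded has_gradient_def]]])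
     (auto simp: algebra_simps sum.distrib)

lemma has_gradient_mult:
  assumes "has_gradient f c z" "has_gradient g d z"
  shows "has_gradient (\<lambda>z. f z * g z) (\<lambda>i. c i * g z + f z * d i) z"
  unfolding has_gradient_def
  by (rule has_derivative_eq_rhs[OF has_derivative_mult[OF assms[unfolded has_gradient_def]]])
     (auto simp: algebra_simps sum.distrib sum_distrib_left sum_distrib_right)

lemma has_gradient_inverse:
  assumes "has_gradient f c z" "f z \<noteq> 0"
  shows "has_gradient (\<lambda>z. inverse (f z)) (\<lambda>i. - (inverse (f z) * c i * inverse (f z))) z"
  unfolding has_gradient_def
proof (rule has_derivative_eq_rhs[OF Deriv.has_derivative_inverse[OF assms(2) assms(1)[unfolded has_gradient_def]]])
  show "(\<lambda>h. - (inverse (f z) * (\<Sum>i\<in>UNIV. h $ i * c i) * inverse (f z))) =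
    (\<lambda>v. \<Sum>i\<in>UNIV. v $ i * - (inverse (f z) * c i * inverse (f z)))"
    by (simp only: sum_distrib_left sum_distrib_right sum_negf[symmetric] mult_minus_right mult_ac)
qed

lemma has_gradient_sum:
  assumes "\<And>k. k \<in> A \<Longrightarrow> has_gradient (f k) (c k) z"
  shows "has_gradient (\<lambda>z. \<Sum>k\<in>A. f k z) (\<lambda>i. \<Sum>k\<in>A. c k i) z"
  using assms
  by (induction A rule: infinite_finite_induct) (auto intro: has_gradient_const has_gradient_add)

lemma has_gradient_transform:
  assumes "has_gradient f c z" "open U" "z \<in> U" "\<And>w. w \<in> U \<Longrightarrow> f w = g w"
  shows "has_gradient g c z"
  using assms unfolding has_gradient_def
  by (auto intro: has_derivative_transform_within_open)

lemma has_gradient_compose: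
  fixes \<phi> :: "complex^'n::finite \<Rightarrow> complex^'m::finite"
  assumes "has_gradient h c (\<phi> z)" "\<And>j. has_gradient (\<lambda>z. \<phi> z $ j) (J j) z"
  shows "has_gradient (\<lambda>z. h (\<phi> z)) (\<lambda>i. \<Sum>j\<in>UNIV. J j i * c j) z"
proof -
  have "(\<phi> has_derivative (\<lambda>v. \<chi> j. \<Sum>i\<in>UNIV. v $ i * J j i)) (at z)"
  proof (subst has_derivative_componentwise_within, rule ballI)
    fix b :: "complex^'m" assume "b \<in> Basis"
    then obtain j u where b: "b = axis j u" "u \<in> Basis" unfolding Basis_vec_def by blast
    have "((\<lambda>z. \<phi> z $ j \<bullet> u) has_derivative (\<lambda>v. (\<Sum>i\<in>UNIV. v $ i * J j i) \<bullet> u)) (at z)"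
      using assms(2)[of j] unfolding has_gradient_def by (rule has_derivative_inner_left)
    then show "((\<lambda>x. \<phi> x \<bullet> b) has_derivative
          (\<lambda>x. (\<chi> j. \<Sum>i\<in>UNIV. x $ i * J j i) \<bullet> b)) (at z within UNIV)"
      by (simp add: b inner_axis)
  qed
  from has_derivative_compose[OF this assms(1)[unfolded has_gradient_def]]
  show ?thesis unfolding has_gradient_def
  proof (rule has_derivative_eq_rhs)
    show "(\<lambda>x. \<Sum>i\<in>UNIV. (\<chi> j. \<Sum>i\<in>UNIV. x $ i * J j i) $ i * c i) =
      (\<lambda>v. \<Sum>i\<in>UNIV. v $ i * (\<Sum>j\<in>UNIV. J j i * c j))"
      by (rule ext, simp add: sum_distrib_left sum_distrib_right mult_ac) (rule sum.swap)
  qed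
qed

lemma mv_holomorphic_on_const: "mv_holomorphic_on (\<lambda>z. k) U"
  by (rule mv_holomorphic_onI[OF has_gradient_const])

lemma mv_holomorphic_on_coord: "mv_holomorphic_on (\<lambda>z. z $ j) U"
  by (rule mv_holomorphic_onI[OF has_gradient_coord])

lemma mv_holomorphic_on_add:
  "mv_holomorphic_on f U \<Longrightarrow> mv_holomorphic_on g U \<Longrightarrow> mv_holomorphic_on (\<lambda>z. f z + g z) U"
  by (rule mv_holomorphic_onI[OF has_gradient_add]) (auto intro: mv_holomorphic_onD)

lemma mv_holomorphic_on_mult:
  "mv_holomorphic_on f U \<Longrightarrow> mv_holomorphic_on g U \<Longrightarrow> mv_holomorphic_on (\<lambda>z. f z * g z) U"
  by (rule mv_holomorphic_onI[OF has_gradient_mult]) (auto intro: mv_holomorphic_onD)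

lemma mv_holomorphic_on_diff:
  "mv_holomorphic_on f U \<Longrightarrow> mv_holomorphic_on g U \<Longrightarrow> mv_holomorphic_on (\<lambda>z. f z - g z) U"
  using mv_holomorphic_on_add[of f U "\<lambda>z. (-1) * g z"] mv_holomorphic_on_mult[of "\<lambda>z. -1" U g]
  by (simp add: mv_holomorphic_on_const)

lemma mv_holomorphic_on_sum:
  "(\<And>k. k \<in> A \<Longrightarrow> mv_holomorphic_on (f k) U) \<Longrightarrow> mv_holomorphic_on (\<lambda>z. \<Sum>k\<in>A. f k z) U"
  by (induction A rule: infinite_finite_induct)
     (auto intro: mv_holomorphic_on_const mv_holomorphic_on_add)

lemma mv_holomorphic_on_power:
  "mv_holomorphic_on f U \<Longrightarrow> mv_holomorphic_on (\<lambda>z. f z ^ k) U"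
  by (induction k) (auto intro: mv_holomorphic_on_const mv_holomorphic_on_mult)

lemma mv_holomorphic_on_inverse:
  "mv_holomorphic_on f U \<Longrightarrow> (\<And>z. z \<in> U \<Longrightarrow> f z \<noteq> 0) \<Longrightarrow> mv_holomorphic_on (\<lambda>z. inverse (f z)) U"
  by (rule mv_holomorphic_onI[OF has_gradient_inverse]) (auto intro: mv_holomorphic_onD)

lemma mv_holomorphic_on_compose:
  assumes "holomorphic_map_on \<phi> U" "mv_holomorphic_on h V" "\<phi> ` U \<subseteq> V"
  shows "mv_holomorphic_on (\<lambda>z. h (\<phi> z)) U"
  by (rule mv_holomorphic_onI, rule has_gradient_compose)
     (use assms in \<open>auto simp: holomorphic_map_on_def intro!: mv_holomorphic_onD\<close>)

lemma mv_holomorphic_on_cong: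
  assumes "mv_holomorphic_on f U" "open U" "\<And>z. z \<in> U \<Longrightarrow> f z = g z"
  shows "mv_holomorphic_on g U"
  by (rule mv_holomorphic_onI, rule has_gradient_transform[OF mv_holomorphic_onD[OF assms(1)]])
     (use assms in auto)

lemma partial_deriv_cong:
  assumes "open U" "z \<in> U" "\<And>w. w \<in> U \<Longrightarrow> f w = g w"
  shows "partial_deriv i f z = partial_deriv i g z"
proof -
  have "bounded_linear (\<lambda>t::complex. axis i t)"
    unfolding linear_conv_bounded_linear[symmetric]
    by (intro linearI) (auto simp: vec_eq_iff axis_def)
  then have "((\<lambda>t::complex. z + axis i t) \<longlongrightarrow> z + axis i 0) (nhds 0)"
    by (intro tendsto_add[OF tendsto_const] bounded_linear.tendsto[OF _ filterlim_ident])
  moreover have "z + axis i 0 = z"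
    by (simp add: vec_eq_iff axis_def)
  ultimately have "eventually (\<lambda>t. z + axis i t \<in> U) (nhds 0)"
    using assms(1,2) by (auto dest: topological_tendstoD)
  then have "eventually (\<lambda>t. f (z + axis i t) = g (z + axis i t)) (nhds 0)"
    by eventually_elim (rule assms(3))
  then show ?thesis unfolding partial_deriv_def by (intro deriv_cong_ev) auto
qed

lemma mv_holomorphic_on_imp_continuous_on:
  "mv_holomorphic_on f U \<Longrightarrow> continuous_on U f"
  by (meson has_derivative_continuous_on has_derivative_at_withinI mv_holomorphic_on_def)

lemma partial_deriv_add:
  "mv_holomorphic_on f U \<Longrightarrow> mv_holomorphic_on g U \<Longrightarrow> z \<in> U \<Longrightarrow>
   partial_deriv i (\<lambda>z. f z + g z) z = partial_deriv i f z + partial_deriv i g z"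
  by (intro has_gradient_imp_partial_deriv[OF has_gradient_add]) (auto intro: mv_holomorphic_onD)

lemma partial_deriv_mult:
  "mv_holomorphic_on f U \<Longrightarrow> mv_holomorphic_on g U \<Longrightarrow> z \<in> U \<Longrightarrow>
   partial_deriv i (\<lambda>z. f z * g z) z = partial_deriv i f z * g z + f z * partial_deriv i g z"
  by (intro has_gradient_imp_partial_deriv[OF has_gradient_mult]) (auto intro: mv_holomorphic_onD)

lemma partial_deriv_sum:
  "(\<And>k. k \<in> A \<Longrightarrow> mv_holomorphic_on (f k) U) \<Longrightarrow> z \<in> U \<Longrightarrow>
   partial_deriv i (\<lambda>z. \<Sum>k\<in>A. f k z) z = (\<Sum>k\<in>A. partial_deriv i (f k) z)"
  by (intro has_gradient_imp_partial_deriv[OF has_gradient_sum]) (auto intro: mv_holomorphic_onD)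

lemma partial_deriv_const: "partial_deriv i (\<lambda>z. k) z = 0"
  by (simp add: partial_deriv_def)

lemma partial_deriv_inverse:
  "mv_holomorphic_on f U \<Longrightarrow> z \<in> U \<Longrightarrow> f z \<noteq> 0 \<Longrightarrow>
   partial_deriv i (\<lambda>z. inverse (f z)) z = - partial_deriv i f z / (f z)^2"
  by (subst has_gradient_imp_partial_deriv[OF has_gradient_inverse, OF mv_holomorphic_onD])
     (auto simp: field_simps power2_eq_square)

section \<open>Holomorphy of partial derivatives\<close>

lemma norm_axis_complex: "norm (axis i (t::complex)) = norm t"
  by (simp add: norm_vec_def L2_set_def axis_def if_distrib[of norm] if_distrib[of "\<lambda>x. x^2"] cong: if_cong)

text \<open>Cauchy's estimate on a disc in the line through \<open>z\<close> parallel to the \<open>i\<close>-th axis.\<close>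
lemma norm_partial_deriv_le:
  assumes "mv_holomorphic_on f U" "0 < r"
    and U: "\<And>t. norm t \<le> r \<Longrightarrow> z + axis i t \<in> U"
    and B: "\<And>t. norm t \<le> r \<Longrightarrow> norm (f (z + axis i t)) \<le> B"
  shows "norm (partial_deriv i f z) \<le> B / r"
proof -
  let ?h = "\<lambda>t. f (z + axis i t)"
  have d: "(?h has_field_derivative partial_deriv i f (z + axis i t)) (at t)" if "norm t \<le> r" for t
    by (rule has_gradient_axis, rule mv_holomorphic_onD[OF assms(1) U[OF that]])
  have hol: "?h holomorphic_on cball 0 r"
    unfolding holomorphic_on_def field_differentiable_def
    by (intro ballI exI, rule DERIV_subset[OF d]) auto
  have "norm ((deriv ^^ 1) ?h 0) \<le> fact 1 * B / r ^ 1"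
    by (rule Cauchy_inequality[OF holomorphic_on_subset[OF hol] holomorphic_on_imp_continuous_on[OF hol] assms(2)])
       (auto intro: B)
  then show ?thesis by (simp add: partial_deriv_def)
qed

text \<open>Taylor's formula of order two; the constant comes from Cauchy's estimate for the second derivative on
  discs of radius \<open>r / 2\<close>. The bound shows that difference quotients converge uniformly.\<close>
lemma difference_quotient_bound:
  fixes \<phi> :: "complex \<Rightarrow> complex"
  assumes hol: "\<phi> holomorphic_on ball 0 (2 * r)" and r: "0 < r"
    and B: "\<And>t. norm t \<le> r \<Longrightarrow> norm (\<phi> t) \<le> B"
    and h: "norm h \<le> r / 2"
  shows "norm (\<phi> h - \<phi> 0 - h * deriv \<phi> 0) \<le> 8 * B / r^2 * norm h ^ 2"
proof -
  have hd: "(deriv ^^ k) \<phi> holomorphic_on ball 0 (2 * r)" for k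
    using hol by (simp add: holomorphic_higher_deriv)
  have "norm ((\<lambda>i. (deriv ^^ i) \<phi>) 0 h - (\<Sum>i\<le>1. (\<lambda>i. (deriv ^^ i) \<phi>) i 0 * (h - 0) ^ i / fact i))
      \<le> (8 * B / r^2) * norm (h - 0) ^ Suc 1 / fact 1"
  proof (rule complex_Taylor[where S = "cball 0 (r/2)"])
    fix k x assume x: "x \<in> cball (0::complex) (r / 2)"
    then have x2: "x \<in> ball 0 (2 * r)" using r by auto
    show "((deriv ^^ k) \<phi> has_field_derivative (deriv ^^ Suc k) \<phi> x) (at x within cball 0 (r / 2))"
      using holomorphic_derivI[OF hd[of k] open_ball x2] by (auto intro: DERIV_subset)
  next
    fix x assume x: "x \<in> cball (0::complex) (r / 2)"
    have sub: "cball x (r/2) \<subseteq> ball 0 (2 * r)" "cball x (r/2) \<subseteq> cball 0 r"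
    proof -
      have "norm y \<le> r" if "norm (x - y) \<le> r / 2" for y
        using norm_triangle_sub[of y x] that x by (simp add: norm_minus_commute)
      then show "cball x (r/2) \<subseteq> cball 0 r" by (auto simp: dist_norm)
      with r show "cball x (r/2) \<subseteq> ball 0 (2 * r)" by fastforce
    qed
    have "norm ((deriv ^^ 2) \<phi> x) \<le> fact 2 * B / (r/2) ^ 2"
    proof (rule Cauchy_inequality)
      show "\<phi> holomorphic_on ball x (r / 2)"
        using hol sub(1) by (meson ball_subset_cball holomorphic_on_subset)
      show "continuous_on (cball x (r / 2)) \<phi>"
        using hol sub(1) by (meson holomorphic_on_subset holomorphic_on_imp_continuous_on)
      show "norm (\<phi> w) \<le> B" if "norm (x - w) = r / 2" for w
        using sub(2) that by (intro B) (auto simp: dist_norm subset_iff)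
    qed (use r in auto)
    also have "\<dots> = 8 * B / r^2" by (simp add: power2_eq_square)
    finally show "norm ((deriv ^^ Suc 1) \<phi> x) \<le> 8 * B / r^2" by (simp add: numeral_2_eq_2)
  qed (use h r in auto)
  then show ?thesis by (simp add: algebra_simps power2_eq_square)
qed

lemma norm_sum_mult_le:
  fixes v :: "complex^'n::finite"
  assumes "\<And>i. norm (c i) \<le> e"
  shows "norm (\<Sum>i\<in>UNIV. v $ i * c i) \<le> real CARD('n) * e * norm v"
proof -
  have e: "0 \<le> e" using assms norm_ge_zero order_trans by blast
  have "norm (\<Sum>i\<in>UNIV. v $ i * c i) \<le> (\<Sum>i\<in>(UNIV::'n set). norm v * e)"
    by (intro order_trans[OF norm_sum] sum_mono) (auto simp: norm_mult intro!: mult_mono component_le_norm_cart assms Finite_Cartesian_Product.norm_nth_le)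
  then show ?thesis by (simp add: mult_ac)
qed

text \<open>Cauchy's estimate, applied to the differences \<open>F n - F m\<close>, turns uniform convergence of the functions into
  uniform convergence of their partial derivatives on a smaller ball. The limits of the partial derivatives are
  then the partial derivatives of the limit.\<close>
lemma uniform_limit_has_gradient:
  fixes F :: "nat \<Rightarrow> complex^'n::finite \<Rightarrow> complex"
  assumes R: "0 < R" and hol: "\<And>n. mv_holomorphic_on (F n) (ball z0 (2 * R))"
    and e: "e \<longlonglongrightarrow> 0"
    and bound: "\<And>n z. z \<in> ball z0 (2 * R) \<Longrightarrow> norm (F n z - g z) \<le> e n"
  shows "\<exists>c. has_gradient g c z0"
proof -
  let ?G = "\<lambda>j n z. partial_deriv j (F n) z"
  have diff: "norm (?G j n z - ?G j m z) \<le> (e n + e m) / (R/2)" if z: "z \<in> ball z0 R" for j n m z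
  proof -
    have "norm (partial_deriv j (\<lambda>z. F n z - F m z) z) \<le> (e n + e m) / (R/2)"
    proof (rule norm_partial_deriv_le[OF mv_holomorphic_on_diff[OF hol hol]])
      fix t :: complex assume t: "norm t \<le> R/2"
      have "dist z0 (z + axis j t) \<le> dist z0 z + dist z (z + axis j t)" by (rule dist_triangle)
      also have "\<dots> < 2 * R" using z t R by (simp add: dist_norm norm_axis_complex)
      finally show I: "z + axis j t \<in> ball z0 (2 * R)" by simp
      have "norm (F n (z + axis j t) - F m (z + axis j t)) =
          norm ((F n (z + axis j t) - g (z + axis j t)) - (F m (z + axis j t) - g (z + axis j t)))" by simp
      also have "\<dots> \<le> e n + e m"
        by (intro order_trans[OF norm_triangle_ineq4] add_mono bound I)
      finally show "norm (F n (z + axis j t) - F m (z + axis j t)) \<le> e n + e m" .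
    qed (use R in auto)
    moreover have "z \<in> ball z0 (2 * R)" using z R by auto
    then have "partial_deriv j (\<lambda>z. F n z - F m z) z = ?G j n z - ?G j m z"
      using partial_deriv_add[OF hol[of n] mv_holomorphic_on_mult[OF mv_holomorphic_on_const[of "-1"] hol[of m]], of z j]
        partial_deriv_mult[OF mv_holomorphic_on_const[of "-1"] hol[of m], of z j]
      by (simp add: partial_deriv_const)
    ultimately show ?thesis by simp
  qed
  have small: "\<exists>N. \<forall>n\<ge>N. e n < d" if "0 < d" for d :: real
    using order_tendstoD(2)[OF e that] by (simp add: eventually_sequentially)
  have conv: "convergent (\<lambda>n. ?G j n z)" if z: "z \<in> ball z0 R" for j z
  proof (rule Cauchy_convergent, rule CauchyI)
    fix d :: real assume d: "0 < d"
    obtain N where N: "\<And>n. n \<ge> N \<Longrightarrow> e n < d * R / 4" using small[of "d * R / 4"] d R by auto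
    have "norm (?G j n z - ?G j m z) < d" if "n \<ge> N" "m \<ge> N" for n m
    proof -
      have "norm (?G j n z - ?G j m z) \<le> (e n + e m) / (R/2)" by (rule diff[OF z])
      also have "\<dots> < (d * R / 4 + d * R / 4) / (R/2)"
        using R N that by (intro divide_strict_right_mono add_strict_mono) auto
      finally show ?thesis using R by simp
    qed
    then show "\<exists>M. \<forall>m\<ge>M. \<forall>n\<ge>M. norm (?G j m z - ?G j n z) < d" by blast
  qed
  define G where "G = (\<lambda>j z. lim (\<lambda>n. ?G j n z))"
  have lim: "(\<lambda>m. ?G j m z) \<longlonglongrightarrow> G j z" if "z \<in> ball z0 R" for j z
    using conv[OF that, of j] by (simp add: G_def convergent_LIMSEQ_iff)
  have Gb: "norm (?G j n z - G j z) \<le> e n / (R/2)" if z: "z \<in> ball z0 R" for j n z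
  proof (rule LIMSEQ_le)
    show "(\<lambda>m. norm (?G j n z - ?G j m z)) \<longlonglongrightarrow> norm (?G j n z - G j z)"
      by (intro tendsto_intros lim z)
    show "(\<lambda>m. (e n + e m) / (R/2)) \<longlonglongrightarrow> e n / (R/2)"
      using tendsto_divide[OF tendsto_add[OF tendsto_const[of "e n"] e] tendsto_const[of "R/2"]] R by simp
    show "\<exists>N. \<forall>m\<ge>N. norm (?G j n z - ?G j m z) \<le> (e n + e m) / (R/2)" using diff[OF z] by blast
  qed
  have z0: "z0 \<in> ball z0 R" using R by simp
  have "\<exists>h. \<forall>x\<in>ball z0 R. (\<lambda>n. F n x) \<longlonglongrightarrow> h x \<and>
      (h has_derivative (\<lambda>v. \<Sum>j\<in>UNIV. v $ j * G j x)) (at x within ball z0 R)"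
  proof (rule has_derivative_sequence[OF convex_ball _ _ z0])
    fix n x assume "x \<in> ball z0 R"
    then have "x \<in> ball z0 (2 * R)" using R by auto
    from mv_holomorphic_onD[OF hol this, of n]
    show "(F n has_derivative (\<lambda>v. \<Sum>j\<in>UNIV. v $ j * ?G j n x)) (at x within ball z0 R)"
      unfolding has_gradient_def by (rule has_derivative_at_withinI)
  next
    fix d :: real assume d: "0 < d"
    let ?d = "d * R / (2 * real CARD('n))"
    obtain N where N: "\<And>n. n \<ge> N \<Longrightarrow> e n < ?d" using small[of ?d] d R by auto
    have "norm ((\<Sum>j\<in>UNIV. v $ j * ?G j n x) - (\<Sum>j\<in>UNIV. v $ j * G j x)) \<le> d * norm v"
      if "n \<ge> N" "x \<in> ball z0 R" for n x v
    proof -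
      have "(\<Sum>j\<in>UNIV. v $ j * ?G j n x) - (\<Sum>j\<in>UNIV. v $ j * G j x) = (\<Sum>j\<in>UNIV. v $ j * (?G j n x - G j x))"
        by (simp add: algebra_simps sum_subtractf)
      moreover have "norm (\<Sum>j\<in>UNIV. v $ j * (?G j n x - G j x)) \<le> real CARD('n) * (?d / (R/2)) * norm v"
        by (rule norm_sum_mult_le, rule order_trans[OF Gb[OF that(2)]],
            rule divide_right_mono[OF less_imp_le[OF N[OF that(1)]]]) (use R in simp)
      ultimately show ?thesis using R by simp
    qed
    then show "\<forall>\<^sub>F n in sequentially. \<forall>x\<in>ball z0 R. \<forall>h.
        norm ((\<Sum>j\<in>UNIV. h $ j * ?G j n x) - (\<Sum>j\<in>UNIV. h $ j * G j x)) \<le> d * norm h"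
      unfolding eventually_sequentially by blast
  next
    show "(\<lambda>n. F n z0) \<longlonglongrightarrow> g z0"
    proof (rule LIM_zero_cancel, rule tendsto_norm_zero_cancel, rule tendsto_sandwich[OF _ _ tendsto_const e])
      show "\<forall>\<^sub>F n in sequentially. norm (F n z0 - g z0) \<le> e n" using bound[of z0] R by simp
    qed simp
  qed
  then obtain h where h: "\<And>x. x \<in> ball z0 R \<Longrightarrow> (\<lambda>n. F n x) \<longlonglongrightarrow> h x"
      "(h has_derivative (\<lambda>v. \<Sum>j\<in>UNIV. v $ j * G j z0)) (at z0 within ball z0 R)" using z0 by blast
  have hg: "h x = g x" if x: "x \<in> ball z0 R" for x
  proof (rule LIMSEQ_unique[OF h(1)[OF x]])
    show "(\<lambda>n. F n x) \<longlonglongrightarrow> g x"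
    proof (rule LIM_zero_cancel, rule tendsto_norm_zero_cancel, rule tendsto_sandwich[OF _ _ tendsto_const e])
      show "\<forall>\<^sub>F n in sequentially. norm (F n x - g x) \<le> e n" using bound[of x] x R by simp
    qed simp
  qed
  have "has_gradient h (\<lambda>j. G j z0) z0"
    using h(2) z0 unfolding has_gradient_def by (simp add: at_within_open[OF z0 open_ball])
  then have "has_gradient g (\<lambda>j. G j z0) z0"
    by (rule has_gradient_transform[OF _ open_ball z0 hg])
  then show ?thesis by blast
qed

lemma mv_holomorphic_on_translate:
  assumes "mv_holomorphic_on f U" "\<And>z. z \<in> V \<Longrightarrow> z + a \<in> U"
  shows "mv_holomorphic_on (\<lambda>z. f (z + a)) V"
proof (rule mv_holomorphic_on_compose[OF _ assms(1)])
  show "holomorphic_map_on (\<lambda>z. z + a) V"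
    by (auto simp: holomorphic_map_on_def intro: mv_holomorphic_on_add mv_holomorphic_on_coord mv_holomorphic_on_const)
qed (use assms in auto)

text \<open>The difference quotients in direction \<open>i\<close> are holomorphic and converge locally uniformly. This avoids any
  assumption of continuity on the partial derivatives.\<close>
theorem mv_holomorphic_on_partial_deriv:
  assumes hol: "mv_holomorphic_on f U" and U: "open U"
  shows "mv_holomorphic_on (partial_deriv i f) U"
  unfolding mv_holomorphic_on_def complex_derivative_iff_has_gradient
proof
  fix z0 assume "z0 \<in> U"
  then obtain r where r: "0 < r" "cball z0 r \<subseteq> U" using U open_contains_cball by blast
  \<comment> \<open>Points of the ball of radius \<open>2 R\<close> may then be moved by \<open>2 R\<close>.\<close>
  define R where "R = r / 4"
  have R: "0 < R" "cball z0 (4 * R) \<subseteq> U" using r by (auto simp: R_def)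
  have "continuous_on (cball z0 (4 * R)) f"
    using mv_holomorphic_on_imp_continuous_on[OF hol] R(2) continuous_on_subset by blast
  then have "bounded (f ` cball z0 (4 * R))"
    by (intro compact_imp_bounded compact_continuous_image compact_cball)
  then obtain B where B: "\<And>z. z \<in> cball z0 (4 * R) \<Longrightarrow> norm (f z) \<le> B"
    unfolding bounded_iff by blast
  define h where "h = (\<lambda>n. R / (real n + 2))"
  have h: "0 < h n" "h n \<le> R / 2" for n using R by (auto simp: h_def field_simps)
  have h0: "h \<longlonglongrightarrow> 0" unfolding h_def by real_asymp
  have in4: "z + axis i t \<in> cball z0 (4 * R)" if "z \<in> ball z0 (2 * R)" "norm t \<le> 2 * R" for z t
  proof -
    have "dist z0 (z + axis i t) \<le> dist z0 z + dist z (z + axis i t)" by (rule dist_triangle)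
    also have "\<dots> \<le> 4 * R" using that by (simp add: dist_norm norm_axis_complex)
    finally show ?thesis by simp
  qed
  have nh: "norm (complex_of_real (h n)) = h n" for n using h(1)[of n] by simp
  show "\<exists>c. has_gradient (partial_deriv i f) c z0"
  proof (rule uniform_limit_has_gradient[where F = "\<lambda>n z. (f (z + axis i (of_real (h n))) - f z) * inverse (of_real (h n))"
        and e = "\<lambda>n. 8 * B / R^2 * h n"])
    fix n
    show "mv_holomorphic_on (\<lambda>z. (f (z + axis i (of_real (h n))) - f z) * inverse (of_real (h n))) (ball z0 (2 * R))"
    proof (intro mv_holomorphic_on_mult mv_holomorphic_on_diff mv_holomorphic_on_const
         mv_holomorphic_on_translate[OF hol] mv_holomorphic_on_subset[OF hol])
      show "z + axis i (of_real (h n)) \<in> U" if "z \<in> ball z0 (2 * R)" for z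
        using in4[OF that, of "of_real (h n)"] R h[of n] by (auto simp: nh)
      show "ball z0 (2 * R) \<subseteq> U" using R by auto
    qed
  next
    show "(\<lambda>n. 8 * B / R\<^sup>2 * h n) \<longlonglongrightarrow> 0"
      using tendsto_mult_left[OF h0, of "8 * B / R\<^sup>2"] by simp
  next
    fix n z assume z: "z \<in> ball z0 (2 * R)"
    let ?p = "\<lambda>t. f (z + axis i t)"
    have d: "(?p has_field_derivative partial_deriv i f (z + axis i t)) (at t)" if "norm t \<le> 2 * R" for t
      by (rule has_gradient_axis, rule mv_holomorphic_onD[OF hol]) (use in4[OF z that] R in auto)
    have hp: "?p holomorphic_on ball 0 (2 * R)"
      unfolding holomorphic_on_def field_differentiable_def
      by (intro ballI exI, rule DERIV_subset[OF d]) auto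
    have "norm (?p (of_real (h n)) - ?p 0 - of_real (h n) * deriv ?p 0) \<le> 8 * B / R^2 * norm (complex_of_real (h n)) ^ 2"
      by (rule difference_quotient_bound[OF hp R(1)]) (use in4[OF z] R h[of n] in \<open>auto simp: nh intro!: B\<close>)
    then have "norm ((f (z + axis i (of_real (h n))) - f z) - of_real (h n) * partial_deriv i f z) \<le> 8 * B / R^2 * h n ^ 2"
      using axis_eq_0_iff[of i "0::complex"] unfolding nh partial_deriv_def
      by (simp add: axis_eq_scale[of i 0])
    then have "norm ((f (z + axis i (of_real (h n))) - f z) - of_real (h n) * partial_deriv i f z) / h n \<le> 8 * B / R^2 * h n"
      using h[of n] by (simp add: divide_le_eq power2_eq_square mult.assoc)
    moreover have "((f (z + axis i (of_real (h n))) - f z) * inverse (of_real (h n)) - partial_deriv i f z)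
       = ((f (z + axis i (of_real (h n))) - f z) - of_real (h n) * partial_deriv i f z) / of_real (h n)"
      using h[of n] by (simp add: field_simps)
    ultimately show "norm ((f (z + axis i (of_real (h n))) - f z) * inverse (of_real (h n)) - partial_deriv i f z) \<le> 8 * B / R\<^sup>2 * h n"
      by (simp only: norm_divide nh)
  qed (use R in auto)
qed

section \<open>Polynomials in several variables\<close>

abbreviation lookup where "lookup \<equiv> Poly_Mapping.lookup"
abbreviation keys where "keys \<equiv> Poly_Mapping.keys"

type_synonym 'n mpoly = "('n \<Rightarrow>\<^sub>0 nat) \<Rightarrow>\<^sub>0 complex"

definition Const :: "complex \<Rightarrow> 'n mpoly" where
  "Const c = Poly_Mapping.single 0 c"

definition Var :: "'n \<Rightarrow> 'n mpoly" where
  "Var i = Poly_Mapping.single (Poly_Mapping.single i 1) 1"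

definition peval_monom :: "('n::finite \<Rightarrow>\<^sub>0 nat) \<Rightarrow> complex^'n \<Rightarrow> complex" where
  "peval_monom \<nu> z = (\<Prod>i\<in>UNIV. z $ i ^ lookup \<nu> i)"

definition peval :: "'n::finite mpoly \<Rightarrow> complex^'n \<Rightarrow> complex" where
  "peval p z = (\<Sum>\<nu>\<in>keys p. lookup p \<nu> * peval_monom \<nu> z)"

text \<open>If the exponent of variable \<open>i\<close> is 0, the truncated subtraction leaves the monomial unchanged, but the
  coefficient is 0.\<close>
definition Diff :: "'n \<Rightarrow> 'n mpoly \<Rightarrow> 'n mpoly" where
  "Diff i p = (\<Sum>\<nu>\<in>keys p. Poly_Mapping.single (\<nu> - Poly_Mapping.single i 1) (of_nat (lookup \<nu> i) * lookup p \<nu>))"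

lemma mpoly_eq_sum_single: "p = (\<Sum>\<nu>\<in>keys p. Poly_Mapping.single \<nu> (lookup p \<nu>))"
proof (rule poly_mapping_eqI)
  fix k
  have "lookup (\<Sum>\<nu>\<in>keys p. Poly_Mapping.single \<nu> (lookup p \<nu>)) k =
     (\<Sum>\<nu>\<in>keys p. if \<nu> = k then lookup p \<nu> else 0)"
    by (simp add: lookup_sum lookup_single when_def)
  also have "\<dots> = lookup p k" by (simp add: sum.delta' in_keys_iff)
  finally show "lookup p k = lookup (\<Sum>\<nu>\<in>keys p. Poly_Mapping.single \<nu> (lookup p \<nu>)) k" ..
qed

lemma mpoly_single_induct [case_names zero single add]:
  assumes "P 0" "\<And>\<nu> c. P (Poly_Mapping.single \<nu> c)" "\<And>p q. P p \<Longrightarrow> P q \<Longrightarrow> P (p + q)"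
  shows "P (p :: 'n mpoly)"
proof -
  have "P (\<Sum>\<nu>\<in>A. Poly_Mapping.single \<nu> (lookup p \<nu>))" for A
    by (induction A rule: infinite_finite_induct) (auto intro: assms)
  from this[of "keys p"] show ?thesis by (simp flip: mpoly_eq_sum_single)
qed

lemma sum_keys_superset:
  assumes "finite A" "keys p \<subseteq> A" "\<And>\<nu>. f \<nu> 0 = 0"
  shows "(\<Sum>\<nu>\<in>keys p. f \<nu> (lookup p \<nu>)) = (\<Sum>\<nu>\<in>A. f \<nu> (lookup p \<nu>))"
  by (rule sum.mono_neutral_left) (use assms in \<open>auto simp: in_keys_iff\<close>)

lemma sum_keys_add:
  fixes p q :: "'n mpoly" and f :: "_ \<Rightarrow> complex \<Rightarrow> 'b::comm_monoid_add"
  assumes "\<And>\<nu>. f \<nu> 0 = 0" "\<And>\<nu> a b. f \<nu> (a + b) = f \<nu> a + f \<nu> b"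
  shows "(\<Sum>\<nu>\<in>keys (p + q). f \<nu> (lookup (p + q) \<nu>)) =
    (\<Sum>\<nu>\<in>keys p. f \<nu> (lookup p \<nu>)) + (\<Sum>\<nu>\<in>keys q. f \<nu> (lookup q \<nu>))"
  using sum_keys_superset[of "keys p \<union> keys q" "p + q" f] sum_keys_superset[of "keys p \<union> keys q" p f]
    sum_keys_superset[of "keys p \<union> keys q" q f] assms keys_add[of p q]
  by (simp add: sum.distrib lookup_add)

lemma peval_add: "peval (p + q) z = peval p z + peval q z"
  unfolding peval_def by (rule sum_keys_add) (auto simp: algebra_simps)

lemma peval_single: "peval (Poly_Mapping.single \<nu> c) z = c * peval_monom \<nu> z"
  by (simp add: peval_def)

lemma peval_zero [simp]: "peval 0 z = 0"
  by (simp add: peval_def)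

lemma peval_monom_add: "peval_monom (\<mu> + \<nu>) z = peval_monom \<mu> z * peval_monom \<nu> z"
  by (simp add: peval_monom_def lookup_add power_add prod.distrib)

lemma peval_mult: "peval (p * q) z = peval p z * peval q z"
proof (induction p rule: mpoly_single_induct)
  case (single \<mu> a)
  show ?case
    by (induction q rule: mpoly_single_induct)
       (auto simp: mult_single peval_single peval_monom_add peval_add algebra_simps)
qed (auto simp: peval_add algebra_simps)

lemma peval_Const [simp]: "peval (Const c) z = c"
  by (simp add: Const_def peval_single peval_monom_def)

lemma peval_Var [simp]: "peval (Var i) z = z $ i"
proof -
  have "(\<Prod>j\<in>UNIV. z $ j ^ (1 when i = j)) = (\<Prod>j\<in>UNIV. if i = j then z $ i else 1)"
    by (rule prod.cong) (auto simp: when_def)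
  then show ?thesis by (simp add: Var_def peval_single peval_monom_def lookup_single)
qed

lemma Const_simps: "Const 0 = 0" "Const 1 = 1" "Const (a + b) = Const a + Const b"
    "Const (a * b) = Const a * Const b" "Const (- a) = - Const a" "Const (a - b) = Const a - Const b"
  by (simp_all add: Const_def single_add mult_single single_uminus single_diff)

lemma of_nat_eq_Const: "of_nat n = Const (of_nat n)"
  by (simp add: Const_def)

lemma peval_one [simp]: "peval 1 z = 1"
  using peval_Const[of 1 z] by (simp add: Const_simps)

lemma peval_of_nat [simp]: "peval (of_nat n) z = of_nat n"
  by (simp add: of_nat_eq_Const)

lemma peval_power: "peval (p ^ k) z = peval p z ^ k"
  by (induction k) (auto simp: peval_mult)

lemma peval_sum: "peval (\<Sum>k\<in>A. p k) z = (\<Sum>k\<in>A. peval (p k) z)"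
  by (induction A rule: infinite_finite_induct) (auto simp: peval_add)

lemma peval_prod: "peval (\<Prod>k\<in>A. p k) z = (\<Prod>k\<in>A. peval (p k) z)"
  by (induction A rule: infinite_finite_induct) (auto simp: peval_mult)

lemma peval_uminus: "peval (- p) z = - peval p z"
  using peval_add[of p "- p" z] by (simp add: eq_neg_iff_add_eq_0 add.commute)

lemma peval_diff: "peval (p - q) z = peval p z - peval q z"
  using peval_add[of p "- q" z] by (simp add: peval_uminus)

lemma Var_power: "Var i ^ k = Poly_Mapping.single (Poly_Mapping.single i k) 1"
  by (induction k) (auto simp: Var_def mult_single simp flip: single_add)

lemma single_eq_prod_Var:
  "Poly_Mapping.single \<nu> c = Const c * (\<Prod>i\<in>UNIV. Var (i::'n::finite) ^ lookup \<nu> i)"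
proof -
  have "(\<Prod>i\<in>A. Var i ^ lookup \<nu> i) = Poly_Mapping.single (\<Sum>i\<in>A. Poly_Mapping.single i (lookup \<nu> i)) 1" for A :: "'n set"
    by (induction A rule: infinite_finite_induct) (auto simp: Var_power mult_single)
  moreover have "(\<Sum>i\<in>UNIV. Poly_Mapping.single i (lookup \<nu> i)) = \<nu>"
    by (rule poly_mapping_eqI) (simp add: lookup_sum lookup_single when_def)
  ultimately show ?thesis by (simp add: Const_def mult_single)
qed

lemma mpoly_induct [case_names Const Var add mult]:
  assumes C: "\<And>c. P (Const c)" and V: "\<And>i. P (Var i)"
    and A: "\<And>p q. P p \<Longrightarrow> P q \<Longrightarrow> P (p + q)" and M: "\<And>p q. P p \<Longrightarrow> P q \<Longrightarrow> P (p * q)"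
  shows "P (p :: 'n::finite mpoly)"
proof (induction p rule: mpoly_single_induct)
  case zero
  show ?case using C[of 0] by (simp add: Const_simps)
next
  case (single \<nu> c)
  have one: "P 1" using C[of 1] by (simp add: Const_simps)
  have "P (Var i ^ k)" for i k by (induction k) (auto intro: one V M)
  then have "P (\<Prod>i\<in>A. Var i ^ lookup \<nu> i)" for A
    by (induction A rule: infinite_finite_induct) (auto intro: one M)
  then show ?case unfolding single_eq_prod_Var by (intro M C)
qed (auto intro: A)

lemma Diff_add: "Diff i (p + q) = Diff i p + Diff i q"
  unfolding Diff_def by (rule sum_keys_add) (auto simp: algebra_simps single_add)

lemma Diff_single: "Diff i (Poly_Mapping.single \<nu> c) =
    Poly_Mapping.single (\<nu> - Poly_Mapping.single i 1) (of_nat (lookup \<nu> i) * c)"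
  by (simp add: Diff_def)

lemma Diff_zero [simp]: "Diff i 0 = 0"
  by (simp add: Diff_def)

lemma Diff_uminus: "Diff i (- p) = - Diff i p"
  using Diff_add[of i p "- p"] by (simp add: eq_neg_iff_add_eq_0 add.commute)

lemma Diff_diff: "Diff i (p - q) = Diff i p - Diff i q"
  using Diff_add[of i p "- q"] by (simp add: Diff_uminus)

lemma Diff_sum: "Diff i (\<Sum>k\<in>A. p k) = (\<Sum>k\<in>A. Diff i (p k))"
  by (induction A rule: infinite_finite_induct) (auto simp: Diff_add)

lemma minus_single_add:
  fixes \<mu> \<nu> :: "'n \<Rightarrow>\<^sub>0 nat"
  shows "lookup \<mu> i > 0 \<Longrightarrow> \<mu> - Poly_Mapping.single i 1 + \<nu> = \<mu> + \<nu> - Poly_Mapping.single i 1"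
  by (rule poly_mapping_eqI) (auto simp: lookup_add lookup_minus lookup_single when_def)

lemma Diff_mult: "Diff i (p * q) = Diff i p * q + p * Diff i q"
proof (induction p rule: mpoly_single_induct)
  case (single \<mu> a)
  show ?case
  proof (induction q rule: mpoly_single_induct)
    case (single \<nu> b)
    let ?e = "Poly_Mapping.single i (1::nat)"
    have 1: "Poly_Mapping.single (\<mu> - ?e + \<nu>) (of_nat (lookup \<mu> i) * a * b) =
        Poly_Mapping.single (\<mu> + \<nu> - ?e) (of_nat (lookup \<mu> i) * a * b)"
      by (cases "lookup \<mu> i = 0") (simp_all add: minus_single_add del: One_nat_def)
    have 2: "Poly_Mapping.single (\<mu> + (\<nu> - ?e)) (a * (of_nat (lookup \<nu> i) * b)) =
        Poly_Mapping.single (\<mu> + \<nu> - ?e) (a * (of_nat (lookup \<nu> i) * b))"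
      using minus_single_add[of \<nu> i \<mu>]
      by (cases "lookup \<nu> i = 0") (simp_all add: add.commute del: One_nat_def)
    show ?case
      unfolding mult_single Diff_single 1 2
      by (simp add: algebra_simps lookup_add flip: single_add)
  qed (auto simp: Diff_add algebra_simps)
qed (auto simp: Diff_add algebra_simps)

lemma Diff_Const [simp]: "Diff i (Const c) = 0"
  by (simp add: Const_def Diff_single)

lemma Diff_Var: "Diff i (Var j) = (if i = j then 1 else 0)"
  by (auto simp: Var_def Diff_single lookup_single)

lemma Diff_commute: "Diff i (Diff j p) = Diff j (Diff i (p :: 'n::finite mpoly))"
proof (induction p rule: mpoly_induct)
  case (Var k)
  have "Diff i (1 :: 'n mpoly) = 0" for i
    using Diff_Const[of i 1] by (simp add: Const_simps)
  then show ?case by (simp add: Diff_Var)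
qed (auto simp: Diff_add Diff_mult algebra_simps)

lemma lookup_Diff:
  "lookup (Diff i p) \<nu> = of_nat (lookup \<nu> i + 1) * lookup p (\<nu> + Poly_Mapping.single i 1)"
proof (induction p rule: mpoly_single_induct)
  case (single \<mu> c)
  let ?e = "Poly_Mapping.single i (1::nat)"
  show ?case
  proof (cases "\<mu> = \<nu> + ?e")
    case True
    then show ?thesis by (simp add: Diff_single lookup_add)
  next
    case False
    have "lookup \<mu> i = 0" if "\<mu> - ?e = \<nu>"
    proof (rule ccontr)
      assume "lookup \<mu> i \<noteq> 0"
      then have "\<mu> = \<mu> - ?e + ?e"
        by (intro poly_mapping_eqI) (auto simp: lookup_add lookup_minus lookup_single when_def)
      with that False show False by simp
    qed
    with False show ?thesis by (auto simp: Diff_single lookup_single when_def)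
  qed
qed (auto simp: Diff_add lookup_add algebra_simps)

lemma peval_has_gradient: "has_gradient (peval p) (\<lambda>i. peval (Diff i p) z) z"
proof (induction p rule: mpoly_induct)
  case (Const c)
  show ?case using has_gradient_const[of c z] by (simp add: fun_eq_iff[symmetric])
next
  case (Var i)
  have "(\<lambda>j. peval (Diff j (Var i)) z) = (\<lambda>j. if j = i then 1 else 0)"
    by (auto simp: Diff_Var)
  then show ?case using has_gradient_coord[of i z] by simp
next
  case (add p q)
  show ?case using has_gradient_add[OF add] by (simp add: peval_add Diff_add)
next
  case (mult p q)
  show ?case using has_gradient_mult[OF mult] by (simp add: peval_add peval_mult Diff_mult)
qed

lemma peval_holomorphic: "mv_holomorphic_on (peval p) U"
  by (rule mv_holomorphic_onI[OF peval_has_gradient])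

lemma partial_deriv_peval: "partial_deriv i (peval p) z = peval (Diff i p) z"
  by (rule has_gradient_imp_partial_deriv[OF peval_has_gradient])

section \<open>Weighted homogeneous polynomials\<close>

definition weighted_deg :: "('n::finite \<Rightarrow> nat) \<Rightarrow> ('n \<Rightarrow>\<^sub>0 nat) \<Rightarrow> nat" where
  "weighted_deg W \<nu> = (\<Sum>i\<in>UNIV. W i * lookup \<nu> i)"

definition weighted_homog :: "('n::finite \<Rightarrow> nat) \<Rightarrow> nat \<Rightarrow> 'n mpoly \<Rightarrow> bool" where
  "weighted_homog W e p \<longleftrightarrow> (\<forall>\<nu>\<in>keys p. weighted_deg W \<nu> = e)"

definition weighted_part :: "('n::finite \<Rightarrow> nat) \<Rightarrow> nat \<Rightarrow> 'n mpoly \<Rightarrow> 'n mpoly" where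
  "weighted_part W e p = (\<Sum>\<nu>\<in>keys p. if weighted_deg W \<nu> = e then Poly_Mapping.single \<nu> (lookup p \<nu>) else 0)"

lemma weighted_deg_add: "weighted_deg W (\<mu> + \<nu>) = weighted_deg W \<mu> + weighted_deg W \<nu>"
  by (simp add: weighted_deg_def lookup_add algebra_simps sum.distrib)

lemma weighted_deg_single: "weighted_deg W (Poly_Mapping.single i k) = W i * k"
  by (simp add: weighted_deg_def lookup_single when_def if_distrib cong: if_cong)

lemma weighted_part_add: "weighted_part W e (p + q) = weighted_part W e p + weighted_part W e q"
  unfolding weighted_part_def by (rule sum_keys_add) (auto simp: single_add)

lemma weighted_part_single: "weighted_part W e (Poly_Mapping.single \<nu> c) = (if weighted_deg W \<nu> = e then Poly_Mapping.single \<nu> c else 0)"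
  by (simp add: weighted_part_def)

lemma weighted_part_zero [simp]: "weighted_part W e 0 = 0"
  by (simp add: weighted_part_def)

lemma weighted_part_sum: "weighted_part W e (\<Sum>k\<in>A. p k) = (\<Sum>k\<in>A. weighted_part W e (p k))"
  by (induction A rule: infinite_finite_induct) (auto simp: weighted_part_add)

lemma weighted_part_uminus: "weighted_part W e (- p) = - weighted_part W e p"
  using weighted_part_add[of W e p "- p"] by (simp add: eq_neg_iff_add_eq_0 add.commute)

lemma weighted_part_diff: "weighted_part W e (p - q) = weighted_part W e p - weighted_part W e q"
  using weighted_part_add[of W e p "- q"] by (simp add: weighted_part_uminus)

lemma lookup_weighted_part: "lookup (weighted_part W e p) \<nu> = (if weighted_deg W \<nu> = e then lookup p \<nu> else 0)"
  by (induction p rule: mpoly_single_induct)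
     (auto simp: weighted_part_add weighted_part_single lookup_add lookup_single when_def)

lemma weighted_homog_weighted_part: "weighted_homog W e (weighted_part W e p)"
  by (auto simp: weighted_homog_def in_keys_iff lookup_weighted_part split: if_splits)

lemma weighted_homog_iff_weighted_part: "weighted_homog W e p \<longleftrightarrow> weighted_part W e p = p"
proof
  assume "weighted_homog W e p"
  then show "weighted_part W e p = p"
    by (intro poly_mapping_eqI) (auto simp: lookup_weighted_part weighted_homog_def in_keys_iff)
qed (metis weighted_homog_weighted_part)

lemma weighted_homog_induct [consumes 1, case_names zero single add]:
  assumes "weighted_homog W e p" "P 0" "\<And>\<nu> c. weighted_deg W \<nu> = e \<Longrightarrow> P (Poly_Mapping.single \<nu> c)"
    "\<And>p q. P p \<Longrightarrow> P q \<Longrightarrow> P (p + q)"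
  shows "P p"
proof -
  have "A \<subseteq> keys p \<Longrightarrow> P (\<Sum>\<nu>\<in>A. Poly_Mapping.single \<nu> (lookup p \<nu>))" for A
    by (induction A rule: infinite_finite_induct) (use assms in \<open>auto simp: weighted_homog_def\<close>)
  from this[of "keys p"] show ?thesis by (simp flip: mpoly_eq_sum_single)
qed

lemma weighted_part_mult_weighted_homog:
  assumes "weighted_homog W d f"
  shows "weighted_part W (d + e) (f * p) = f * weighted_part W e p"
  using assms
proof (induction rule: weighted_homog_induct)
  case (single \<mu> a)
  then show ?case
    by (induction p rule: mpoly_single_induct)
       (auto simp: mult_single weighted_part_single weighted_deg_add weighted_part_add algebra_simps)
qed (auto simp: weighted_part_add algebra_simps)

lemma weighted_part_mult_weighted_homog_0:
  assumes "weighted_homog W d f" "e < d"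
  shows "weighted_part W e (f * p) = 0"
  using assms
proof (induction rule: weighted_homog_induct)
  case (single \<mu> a)
  then show ?case
    by (induction p rule: mpoly_single_induct)
       (auto simp: mult_single weighted_part_single weighted_deg_add weighted_part_add algebra_simps)
qed (auto simp: weighted_part_add algebra_simps)

lemma weighted_part_Diff: "weighted_part W e (Diff i p) = Diff i (weighted_part W (e + W i) p)"
proof (rule poly_mapping_eqI)
  fix \<nu> show "lookup (weighted_part W e (Diff i p)) \<nu> = lookup (Diff i (weighted_part W (e + W i) p)) \<nu>"
    by (auto simp: lookup_weighted_part lookup_Diff weighted_deg_add weighted_deg_single)
qed

lemma weighted_homog_Const: "weighted_homog W 0 (Const c)"
  by (auto simp: weighted_homog_def Const_def weighted_deg_def)

lemma weighted_homog_Var: "weighted_homog W (W i) (Var i)"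
  by (auto simp: weighted_homog_def Var_def weighted_deg_single)

lemma weighted_homog_add: "weighted_homog W e p \<Longrightarrow> weighted_homog W e q \<Longrightarrow> weighted_homog W e (p + q)"
  by (simp add: weighted_homog_iff_weighted_part weighted_part_add)

lemma weighted_homog_zero: "weighted_homog W e 0"
  by (simp add: weighted_homog_def)

lemma weighted_homog_sum: "(\<And>k. k \<in> A \<Longrightarrow> weighted_homog W e (p k)) \<Longrightarrow> weighted_homog W e (\<Sum>k\<in>A. p k)"
  by (induction A rule: infinite_finite_induct) (auto intro: weighted_homog_add weighted_homog_zero)

lemma weighted_homog_mult: "weighted_homog W d p \<Longrightarrow> weighted_homog W e q \<Longrightarrow> weighted_homog W (d + e) (p * q)"
  using weighted_part_mult_weighted_homog[of W d p e q] by (simp add: weighted_homog_iff_weighted_part)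

lemma weighted_homog_power: "weighted_homog W d p \<Longrightarrow> weighted_homog W (k * d) (p ^ k)"
  using weighted_homog_Const[of W 1] by (induction k) (auto intro: weighted_homog_mult simp: Const_simps)

lemma weighted_homog_Diff: "weighted_homog W (e + W i) p \<Longrightarrow> weighted_homog W e (Diff i p)"
  by (simp add: weighted_homog_iff_weighted_part weighted_part_Diff)

lemma single_sum: "Poly_Mapping.single \<nu> (\<Sum>k\<in>A. f k) = (\<Sum>k\<in>A. Poly_Mapping.single \<nu> (f k))"
  by (induction A rule: infinite_finite_induct) (auto simp: single_add)

lemma euler_identity:
  assumes "weighted_homog W e p"
  shows "(\<Sum>i\<in>UNIV. of_nat (W i) * Var i * Diff i p) = of_nat e * p"
  using assms
proof (induction rule: weighted_homog_induct)
  case (single \<nu> c)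
  have "of_nat (W i) * Var i * Diff i (Poly_Mapping.single \<nu> c) =
      Poly_Mapping.single \<nu> (of_nat (W i * lookup \<nu> i) * c)" for i
  proof (cases "lookup \<nu> i = 0")
    case False
    then have "Poly_Mapping.single i 1 + (\<nu> - Poly_Mapping.single i 1) = \<nu>"
      by (intro poly_mapping_eqI) (auto simp: lookup_add lookup_minus lookup_single when_def)
    moreover have "of_nat (W i) * Var i * Diff i (Poly_Mapping.single \<nu> c) = Poly_Mapping.single
        (0 + Poly_Mapping.single i 1 + (\<nu> - Poly_Mapping.single i 1)) (of_nat (W i) * 1 * (of_nat (lookup \<nu> i) * c))"
      unfolding of_nat_eq_Const Const_def Var_def Diff_single mult_single ..
    ultimately show ?thesis by (simp only: add_0 of_nat_mult mult_1_right mult.assoc)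
  qed (simp add: Diff_single)
  then have "(\<Sum>i\<in>UNIV. of_nat (W i) * Var i * Diff i (Poly_Mapping.single \<nu> c)) =
      Poly_Mapping.single \<nu> (of_nat (\<Sum>i\<in>UNIV. W i * lookup \<nu> i) * c)"
    by (simp only: single_sum of_nat_sum sum_distrib_right)
  also have "(\<Sum>i\<in>UNIV. W i * lookup \<nu> i) = e"
    using single by (simp add: weighted_deg_def)
  finally show ?case
    unfolding of_nat_eq_Const Const_def mult_single by simp
qed (simp_all add: Diff_add distrib_left sum.distrib)

lemma peval_weighted_scale:
  assumes "weighted_homog W e p"
  shows "peval p (\<chi> i. t ^ W i * z $ i) = t ^ e * peval p z"
  using assms
proof (induction rule: weighted_homog_induct)
  case (single \<nu> c)
  have "(\<Prod>i\<in>UNIV. t ^ (W i * lookup \<nu> i)) = t ^ e"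
    unfolding single[symmetric] weighted_deg_def by (rule power_sum[symmetric])
  then show ?case
    by (simp add: peval_single peval_monom_def power_mult_distrib prod.distrib power_mult[symmetric])
qed (simp_all add: peval_add distrib_left)

text \<open>Up to factorials, the coefficients are the values of the iterated derivatives at the origin.\<close>
lemma lookup_eq_0_if_Diff_vanish:
  assumes "\<And>w. length w < K \<Longrightarrow> peval (foldr Diff w p) 0 = 0" "weighted_deg (\<lambda>_. 1) \<nu> < K"
  shows "lookup p \<nu> = 0"
  using assms
proof (induction "weighted_deg (\<lambda>_. 1) \<nu>" arbitrary: \<nu> p K)
  case 0
  then have "\<nu> = 0" by (intro poly_mapping_eqI) (simp add: weighted_deg_def)
  moreover have "peval p 0 = lookup p 0"
  proof -
    have "peval_monom \<mu> 0 = (if \<mu> = 0 then 1 else 0)" for \<mu> :: "'a \<Rightarrow>\<^sub>0 nat"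
    proof (cases "\<mu> = 0")
      case False
      then obtain i where "lookup \<mu> i \<noteq> 0" by (metis lookup_zero poly_mapping_eqI)
      then show ?thesis using False by (auto simp: peval_monom_def intro!: bexI[of _ i])
    qed (simp add: peval_monom_def)
    then have "peval p 0 = (\<Sum>\<mu>\<in>keys p. if \<mu> = 0 then lookup p \<mu> else 0)"
      unfolding peval_def by (intro sum.cong) auto
    then show ?thesis by (simp add: in_keys_iff)
  qed
  ultimately show ?case using 0(2)[of "[]"] 0(3) by simp
next
  case (Suc n)
  have "\<exists>i. lookup \<nu> i \<noteq> 0"
  proof (rule ccontr)
    assume "\<not> (\<exists>i. lookup \<nu> i \<noteq> 0)"
    with Suc.hyps(2) show False by (simp add: weighted_deg_def)
  qed
  then obtain i where i: "lookup \<nu> i \<noteq> 0" ..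
  define \<mu> where "\<mu> = \<nu> - Poly_Mapping.single i 1"
  have \<nu>: "\<nu> = \<mu> + Poly_Mapping.single i 1"
    unfolding \<mu>_def using i
    by (intro poly_mapping_eqI) (auto simp: lookup_add lookup_minus lookup_single when_def)
  obtain K' where K': "K = Suc K'" using Suc.prems(2) by (cases K) auto
  have deg: "weighted_deg (\<lambda>_. 1) \<nu> = Suc (weighted_deg (\<lambda>_. 1) \<mu>)" by (simp add: \<nu> weighted_deg_add weighted_deg_single)
  have "lookup (Diff i p) \<mu> = 0"
  proof (rule Suc.hyps(1))
    show "n = weighted_deg (\<lambda>_. 1) \<mu>" using Suc.hyps(2) deg by simp
    show "peval (foldr Diff w (Diff i p)) 0 = 0" if "length w < K'" for w
      using Suc.prems(1)[of "w @ [i]"] that K' by simp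
    show "weighted_deg (\<lambda>_. 1) \<mu> < K'" using Suc.prems(2) deg K' by simp
  qed
  then show ?case unfolding lookup_Diff \<nu>[symmetric] by (simp flip: of_nat_Suc)
qed

section \<open>The Koszul complex\<close>

text \<open>The ideal generated by the first \<open>k\<close> entries of the sequence \<open>x\<close>.\<close>
definition gen_ideal :: "(nat \<Rightarrow> 'a::comm_ring_1) \<Rightarrow> nat \<Rightarrow> 'a set" where
  "gen_ideal x k = {a. \<exists>r. a = (\<Sum>l<k. x l * r l)}"

text \<open>An element of the exterior algebra on the index set is a function on subsets. With the ordering of the indices
  given by an injection \<open>e\<close>, the operator \<open>contract e f\<close> is the Koszul differential of the family \<open>f\<close>, and
  \<open>wedge e a\<close> is exterior multiplication by the one-form with coefficients \<open>a\<close>.\<close>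
definition ksign :: "('n \<Rightarrow> nat) \<Rightarrow> 'n \<Rightarrow> 'n set \<Rightarrow> 'a::comm_ring_1" where
  "ksign e j S = (- 1) ^ card {i \<in> S. e i < e j}"

definition contract :: "('n \<Rightarrow> nat) \<Rightarrow> ('n \<Rightarrow> 'a) \<Rightarrow> ('n::finite set \<Rightarrow> 'a) \<Rightarrow> 'n set \<Rightarrow> 'a::comm_ring_1" where
  "contract e f \<omega> S = (\<Sum>j\<in>-S. ksign e j S * f j * \<omega> (insert j S))"

definition wedge :: "('n \<Rightarrow> nat) \<Rightarrow> ('n \<Rightarrow> 'a) \<Rightarrow> ('n::finite set \<Rightarrow> 'a) \<Rightarrow> 'n set \<Rightarrow> 'a::comm_ring_1" where
  "wedge e a \<omega> S = (\<Sum>j\<in>S. ksign e j S * a j * \<omega> (S - {j}))"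

lemma gen_idealI: "a = (\<Sum>l<k. x l * r l) \<Longrightarrow> a \<in> gen_ideal x k"
  unfolding gen_ideal_def by (rule CollectI, rule exI)

lemma gen_idealE:
  assumes "a \<in> gen_ideal x k"
  obtains r where "a = (\<Sum>l<k. x l * r l)"
  using assms unfolding gen_ideal_def by auto

lemma gen_ideal_add: "a \<in> gen_ideal x k \<Longrightarrow> b \<in> gen_ideal x k \<Longrightarrow> a + b \<in> gen_ideal x k"
proof -
  assume "a \<in> gen_ideal x k" "b \<in> gen_ideal x k"
  then obtain r s where "a = (\<Sum>l<k. x l * r l)" "b = (\<Sum>l<k. x l * s l)"
    by (elim gen_idealE)
  then have "a + b = (\<Sum>l<k. x l * (r l + s l))" by (simp add: distrib_left sum.distrib)
  then show ?thesis by (rule gen_idealI)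
qed

lemma gen_ideal_mult: "a \<in> gen_ideal x k \<Longrightarrow> b * a \<in> gen_ideal x k"
proof -
  assume "a \<in> gen_ideal x k"
  then obtain r where "a = (\<Sum>l<k. x l * r l)" by (rule gen_idealE)
  then have "b * a = (\<Sum>l<k. x l * (b * r l))" by (simp add: sum_distrib_left mult_ac)
  then show ?thesis by (rule gen_idealI)
qed

lemma gen_ideal_0: "0 \<in> gen_ideal x k"
  unfolding gen_ideal_def by (auto intro!: exI[of _ "\<lambda>_. 0"])

lemma gen_ideal_sum: "(\<And>j. j \<in> A \<Longrightarrow> a j \<in> gen_ideal x k) \<Longrightarrow> (\<Sum>j\<in>A. a j) \<in> gen_ideal x k"
  by (induction A rule: infinite_finite_induct) (auto intro: gen_ideal_0 gen_ideal_add)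

lemma gen_ideal_Suc: "a \<in> gen_ideal x (Suc k) \<longleftrightarrow> (\<exists>b. a - x k * b \<in> gen_ideal x k)"
proof
  assume "a \<in> gen_ideal x (Suc k)"
  then obtain r where "a = (\<Sum>l<Suc k. x l * r l)" by (rule gen_idealE)
  then have "a - x k * r k = (\<Sum>l<k. x l * r l)" by simp
  then show "\<exists>b. a - x k * b \<in> gen_ideal x k" by (blast intro: gen_idealI)
next
  assume "\<exists>b. a - x k * b \<in> gen_ideal x k"
  then obtain b r where r: "a - x k * b = (\<Sum>l<k. x l * r l)" by (auto elim: gen_idealE)
  then have "a = (\<Sum>l<k. x l * r l) + x k * b" by (metis add.commute diff_add_cancel)
  also have "\<dots> = (\<Sum>l<Suc k. x l * (if l = k then b else r l))" by simp
  finally show "a \<in> gen_ideal x (Suc k)"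
    by (rule gen_idealI)
qed

lemma ksign_sq: "ksign e j S * ksign e j S = (1::'a::comm_ring_1)"
  by (simp add: ksign_def flip: power_add mult_2)

lemma ksign_insert:
  assumes "inj e" "i \<notin> S"
  shows "ksign e j (insert i S) = (if e i < e j then - ksign e j S else ksign e j (S :: 'n::finite set))"
proof -
  have "{k \<in> insert i S. e k < e j} = (if e i < e j then insert i {k \<in> S. e k < e j} else {k \<in> S. e k < e j})"
    by auto
  then show ?thesis using assms(2) by (simp add: ksign_def)
qed

lemma ksign_swap:
  assumes "inj e" "i \<noteq> j" "i \<notin> S" "j \<notin> S"
  shows "ksign e j S * ksign e i (insert j S) = - (ksign e i S * ksign e j (insert i (S :: 'n::finite set)) :: 'a::comm_ring_1)"
proof -
  have "e i \<noteq> e j" using assms by (auto dest: injD)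
  then show ?thesis using assms by (auto simp: ksign_insert)
qed

lemma sum_antisymmetric:
  fixes g :: "'n::finite \<Rightarrow> 'n \<Rightarrow> 'a::comm_ring_1"
  assumes "inj (e :: 'n \<Rightarrow> nat)" "\<And>i j. i \<noteq> j \<Longrightarrow> i \<in> A \<Longrightarrow> j \<in> A \<Longrightarrow> g i j = - g j i"
  shows "(\<Sum>i\<in>A. \<Sum>j\<in>A - {i}. g i j) = 0"
proof -
  let ?L = "{(i, j). i \<in> A \<and> j \<in> A \<and> e i < e j}" and ?G = "{(i, j). i \<in> A \<and> j \<in> A \<and> e j < e i}"
  have "(\<Sum>i\<in>A. \<Sum>j\<in>A - {i}. g i j) = (\<Sum>(i, j)\<in>(SIGMA i:A. A - {i}). g i j)"
    by (rule sum.Sigma) auto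
  also have "(SIGMA i:A. A - {i}) = ?L \<union> ?G"
    using assms(1) by (auto simp: inj_def) (metis linorder_neqE_nat)
  also have "(\<Sum>(i, j)\<in>?L \<union> ?G. g i j) = (\<Sum>(i, j)\<in>?L. g i j) + (\<Sum>(i, j)\<in>?G. g i j)"
    by (rule sum.union_disjoint) auto
  also have "(\<Sum>(i, j)\<in>?G. g i j) = (\<Sum>(i, j)\<in>?L. g j i)"
    by (rule sum.reindex_bij_witness[of _ prod.swap prod.swap]) auto
  also have "\<dots> = (\<Sum>(i, j)\<in>?L. - g i j)"
  proof (intro sum.cong refl)
    fix p assume "p \<in> ?L"
    then have "g (snd p) (fst p) = - g (fst p) (snd p)"
      by (intro assms(2)) auto
    then show "(case p of (i, j) \<Rightarrow> g j i) = (case p of (i, j) \<Rightarrow> - g i j)"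
      by (simp add: case_prod_unfold)
  qed
  finally show ?thesis by (simp add: sum_negf case_prod_unfold)
qed

lemma contract_contract:
  assumes "inj e"
  shows "contract e f (contract e f \<omega>) S = 0"
proof -
  have "contract e f (contract e f \<omega>) S =
     (\<Sum>j\<in>-S. \<Sum>i\<in>-S - {j}. ksign e j S * ksign e i (insert j S) * (f j * f i * \<omega> (insert i (insert j S))))"
    unfolding contract_def by (intro sum.cong refl) (auto simp: sum_distrib_left mult_ac Compl_insert)
  also have "\<dots> = 0"
    by (rule sum_antisymmetric[OF assms]) (subst ksign_swap[OF assms], auto simp: insert_commute mult_ac)
  finally show ?thesis .
qed

text \<open>Exterior multiplication by \<open>a\<close> is a homotopy from multiplication by \<open>\<Sum> a\<^sub>j f\<^sub>j\<close> to 0. So the ideal generated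
  by \<open>f\<close> annihilates Koszul homology.\<close>
lemma contract_wedge:
  fixes f a :: "'n::finite \<Rightarrow> 'a::comm_ring_1"
  assumes e: "inj e"
  shows "contract e f (wedge e a \<omega>) S + wedge e a (contract e f \<omega>) S = (\<Sum>j\<in>UNIV. a j * f j) * \<omega> S"
proof -
  let ?c = "\<lambda>j i. ksign e j S * ksign e i (insert j S) * (f j * a i * \<omega> (insert j S - {i}))"
  have s: "ksign e j (insert j S) = (ksign e j S :: 'a)" if "j \<notin> S" for j
    using ksign_insert[OF e that, of j, where 'a = 'a] by simp
  have "contract e f (wedge e a \<omega>) S = (\<Sum>j\<in>-S. a j * f j * \<omega> S + (\<Sum>i\<in>S. ?c j i))"
    unfolding contract_def wedge_def
  proof (intro sum.cong refl)
    fix j assume "j \<in> - S"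
    then have j: "j \<notin> S" by simp
    then have "(\<Sum>i\<in>insert j S. ksign e i (insert j S) * a i * \<omega> (insert j S - {i})) =
        ksign e j S * a j * \<omega> S + (\<Sum>i\<in>S. ksign e i (insert j S) * a i * \<omega> (insert j S - {i}))"
      by (simp add: s)
    moreover have "ksign e j S * f j * (ksign e j S * a j * \<omega> S) = (ksign e j S * ksign e j S) * (a j * f j * \<omega> S)"
      by (simp only: mult_ac)
    ultimately show "ksign e j S * f j * (\<Sum>i\<in>insert j S. ksign e i (insert j S) * a i * \<omega> (insert j S - {i})) =
        a j * f j * \<omega> S + (\<Sum>i\<in>S. ?c j i)"
      by (simp add: distrib_left sum_distrib_left ksign_sq mult_ac)
  qed
  moreover have "wedge e a (contract e f \<omega>) S = (\<Sum>i\<in>S. a i * f i * \<omega> S + (\<Sum>j\<in>-S. - ?c j i))"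
    unfolding contract_def wedge_def
  proof (intro sum.cong refl)
    fix i assume i: "i \<in> S"
    have C: "- (S - {i}) = insert i (- S)" using i by auto
    have S: "insert i (S - {i}) = S" using i by auto
    have si: "ksign e i (S - {i}) = (ksign e i S :: 'a)"
      using ksign_insert[OF e, of i "S - {i}" i, where 'a = 'a] unfolding S by simp
    have sw: "ksign e i S * ksign e j (S - {i}) = (- (ksign e j S * ksign e i (insert j S)) :: 'a)" if "j \<notin> S" for j
    proof -
      have "i \<noteq> j" using that i by auto
      then have "ksign e j (S - {i}) * ksign e i (insert j (S - {i})) = (- (ksign e i (S - {i}) * ksign e j (insert i (S - {i}))) :: 'a)"
        using that by (intro ksign_swap[OF e]) auto
      moreover have "ksign e i (insert j (S - {i})) = (ksign e i (insert j S) :: 'a)"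
      proof -
        have T: "insert i (insert j (S - {i})) = insert j S" using S by blast
        have "i \<notin> insert j (S - {i})" using \<open>i \<noteq> j\<close> by simp
        from ksign_insert[OF e this, of i, where 'a = 'a] show ?thesis unfolding T by simp
      qed
      moreover have "ksign e i S * ksign e j (S - {i}) =
          (ksign e i S * ksign e i (insert j S)) * (ksign e j (S - {i}) * ksign e i (insert j S) :: 'a)"
        using ksign_sq[of e i "insert j S", where 'a = 'a] by (metis mult.assoc mult.commute mult.left_neutral)
      ultimately show ?thesis
        using ksign_sq[of e i S, where 'a = 'a] unfolding S si
        by (metis (no_types, lifting) mult.assoc mult.commute mult.left_neutral mult_minus_right)
    qed
    have "ksign e i S * a i * (\<Sum>j\<in>- (S - {i}). ksign e j (S - {i}) * f j * \<omega> (insert j (S - {i}))) =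
        ksign e i S * a i * (ksign e i (S - {i}) * f i * \<omega> S) +
        (\<Sum>j\<in>-S. ksign e i S * a i * (ksign e j (S - {i}) * f j * \<omega> (insert j (S - {i}))))"
      unfolding C by (subst sum.insert) (use i in \<open>simp_all only: S distrib_left sum_distrib_left finite Compl_iff not_not if_False\<close>)
    also have "ksign e i S * a i * (ksign e i (S - {i}) * f i * \<omega> S) = (ksign e i S * ksign e i S) * (a i * f i * \<omega> S)"
      by (simp only: si mult_ac)
    also have "\<dots> = a i * f i * \<omega> S" by (simp add: ksign_sq)
    also have "(\<Sum>j\<in>-S. ksign e i S * a i * (ksign e j (S - {i}) * f j * \<omega> (insert j (S - {i})))) = (\<Sum>j\<in>-S. - ?c j i)"
    proof (intro sum.cong refl)
      fix j assume "j \<in> - S"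
      then have j: "j \<notin> S" by simp
      have "insert j (S - {i}) = insert j S - {i}" using i j by auto
      moreover have "ksign e i S * a i * (ksign e j (S - {i}) * f j * w) =
          (ksign e i S * ksign e j (S - {i})) * (f j * a i * w)" for w
        by (simp only: mult_ac)
      ultimately show "ksign e i S * a i * (ksign e j (S - {i}) * f j * \<omega> (insert j (S - {i}))) = - ?c j i"
        by (simp add: sw[OF j])
    qed
    finally show "ksign e i S * a i * (\<Sum>j\<in>- (S - {i}). ksign e j (S - {i}) * f j * \<omega> (insert j (S - {i}))) =
        a i * f i * \<omega> S + (\<Sum>j\<in>-S. - ?c j i)" .
  qed
  moreover have "(\<Sum>j\<in>-S. \<Sum>i\<in>S. ?c j i) = (\<Sum>i\<in>S. \<Sum>j\<in>-S. ?c j i)" by (rule sum.swap)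
  moreover have "(\<Sum>j\<in>UNIV. a j * f j * \<omega> S) = (\<Sum>j\<in>-S. a j * f j * \<omega> S) + (\<Sum>j\<in>S. a j * f j * \<omega> S)"
    using sum.union_disjoint[of "- S" S "\<lambda>j. a j * f j * \<omega> S"] by (simp add: Compl_partition2 Un_commute)
  ultimately show ?thesis
    by (simp add: sum.distrib sum_negf sum_subtractf sum_distrib_right)
qed

lemma contract_diff: "contract e f (\<lambda>S. \<omega> S - \<eta> S) S = contract e f \<omega> S - contract e f \<eta> S"
  by (simp add: contract_def right_diff_distrib sum_subtractf)

lemma contract_scale: "contract e f (\<lambda>S. c * \<omega> S) S = c * contract e f \<omega> S"
  by (simp add: contract_def sum_distrib_left mult_ac)

lemma contract_in_gen_ideal: "(\<And>S. \<omega> S \<in> gen_ideal x k) \<Longrightarrow> contract e f \<omega> S \<in> gen_ideal x k"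
  unfolding contract_def by (intro gen_ideal_sum gen_ideal_mult)

lemma wedge_in_gen_ideal: "(\<And>S. \<omega> S \<in> gen_ideal x k) \<Longrightarrow> wedge e f \<omega> S \<in> gen_ideal x k"
  unfolding wedge_def by (intro gen_ideal_sum gen_ideal_mult)

text \<open>Modulo \<open>x\<^sub>0, \<dots>, x\<^sub>k\<^sub>-\<^sub>1\<close> the Koszul homology of \<open>f\<close> vanishes in degrees above \<open>k\<close>. For \<open>k = CARD('n)\<close> there are no
  nonzero chains of such degree, and the induction goes down. Let \<open>\<omega>\<close> be a cycle modulo the first \<open>k\<close> elements, and
  \<open>x\<^sub>k = \<Sum> a\<^sub>j f\<^sub>j\<close>. Then \<open>x\<^sub>k \<omega>\<close> is the boundary of \<open>a \<and> \<omega>\<close>, so \<open>a \<and> \<omega>\<close> is a cycle modulo \<open>x\<^sub>k\<close> as well, and the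
  induction hypothesis writes it as a boundary plus \<open>x\<^sub>k \<beta>\<close>. The boundary of \<open>a \<and> \<omega>\<close> is therefore both \<open>x\<^sub>k \<omega>\<close> and
  \<open>x\<^sub>k\<close> times the boundary of \<open>\<beta>\<close>, and \<open>x\<^sub>k\<close> can be cancelled.\<close>
lemma koszul_acyclic_mod:
  fixes f :: "'n::finite \<Rightarrow> 'a::comm_ring_1"
  assumes e: "inj e"
    and in_ideal: "\<And>k. k < CARD('n) \<Longrightarrow> x k = (\<Sum>j\<in>UNIV. a k j * f j)"
    and regular: "\<And>k b. k < CARD('n) \<Longrightarrow> x k * b \<in> gen_ideal x k \<Longrightarrow> b \<in> gen_ideal x k"
    and "k \<le> CARD('n)" "k < j"
    and "\<And>S. card S \<noteq> j \<Longrightarrow> \<omega> S = 0"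
    and "\<And>S. contract e f \<omega> S \<in> gen_ideal x k"
  shows "\<exists>\<beta>. \<forall>S. \<omega> S - contract e f \<beta> S \<in> gen_ideal x k"
  using assms(4-)
proof (induction k arbitrary: j \<omega> rule: inc_induct)
  case base
  have "card S \<noteq> j" for S :: "'n set" using card_mono[of UNIV S] base.prems(1) by auto
  then have "\<omega> S = 0" for S using base.prems(2) by blast
  then show ?case by (intro exI[of _ "\<lambda>_. 0"]) (simp add: contract_def gen_ideal_0)
next
  case (step k)
  let ?w = "wedge e (a k) \<omega>"
  have k: "x k = (\<Sum>j\<in>UNIV. a k j * f j)" using in_ideal step.hyps(2) by simp
  have hom: "x k * \<omega> S - contract e f ?w S \<in> gen_ideal x k" for S
  proof -
    have "x k * \<omega> S - contract e f ?w S = wedge e (a k) (contract e f \<omega>) S"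
      using contract_wedge[OF e, of f "a k" \<omega> S] by (simp add: k algebra_simps)
    then show ?thesis using wedge_in_gen_ideal[OF step.prems(3)] by simp
  qed
  have "\<exists>\<eta>. \<forall>S. ?w S - contract e f \<eta> S \<in> gen_ideal x (Suc k)"
  proof (rule step.IH)
    show "Suc k < Suc j" using step.prems by simp
    show "?w S = 0" if "card S \<noteq> Suc j" for S
      unfolding wedge_def
    proof (intro sum.neutral ballI)
      fix i assume "i \<in> S"
      then have "card (S - {i}) \<noteq> j" using that by (simp add: card_Diff_singleton) (metis Suc_pred card_gt_0_iff empty_iff finite)
      then show "ksign e i S * a k i * \<omega> (S - {i}) = 0" by (simp add: step.prems(2))
    qed
    show "contract e f ?w S \<in> gen_ideal x (Suc k)" for S
      unfolding gen_ideal_Suc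
    proof
      show "contract e f ?w S - x k * \<omega> S \<in> gen_ideal x k"
        using gen_ideal_mult[OF hom[of S], of "-1"] by simp
    qed
  qed
  then obtain \<eta> where "\<And>S. \<exists>b. ?w S - contract e f \<eta> S - x k * b \<in> gen_ideal x k"
    unfolding gen_ideal_Suc by blast
  then obtain \<beta> where \<beta>: "\<And>S. ?w S - contract e f \<eta> S - x k * \<beta> S \<in> gen_ideal x k" by metis
  have "\<omega> S - contract e f \<beta> S \<in> gen_ideal x k" for S
  proof (rule regular)
    have "contract e f (\<lambda>S. ?w S - contract e f \<eta> S - x k * \<beta> S) S \<in> gen_ideal x k"
      by (rule contract_in_gen_ideal[OF \<beta>])
    then have "contract e f ?w S - x k * contract e f \<beta> S \<in> gen_ideal x k"
      by (simp add: contract_diff contract_scale contract_contract[OF e])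
    from gen_ideal_add[OF hom[of S] this]
    show "x k * (\<omega> S - contract e f \<beta> S) \<in> gen_ideal x k" by (simp add: algebra_simps)
  qed (use step.hyps in simp)
  then show ?case by blast
qed

text \<open>The case of degree 1 and no relations: a syzygy is a one-chain that is a cycle, and a two-chain with this boundary
  is an antisymmetric matrix.\<close>
theorem syzygies_trivial:
  fixes f v :: "'n::finite \<Rightarrow> 'a::comm_ring_1"
  assumes in_ideal: "\<And>k. k < CARD('n) \<Longrightarrow> x k = (\<Sum>j\<in>UNIV. a k j * f j)"
    and regular: "\<And>k b. k < CARD('n) \<Longrightarrow> x k * b \<in> gen_ideal x k \<Longrightarrow> b \<in> gen_ideal x k"
    and syz: "(\<Sum>i\<in>UNIV. v i * f i) = 0"
  shows "\<exists>A. (\<forall>i j. A i j = - A j i) \<and> (\<forall>i. v i = (\<Sum>j\<in>UNIV. A i j * f j))"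
proof -
  obtain e :: "'n \<Rightarrow> nat" where e: "inj e"
    using finite_imp_inj_to_nat_seg[of "UNIV :: 'n set"] by auto
  define \<omega> where "\<omega> = (\<lambda>S. if card S = 1 then v (the_elem S) else 0)"
  have "contract e f \<omega> S = 0" for S
  proof (cases "S = {}")
    case True
    then show ?thesis using syz by (simp add: contract_def \<omega>_def ksign_def mult.commute)
  next
    case False
    have "card (insert j S) \<noteq> 1" if "j \<notin> S" for j using that False by simp
    then show ?thesis by (simp add: contract_def \<omega>_def)
  qed
  then have "\<exists>\<beta>. \<forall>S. \<omega> S - contract e f \<beta> S \<in> gen_ideal x 0"
    by (intro koszul_acyclic_mod[OF e in_ideal regular, where j = 1]) (auto simp: \<omega>_def gen_ideal_def)
  then obtain \<beta> where \<beta>: "\<And>S. \<omega> S = contract e f \<beta> S" by (auto simp: gen_ideal_def)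
  define A where "A = (\<lambda>i j. if i = j then 0 else ksign e j {i} * \<beta> {i, j})"
  have "A i j = - A j i" for i j
  proof (cases "i = j")
    case False
    have "ksign e j {i} = (- ksign e i {j} :: 'a)"
      using ksign_swap[OF e False, of "{}", where 'a = 'a] False
      by (auto simp: ksign_def)
    then show ?thesis using False by (simp add: A_def insert_commute)
  qed (simp add: A_def)
  moreover have "v i = (\<Sum>j\<in>UNIV. A i j * f j)" for i
  proof -
    have "v i = contract e f \<beta> {i}" using \<beta>[of "{i}"] by (simp add: \<omega>_def)
    also have "\<dots> = (\<Sum>j\<in>-{i}. A i j * f j)"
      unfolding contract_def by (intro sum.cong) (auto simp: A_def insert_commute mult_ac)
    also have "\<dots> = (\<Sum>j\<in>UNIV. A i j * f j)"
      by (rule sum.mono_neutral_left) (auto simp: A_def)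
    finally show ?thesis .
  qed
  ultimately show ?thesis by blast
qed

section \<open>The Nullstellensatz over the complex numbers\<close>

definition is_ideal :: "'a::comm_ring_1 set \<Rightarrow> bool" where
  "is_ideal I \<longleftrightarrow> 0 \<in> I \<and> (\<forall>a\<in>I. \<forall>b\<in>I. a + b \<in> I) \<and> (\<forall>a\<in>I. \<forall>r. r * a \<in> I)"

lemma is_idealD:
  assumes "is_ideal I"
  shows "0 \<in> I" "a \<in> I \<Longrightarrow> b \<in> I \<Longrightarrow> a + b \<in> I" "a \<in> I \<Longrightarrow> r * a \<in> I"
    "a \<in> I \<Longrightarrow> - a \<in> I" "a \<in> I \<Longrightarrow> b \<in> I \<Longrightarrow> a - b \<in> I"
proof -
  show 0: "0 \<in> I" and 1: "\<And>a b. a \<in> I \<Longrightarrow> b \<in> I \<Longrightarrow> a + b \<in> I" and 2: "\<And>r a. a \<in> I \<Longrightarrow> r * a \<in> I"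
    using assms by (auto simp: is_ideal_def)
  show 3: "\<And>a. a \<in> I \<Longrightarrow> - a \<in> I" using 2[of _ "-1"] by simp
  show "a \<in> I \<Longrightarrow> b \<in> I \<Longrightarrow> a - b \<in> I" using 1[of a "- b"] 3[of b] by simp
qed

lemma is_ideal_sum: "is_ideal I \<Longrightarrow> (\<And>k. k \<in> A \<Longrightarrow> a k \<in> I) \<Longrightarrow> (\<Sum>k\<in>A. a k) \<in> I"
  by (induction A rule: infinite_finite_induct) (auto intro: is_idealD)

text \<open>Zorn's lemma gives an ideal \<open>P\<close> that is maximal among those above \<open>J\<close> without a power of \<open>y\<close>. Adjoining any other element \<open>a\<close>
  produces such a power, which is the last property. It makes \<open>P\<close> prime.\<close>
lemma exists_ideal_avoiding_powers:
  fixes y :: "'a::comm_ring_1"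
  assumes J: "is_ideal J" "\<And>k. y ^ k \<notin> J"
  shows "\<exists>P. is_ideal P \<and> J \<subseteq> P \<and> (\<forall>k. y ^ k \<notin> P) \<and> (\<forall>a. a \<notin> P \<longrightarrow> (\<exists>k r. y ^ k - r * a \<in> P))"
proof -
  let ?S = "{I. is_ideal I \<and> J \<subseteq> I \<and> (\<forall>k. y ^ k \<notin> I)}"
  have "\<exists>M\<in>?S. \<forall>X\<in>?S. M \<subseteq> X \<longrightarrow> X = M"
  proof (rule subset_Zorn_nonempty)
    show "?S \<noteq> {}" using J by blast
  next
    fix C assume C: "C \<noteq> {}" "subset.chain ?S C"
    have sub: "X \<in> ?S" if "X \<in> C" for X using C(2) that by (auto simp: subset_chain_def)
    have "is_ideal (\<Union>C)"
      unfolding is_ideal_def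
    proof (intro conjI ballI allI)
      show "0 \<in> \<Union>C" using C(1) sub is_idealD(1) by blast
    next
      fix a b assume "a \<in> \<Union>C" "b \<in> \<Union>C"
      then obtain X Y where XY: "X \<in> C" "a \<in> X" "Y \<in> C" "b \<in> Y" by blast
      then have "X \<subseteq> Y \<or> Y \<subseteq> X" using C(2) by (auto simp: subset_chain_def)
      then show "a + b \<in> \<Union>C"
      proof
        assume "X \<subseteq> Y"
        then have "a + b \<in> Y" using XY sub[of Y] is_idealD(2) by blast
        then show ?thesis using XY by blast
      next
        assume "Y \<subseteq> X"
        then have "a + b \<in> X" using XY sub[of X] is_idealD(2) by blast
        then show ?thesis using XY by blast
      qed
    next
      fix a r assume "a \<in> \<Union>C"
      then obtain X where X: "X \<in> C" "a \<in> X" by blast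
      then have "r * a \<in> X" using sub[of X] is_idealD(3) by blast
      then show "r * a \<in> \<Union>C" using X by blast
    qed
    moreover have "J \<subseteq> \<Union>C" using C(1) sub by blast
    moreover have "\<forall>k. y ^ k \<notin> \<Union>C" using sub by blast
    ultimately show "\<Union>C \<in> ?S" by blast
  qed
  then obtain P where P: "is_ideal P" "J \<subseteq> P" "\<And>k. y ^ k \<notin> P"
    and max: "\<And>X. is_ideal X \<Longrightarrow> J \<subseteq> X \<Longrightarrow> (\<forall>k. y ^ k \<notin> X) \<Longrightarrow> P \<subseteq> X \<Longrightarrow> X = P"
    by auto
  have "\<exists>k r. y ^ k - r * a \<in> P" if a: "a \<notin> P" for a
  proof (rule ccontr)
    assume no: "\<not> (\<exists>k r. y ^ k - r * a \<in> P)"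
    let ?X = "{b. \<exists>r. b - r * a \<in> P}"
    have "is_ideal ?X"
      unfolding is_ideal_def
    proof (intro conjI ballI allI)
      show "0 \<in> ?X" using is_idealD(1)[OF P(1)] by (auto intro!: exI[of _ 0])
    next
      fix b c assume "b \<in> ?X" "c \<in> ?X"
      then obtain r s where "b - r * a \<in> P" "c - s * a \<in> P" by blast
      from is_idealD(2)[OF P(1) this] have "(b + c) - (r + s) * a \<in> P" by (simp add: algebra_simps)
      then show "b + c \<in> ?X" by blast
    next
      fix b t assume "b \<in> ?X"
      then obtain r where "b - r * a \<in> P" by blast
      from is_idealD(3)[OF P(1) this, of t] have "t * b - (t * r) * a \<in> P" by (simp add: algebra_simps)
      then show "t * b \<in> ?X" by blast
    qed
    moreover have PX: "P \<subseteq> ?X" by (auto intro!: exI[of _ 0])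
    ultimately have "?X = P" using max[of ?X] P(2) no by blast
    moreover have "a \<in> ?X" using is_idealD(1)[OF P(1)] by (auto intro!: exI[of _ 1])
    ultimately show False using a by simp
  qed
  with P show ?thesis by blast
qed

text \<open>Gaussian elimination of one equation at a time: more unknowns than homogeneous linear equations.\<close>
lemma exists_linear_relation:
  fixes M :: "'b \<Rightarrow> 'c \<Rightarrow> 'a::field"
  assumes "finite T" "finite L" "card T < card L"
  shows "\<exists>c. (\<exists>l\<in>L. c l \<noteq> 0) \<and> (\<forall>t\<in>T. (\<Sum>l\<in>L. c l * M t l) = 0)"
  using assms
proof (induction T arbitrary: L M rule: finite_induct)
  case empty
  then obtain l where "l \<in> L" by (metis card_gt_0_iff equals0I card.empty)
  then show ?case by (intro exI[of _ "\<lambda>_. 1"]) auto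
next
  case (insert t T)
  show ?case
  proof (cases "\<forall>l\<in>L. M t l = 0")
    case True
    have "\<exists>c. (\<exists>l\<in>L. c l \<noteq> 0) \<and> (\<forall>t\<in>T. (\<Sum>l\<in>L. c l * M t l) = 0)"
      by (rule insert.IH) (use insert in auto)
    then show ?thesis using True by auto
  next
    case False
    then obtain p where p: "p \<in> L" "M t p \<noteq> 0" by blast
    let ?L = "L - {p}"
    let ?M = "\<lambda>u l. M u l - M u p * M t l / M t p"
    have "\<exists>c. (\<exists>l\<in>?L. c l \<noteq> 0) \<and> (\<forall>u\<in>T. (\<Sum>l\<in>?L. c l * ?M u l) = 0)"
      by (rule insert.IH) (use insert p in auto)
    then obtain c where c: "\<exists>l\<in>?L. c l \<noteq> 0" "\<And>u. u \<in> T \<Longrightarrow> (\<Sum>l\<in>?L. c l * ?M u l) = 0" by blast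
    let ?s = "\<Sum>l\<in>?L. c l * M t l"
    let ?d = "c(p := - ?s / M t p)"
    have d: "(\<Sum>l\<in>L. ?d l * M u l) = (\<Sum>l\<in>?L. c l * M u l) - ?s / M t p * M u p" for u
    proof -
      have "(\<Sum>l\<in>L. ?d l * M u l) = ?d p * M u p + (\<Sum>l\<in>?L. ?d l * M u l)"
        by (rule sum.remove) (use p insert in auto)
      moreover have "(\<Sum>l\<in>?L. ?d l * M u l) = (\<Sum>l\<in>?L. c l * M u l)"
        by (rule sum.cong) auto
      ultimately show ?thesis by simp
    qed
    have "(\<Sum>l\<in>L. ?d l * M u l) = 0" if u: "u \<in> insert t T" for u
    proof (cases "u = t")
      case True
      then show ?thesis using p by (simp only: d) simp
    next
      case False
      have "(\<Sum>l\<in>?L. c l * ?M u l) = (\<Sum>l\<in>?L. c l * M u l) - (\<Sum>l\<in>?L. (c l * M t l) * (M u p / M t p))"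
        by (simp add: sum_subtractf right_diff_distrib) (simp add: mult_ac)
      also have "\<dots> = (\<Sum>l\<in>L. ?d l * M u l)"
        unfolding d sum_distrib_right[symmetric] by simp
      finally show ?thesis using c(2) False u by simp
    qed
    moreover have "\<exists>l\<in>L. ?d l \<noteq> 0" using c(1) by auto
    ultimately show ?thesis by blast
  qed
qed

definition poly_at :: "complex poly \<Rightarrow> 'n mpoly \<Rightarrow> 'n mpoly" where
  "poly_at q y = (\<Sum>k\<le>Polynomial.degree q. Const (coeff q k) * y ^ k)"

lemma poly_at_bound: "Polynomial.degree q \<le> N \<Longrightarrow> poly_at q y = (\<Sum>k\<le>N. Const (coeff q k) * y ^ k)"
  unfolding poly_at_def by (rule sum.mono_neutral_left) (auto simp: coeff_eq_0 Const_simps)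

lemma poly_at_add: "poly_at (p + q) y = poly_at p y + poly_at q y"
  using poly_at_bound[of "p + q" "max (Polynomial.degree p) (Polynomial.degree q)" y]
    poly_at_bound[of p "max (Polynomial.degree p) (Polynomial.degree q)" y]
    poly_at_bound[of q "max (Polynomial.degree p) (Polynomial.degree q)" y]
  by (simp add: degree_add_le_max Const_simps algebra_simps sum.distrib)

lemma poly_at_pCons: "poly_at (pCons a p) y = Const a + y * poly_at p y"
proof -
  have "poly_at (pCons a p) y = (\<Sum>k\<le>Suc (Polynomial.degree p). Const (coeff (pCons a p) k) * y ^ k)"
    by (rule poly_at_bound) (rule degree_pCons_le)
  also have "\<dots> = Const a + (\<Sum>k\<le>Polynomial.degree p. Const (coeff p k) * y ^ Suc k)"
    by (subst sum.atMost_Suc_shift) simp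
  finally show ?thesis by (simp add: poly_at_def sum_distrib_left mult_ac)
qed

lemma poly_at_0 [simp]: "poly_at 0 y = 0"
  by (simp add: poly_at_def Const_simps)

lemma poly_at_smult: "poly_at (smult c p) y = Const c * poly_at p y"
  by (induction p) (auto simp: poly_at_pCons Const_simps algebra_simps)

lemma poly_at_mult: "poly_at (p * q) y = poly_at p y * poly_at q y"
  by (induction p) (auto simp: poly_at_pCons poly_at_add poly_at_smult Const_simps algebra_simps)

lemma poly_at_const: "poly_at [:c:] y = Const c"
  by (simp add: poly_at_pCons)

lemma poly_at_linear: "poly_at [:- l, 1:] y = y - Const l"
  by (simp add: poly_at_pCons Const_simps)

lemma poly_at_sum: "poly_at (\<Sum>k\<in>A. q k) y = (\<Sum>k\<in>A. poly_at (q k) y)"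
  by (induction A rule: infinite_finite_induct) (auto simp: poly_at_add)

lemma poly_at_1: "poly_at 1 y = 1"
  using poly_at_const[of 1 y] by (simp only: Const_simps pCons_one)

lemma poly_at_prod: "poly_at (\<Prod>k\<in>A. q k) y = (\<Prod>k\<in>A. poly_at (q k) y)"
  by (induction A rule: infinite_finite_induct)
     (auto simp: poly_at_mult poly_at_1)

text \<open>Over the complex numbers \<open>q\<close> splits into linear factors, and one of them lies in the prime ideal after
  substitution.\<close>
lemma prime_ideal_contains_linear_factor:
  fixes q :: "complex poly"
  assumes P: "is_ideal P" "1 \<notin> P" "\<And>a b. a * b \<in> P \<Longrightarrow> a \<in> P \<or> b \<in> P"
    and "q \<noteq> 0" "poly_at q y \<in> P"
  shows "\<exists>l. y - Const l \<in> P"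
  using assms(4,5)
proof (induction "Polynomial.degree q" arbitrary: q)
  case 0
  then obtain c where c: "q = [:c:]" using degree_eq_zeroE by metis
  then have "c \<noteq> 0" using 0 by auto
  have "Const (inverse c) * poly_at q y \<in> P" using is_idealD(3)[OF P(1)] 0 by blast
  moreover have "Const (inverse c) * poly_at q y = 1"
    using \<open>c \<noteq> 0\<close> by (simp add: c poly_at_const flip: Const_simps)
  ultimately show ?case using P(2) by simp
next
  case (Suc n)
  have "0 < Polynomial.degree q" using Suc.hyps(2) by simp
  then obtain l where "poly q l = 0" using alg_closed_imp_poly_has_root by blast
  then obtain r where r: "q = [:- l, 1:] * r" by (auto simp: poly_eq_0_iff_dvd elim: dvdE)
  then have "r \<noteq> 0" using Suc.prems by auto
  then have "Polynomial.degree r = n" using Suc.hyps(2) by (simp add: r degree_mult_eq del: mult_pCons_left)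
  have "(y - Const l) * poly_at r y \<in> P" using Suc.prems(2) by (simp only: r poly_at_mult poly_at_linear)
  then show ?case using P(3) Suc.hyps(1) \<open>r \<noteq> 0\<close> \<open>Polynomial.degree r = n\<close> by blast
qed

lemma finite_bounded_exponents:
  "finite {\<nu> :: 'n::finite \<Rightarrow>\<^sub>0 nat. weighted_deg (\<lambda>_. 1) \<nu> \<le> N}"
proof -
  have "inj (lookup :: ('n \<Rightarrow>\<^sub>0 nat) \<Rightarrow> _)" by (auto simp: inj_def)
  moreover have "lookup ` {\<nu> :: 'n \<Rightarrow>\<^sub>0 nat. weighted_deg (\<lambda>_. 1) \<nu> \<le> N} \<subseteq> (UNIV \<rightarrow>\<^sub>E {..N})"
  proof (clarsimp simp: weighted_deg_def PiE_def)
    fix \<nu> :: "'n \<Rightarrow>\<^sub>0 nat" and i assume "sum (lookup \<nu>) UNIV \<le> N"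
    then show "lookup \<nu> i \<le> N" using member_le_sum[of i UNIV "lookup \<nu>"] by simp
  qed
  moreover have "finite ((UNIV :: 'n set) \<rightarrow>\<^sub>E {..N})" by (intro finite_PiE) auto
  ultimately show ?thesis by (metis finite_imageD finite_subset inj_on_subset subset_UNIV)
qed

lemma bounded_exponents:
  "\<exists>N. \<forall>\<nu>\<in>keys (p :: 'n::finite mpoly). weighted_deg (\<lambda>_. 1) \<nu> \<le> N"
  by (intro exI[of _ "Max (weighted_deg (\<lambda>_. 1) ` keys p)"]) auto

text \<open>Suppose that \<open>J\<close> contains no power of the variable \<open>i\<close>, and let \<open>P\<close> be a prime ideal above \<open>J\<close> as in
  \<open>exists_ideal_avoiding_powers\<close>. If for some \<open>j\<close> no \<open>Var j - \<lambda>\<close> lies in \<open>P\<close>, then all of them are invertible modulo \<open>P\<close> up to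
  a power of \<open>Var i\<close>. There are uncountably many \<open>\<lambda>\<close>, but the polynomials have countable dimension, so some of the inverses are linearly dependent;
  clearing denominators gives a nonzero polynomial in \<open>Var j\<close> inside \<open>P\<close>, hence a linear factor after all.
  So \<open>P\<close> contains \<open>Var j - z\<^sub>j\<close> for all \<open>j\<close>. The point \<open>z\<close> is a zero of \<open>J\<close>, and its \<open>i\<close>-th coordinate is nonzero
  because \<open>Var i\<close> is not in \<open>P\<close>.\<close>
theorem nullstellensatz:
  fixes J :: "'n::finite mpoly set"
  assumes J: "is_ideal J" and zero: "\<And>z. (\<And>p. p \<in> J \<Longrightarrow> peval p z = 0) \<Longrightarrow> z $ i = 0"
  shows "\<exists>k. Var i ^ k \<in> J"
proof (rule ccontr)
  assume "\<nexists>k. Var i ^ k \<in> J"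
  then obtain P where P: "is_ideal P" "J \<subseteq> P" "\<And>k. Var i ^ k \<notin> P"
    and max: "\<And>a. a \<notin> P \<Longrightarrow> \<exists>k r. Var i ^ k - r * a \<in> P"
    using exists_ideal_avoiding_powers[OF J, of "Var i"] by blast
  have 1: "1 \<notin> P" using P(3)[of 0] by simp
  have prime: "a \<in> P \<or> b \<in> P" if ab: "a * b \<in> P" for a b
  proof (rule ccontr)
    assume "\<not> (a \<in> P \<or> b \<in> P)"
    then obtain k r l s where *: "Var i ^ k - r * a \<in> P" "Var i ^ l - s * b \<in> P" using max by metis
    have "Var i ^ l * (Var i ^ k - r * a) + (r * a) * (Var i ^ l - s * b) + (r * s) * (a * b) \<in> P"
      by (intro is_idealD(2,3)[OF P(1)] * ab)
    also have "Var i ^ l * (Var i ^ k - r * a) + (r * a) * (Var i ^ l - s * b) + (r * s) * (a * b) = Var i ^ (l + k)"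
      by (simp add: algebra_simps power_add)
    finally show False using P(3) by blast
  qed
  have "\<exists>l. Var j - Const l \<in> P" for j
  proof (rule ccontr)
    assume no: "\<nexists>l. Var j - Const l \<in> P"
    then have "\<forall>l. \<exists>k r. Var i ^ k - r * (Var j - Const l) \<in> P" using max by blast
    then obtain k r where kr: "\<And>l. Var i ^ k l - r l * (Var j - Const l) \<in> P"
      unfolding choice_iff by blast
    have "\<forall>l. \<exists>N. \<forall>\<nu>\<in>keys (r l). weighted_deg (\<lambda>_. 1) \<nu> \<le> N" using bounded_exponents by blast
    then obtain N where N: "\<And>l. \<forall>\<nu>\<in>keys (r l). weighted_deg (\<lambda>_. 1) \<nu> \<le> N l"
      unfolding choice_iff by blast
    \<comment> \<open>One exponent \<open>K\<close> and one degree bound \<open>M\<close> serve infinitely many \<open>l\<close>, since there are uncountably many.\<close>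
    have "\<exists>b. infinite {l. (k l, N l) = b}"
    proof (rule ccontr)
      assume "\<nexists>b. infinite {l. (k l, N l) = b}"
      then have "countable (\<Union>b\<in>(UNIV :: (nat \<times> nat) set). {l. (k l, N l) = b})"
        by (intro countable_UN) (auto intro: countable_finite)
      moreover have "(\<Union>b\<in>(UNIV :: (nat \<times> nat) set). {l. (k l, N l) = b}) = (UNIV :: complex set)" by auto
      ultimately show False using uncountable_UNIV_complex by simp
    qed
    then obtain K M where inf: "infinite {l. k l = K \<and> N l = M}" by auto
    let ?T = "{\<nu> :: 'n \<Rightarrow>\<^sub>0 nat. weighted_deg (\<lambda>_. 1) \<nu> \<le> M}"
    obtain L where L: "L \<subseteq> {l. k l = K \<and> N l = M}" "finite L" "card L = Suc (card ?T)"
      using infinite_arbitrarily_large[OF inf] by blast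
    obtain c l0 where c: "l0 \<in> L" "c l0 \<noteq> 0" "\<And>\<nu>. \<nu> \<in> ?T \<Longrightarrow> (\<Sum>l\<in>L. c l * lookup (r l) \<nu>) = 0"
      using exists_linear_relation[OF finite_bounded_exponents L(2), of M "\<lambda>\<nu> l. lookup (r l) \<nu>"] L(3) by auto
    have rel: "(\<Sum>l\<in>L. Const (c l) * r l) = 0"
    proof (rule poly_mapping_eqI)
      fix \<nu>
      have "lookup (Const a * p) \<nu> = a * lookup p \<nu>" for a and p :: "'n mpoly"
        by (induction p rule: mpoly_single_induct)
           (auto simp: Const_def mult_single lookup_single when_def algebra_simps lookup_add)
      then have "lookup (\<Sum>l\<in>L. Const (c l) * r l) \<nu> = (\<Sum>l\<in>L. c l * lookup (r l) \<nu>)"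
        by (simp add: lookup_sum)
      also have "\<dots> = 0"
      proof (cases "\<nu> \<in> ?T")
        case False
        have "lookup (r l) \<nu> = 0" if "l \<in> L" for l
          using N[of l] L(1) that False by (auto simp: in_keys_iff)
        then show ?thesis by simp
      qed (rule c(3))
      finally show "lookup (\<Sum>l\<in>L. Const (c l) * r l) \<nu> = lookup 0 \<nu>" by simp
    qed
    \<comment> \<open>The numerator of \<open>\<Sum> c\<^sub>l / (y - l)\<close>; it is nonzero because its value at \<open>l0\<close> is.\<close>
    define q where "q = (\<Sum>l\<in>L. smult (c l) (\<Prod>m\<in>L - {l}. [:- m, 1:]))"
    have "poly q l0 = (\<Sum>l\<in>L. if l = l0 then c l0 * (\<Prod>m\<in>L - {l0}. l0 - m) else 0)"
      unfolding q_def poly_sum poly_smult poly_prod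
      by (intro sum.cong refl) (use L(2) c(1) in \<open>auto intro!: prod_zero bexI[of _ l0]\<close>)
    also have "\<dots> \<noteq> 0" using L(2) c(1,2) by simp
    finally have q0: "q \<noteq> 0" by auto
    let ?x = "\<lambda>l. Var j - Const l :: 'n mpoly"
    have ring: "c * Q * (y - r * x) = y * (c * Q) - (x * Q) * (c * r)" for c Q y r x :: "'n mpoly"
      by (simp add: algebra_simps)
    have "(\<Sum>l\<in>L. Const (c l) * (\<Prod>m\<in>L - {l}. ?x m) * (Var i ^ K - r l * ?x l)) \<in> P"
    proof (intro is_ideal_sum[OF P(1)] is_idealD(3)[OF P(1)])
      fix l assume "l \<in> L"
      then have "k l = K" using L(1) by auto
      then show "Var i ^ K - r l * ?x l \<in> P" using kr[of l] by simp
    qed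
    also have "(\<Sum>l\<in>L. Const (c l) * (\<Prod>m\<in>L - {l}. ?x m) * (Var i ^ K - r l * ?x l)) =
        (\<Sum>l\<in>L. Var i ^ K * (Const (c l) * (\<Prod>m\<in>L - {l}. ?x m)) - (\<Prod>m\<in>L. ?x m) * (Const (c l) * r l))"
    proof (intro sum.cong refl)
      fix l assume l: "l \<in> L"
      have *: "(\<Prod>m\<in>L. ?x m) = ?x l * (\<Prod>m\<in>L - {l}. ?x m)" by (rule prod.remove[OF L(2) l])
      show "Const (c l) * (\<Prod>m\<in>L - {l}. ?x m) * (Var i ^ K - r l * ?x l) =
          Var i ^ K * (Const (c l) * (\<Prod>m\<in>L - {l}. ?x m)) - (\<Prod>m\<in>L. ?x m) * (Const (c l) * r l)"
        unfolding * by (rule ring)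
    qed
    also have "\<dots> = Var i ^ K * (\<Sum>l\<in>L. Const (c l) * (\<Prod>m\<in>L - {l}. ?x m))"
      using rel by (simp add: sum_subtractf flip: sum_distrib_left)
    also have "(\<Sum>l\<in>L. Const (c l) * (\<Prod>m\<in>L - {l}. ?x m)) = poly_at q (Var j)"
      by (simp add: q_def poly_at_sum poly_at_smult poly_at_prod poly_at_linear)
    finally have "poly_at q (Var j) \<in> P" using prime P(3) by blast
    then show False using prime_ideal_contains_linear_factor[OF P(1) 1 prime q0] no by blast
  qed
  then obtain l where l: "\<And>j. Var j - Const (l j) \<in> P" by metis
  define z where "z = (\<chi> j. l j)"
  have ev: "p - Const (peval p z) \<in> P" for p
  proof (induction p rule: mpoly_induct)
    case (Const c)
    show ?case using is_idealD(1)[OF P(1)] by simp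
  next
    case (Var j)
    show ?case using l by (simp add: z_def)
  next
    case (add p q)
    show ?case using is_idealD(2)[OF P(1) add] by (simp add: peval_add Const_simps algebra_simps)
  next
    case (mult p q)
    have "q * (p - Const (peval p z)) + Const (peval p z) * (q - Const (peval q z)) \<in> P"
      by (intro is_idealD(2,3)[OF P(1)] mult)
    then show ?case by (simp add: peval_mult Const_simps algebra_simps)
  qed
  have unit: "Const c \<notin> P" if "c \<noteq> 0" for c
  proof
    assume "Const c \<in> P"
    then have "Const (inverse c) * Const c \<in> P" by (rule is_idealD(3)[OF P(1)])
    then show False using that 1 by (simp flip: Const_simps)
  qed
  have "peval p z = 0" if "p \<in> J" for p
  proof (rule ccontr)
    assume "peval p z \<noteq> 0"
    moreover have "Const (peval p z) \<in> P"
      using is_idealD(5)[OF P(1) _ ev[of p], of p] that P(2) by auto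
    ultimately show False using unit by blast
  qed
  then have "z $ i = 0" by (rule zero)
  then have "Var i \<in> P" using ev[of "Var i"] by (simp add: Const_simps)
  then show False using P(3)[of 1] by simp
qed

section \<open>Syzygies of the gradient\<close>

lemma gen_ideal_base: "l < k \<Longrightarrow> x l \<in> gen_ideal x k"
  by (rule gen_idealI[where r = "\<lambda>m. if m = l then 1 else 0"])
     (simp add: if_distrib cong: if_cong)

text \<open>Membership in a monomial ideal can be read off from the exponents.\<close>
lemma gen_ideal_Var_powers:
  assumes "inj_on h {..<k}"
  shows "p \<in> gen_ideal (\<lambda>l. Var (h l) ^ N (h l)) k \<longleftrightarrow> (\<forall>\<nu>\<in>keys p. \<exists>l<k. N (h l) \<le> lookup \<nu> (h l))"
    (is "_ \<in> gen_ideal ?x k \<longleftrightarrow> ?R p")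
proof
  assume "p \<in> gen_ideal ?x k"
  then obtain r where p: "p = (\<Sum>l<k. ?x l * r l)" by (rule gen_idealE)
  have add: "?R (a + b)" if "?R a" "?R b" for a b
    using that keys_add[of a b] by blast
  have "?R (\<Sum>l\<in>A. ?x l * r l)" if "A \<subseteq> {..<k}" for A
    using that
  proof (induction A rule: infinite_finite_induct)
    case (insert l A)
    have "?R (?x l * r l)"
    proof
      fix \<nu> assume "\<nu> \<in> keys (?x l * r l)"
      then obtain a b where "a \<in> keys (?x l)" "\<nu> = a + b" using keys_mult by fastforce
      then have "N (h l) \<le> lookup \<nu> (h l)" by (auto simp: Var_power lookup_add split: if_splits)
      then show "\<exists>l<k. N (h l) \<le> lookup \<nu> (h l)" using insert.prems by (intro exI[of _ l]) simp
    qed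
    moreover have "?R (\<Sum>l\<in>A. ?x l * r l)" using insert.IH insert.prems by blast
    ultimately have "?R (?x l * r l + (\<Sum>l\<in>A. ?x l * r l))" by (rule add)
    then show ?case by (subst sum.insert[OF insert.hyps])
  qed auto
  then show "?R p" unfolding p by blast
next
  assume R: "?R p"
  have "Poly_Mapping.single \<nu> (lookup p \<nu>) \<in> gen_ideal ?x k" if "\<nu> \<in> keys p" for \<nu>
  proof -
    obtain l where l: "l < k" "N (h l) \<le> lookup \<nu> (h l)" using R \<open>\<nu> \<in> keys p\<close> by blast
    let ?e = "Poly_Mapping.single (h l) (N (h l))"
    have "(\<nu> - ?e) + ?e = \<nu>"
      by (rule poly_mapping_eqI) (use l in \<open>auto simp: lookup_add lookup_minus lookup_single when_def\<close>)
    then have "Poly_Mapping.single (\<nu> - ?e) (lookup p \<nu>) * ?x l = Poly_Mapping.single \<nu> (lookup p \<nu>)"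
      by (simp add: Var_power mult_single)
    then show ?thesis
      using gen_ideal_mult[OF gen_ideal_base[OF l(1), of ?x], of "Poly_Mapping.single (\<nu> - ?e) (lookup p \<nu>)"]
      by simp
  qed
  then have "(\<Sum>\<nu>\<in>keys p. Poly_Mapping.single \<nu> (lookup p \<nu>)) \<in> gen_ideal ?x k"
    by (rule gen_ideal_sum)
  then show "p \<in> gen_ideal ?x k" by (simp flip: mpoly_eq_sum_single)
qed

lemma lookup_single_mult: "lookup (Poly_Mapping.single \<mu> 1 * p) (\<mu> + \<nu>) = lookup (p :: 'n mpoly) \<nu>"
  by (induction p rule: mpoly_single_induct)
     (auto simp: mult_single lookup_single lookup_add distrib_left when_def)

lemma Var_powers_regular:
  assumes "inj_on h {..<Suc k}"
    and "Var (h k) ^ N (h k) * b \<in> gen_ideal (\<lambda>l. Var (h l) ^ N (h l)) k"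
  shows "b \<in> gen_ideal (\<lambda>l. Var (h l) ^ N (h l)) k"
proof -
  have inj: "inj_on h {..<k}" using assms(1) by (rule inj_on_subset) auto
  show ?thesis
    unfolding gen_ideal_Var_powers[OF inj]
  proof
    fix \<nu> assume "\<nu> \<in> keys b"
    then have "Poly_Mapping.single (h k) (N (h k)) + \<nu> \<in> keys (Var (h k) ^ N (h k) * b)"
      by (simp add: in_keys_iff Var_power lookup_single_mult)
    then obtain l where l: "l < k" "N (h l) \<le> lookup (Poly_Mapping.single (h k) (N (h k)) + \<nu>) (h l)"
      using assms(2) unfolding gen_ideal_Var_powers[OF inj] by blast
    moreover have "h k \<noteq> h l" using inj_onD[OF assms(1), of k l] l(1) by auto
    ultimately show "\<exists>l<k. N (h l) \<le> lookup \<nu> (h l)"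
      by (auto simp: lookup_add lookup_single when_def)
  qed
qed

definition jacobian_ideal :: "'n::finite mpoly \<Rightarrow> 'n mpoly set" where
  "jacobian_ideal F = {p. \<exists>a. p = (\<Sum>j\<in>UNIV. a j * Diff j F)}"

lemma is_ideal_jacobian: "is_ideal (jacobian_ideal F)"
  unfolding is_ideal_def
proof (intro conjI ballI allI)
  show "0 \<in> jacobian_ideal F"
    unfolding jacobian_ideal_def by (rule CollectI, rule exI[of _ "\<lambda>_. 0"]) simp
next
  fix p q assume "p \<in> jacobian_ideal F" "q \<in> jacobian_ideal F"
  then obtain a b where "p = (\<Sum>j\<in>UNIV. a j * Diff j F)" "q = (\<Sum>j\<in>UNIV. b j * Diff j F)"
    unfolding jacobian_ideal_def by auto
  then have "p + q = (\<Sum>j\<in>UNIV. (a j + b j) * Diff j F)" by (simp add: distrib_right sum.distrib)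
  then show "p + q \<in> jacobian_ideal F"
    unfolding jacobian_ideal_def by (intro CollectI exI[of _ "\<lambda>j. a j + b j"])
next
  fix p r assume "p \<in> jacobian_ideal F"
  then obtain a where "p = (\<Sum>j\<in>UNIV. a j * Diff j F)" unfolding jacobian_ideal_def by auto
  then have "r * p = (\<Sum>j\<in>UNIV. (r * a j) * Diff j F)" by (simp add: sum_distrib_left mult_ac)
  then show "r * p \<in> jacobian_ideal F"
    unfolding jacobian_ideal_def by (intro CollectI exI[of _ "\<lambda>j. r * a j"])
qed

lemma Diff_in_jacobian: "Diff i F \<in> jacobian_ideal F"
  unfolding jacobian_ideal_def
  by (rule CollectI, rule exI[of _ "\<lambda>j. if j = i then 1 else 0"]) (simp add: if_distrib[of "\<lambda>x. x * _"] cong: if_cong)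

lemma Var_power_in_jacobian:
  assumes grad: "\<And>z. (\<forall>j. peval (Diff j F) z = 0) \<Longrightarrow> z = 0"
  shows "\<exists>N. Var i ^ N \<in> jacobian_ideal F"
proof (rule nullstellensatz[OF is_ideal_jacobian])
  fix z assume "\<And>p. p \<in> jacobian_ideal F \<Longrightarrow> peval p z = 0"
  then have "z = 0" using Diff_in_jacobian by (intro grad) blast
  then show "z $ i = 0" by simp
qed

text \<open>By the Nullstellensatz the Jacobian ideal contains a power of each variable. These powers form a regular sequence
  of length \<open>CARD('n)\<close>, as \<open>syzygies_trivial\<close> requires.\<close>
lemma gradient_syzygies:
  fixes F :: "'n::finite mpoly"
  assumes grad: "\<And>z. (\<forall>j. peval (Diff j F) z = 0) \<Longrightarrow> z = 0"
    and syz: "(\<Sum>i\<in>UNIV. v i * Diff i F) = 0"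
  shows "\<exists>A. (\<forall>i j. A i j = - A j i) \<and> (\<forall>i. v i = (\<Sum>j\<in>UNIV. A i j * Diff j F))"
proof -
  have "\<forall>i. \<exists>N a. Var i ^ N = (\<Sum>j\<in>UNIV. a j * Diff j F)"
    using Var_power_in_jacobian[OF grad] unfolding jacobian_ideal_def by auto
  then obtain N a where Na: "\<And>i. Var i ^ N i = (\<Sum>j\<in>UNIV. a i j * Diff j F)"
    unfolding choice_iff by auto
  obtain h where h: "bij_betw h {..<CARD('n)} (UNIV :: 'n set)"
    using ex_bij_betw_nat_finite[of "UNIV :: 'n set"] by (auto simp: atLeast0LessThan)
  have inj: "inj_on h {..<Suc k}" if "k < CARD('n)" for k
    using bij_betw_imp_inj_on[OF h] by (rule inj_on_subset) (use that in auto)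
  show ?thesis
    by (rule syzygies_trivial[where x = "\<lambda>l. Var (h l) ^ N (h l)" and a = "\<lambda>l. a (h l)", OF Na _ syz])
       (rule Var_powers_regular[OF inj])
qed

lemma mpoly_eq_uminus:
  assumes "(p :: 'n mpoly) = - p"
  shows "p = 0"
proof (rule poly_mapping_eqI)
  fix \<nu>
  have "lookup p \<nu> = - lookup p \<nu>" by (subst assms) simp
  then have "2 * lookup p \<nu> = 0" by (simp add: eq_neg_iff_add_eq_0)
  then show "lookup p \<nu> = lookup 0 \<nu>" by simp
qed

lemma sum_antisymmetric_mpoly:
  assumes "\<And>i j. g i j = - g j i"
  shows "(\<Sum>i\<in>UNIV. \<Sum>j\<in>UNIV. g i j) = (0 :: 'n::finite mpoly)"
proof (rule mpoly_eq_uminus)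
  have "(\<Sum>i\<in>UNIV. \<Sum>j\<in>UNIV. g i j) = (\<Sum>j\<in>UNIV. \<Sum>i\<in>UNIV. g i j)" by (rule sum.swap)
  also have "\<dots> = (\<Sum>j\<in>UNIV. \<Sum>i\<in>UNIV. - g j i)" by (intro sum.cong refl assms)
  finally show "(\<Sum>i\<in>UNIV. \<Sum>j\<in>UNIV. g i j) = - (\<Sum>i\<in>UNIV. \<Sum>j\<in>UNIV. g i j)"
    by (simp add: sum_negf)
qed

lemma Diff_eq_0_if_heavy:
  assumes "weighted_homog W d F" "d < W i"
  shows "Diff i F = 0"
  using assms
proof (induction rule: weighted_homog_induct)
  case (single \<nu> c)
  have "W i * lookup \<nu> i \<le> weighted_deg W \<nu>" unfolding weighted_deg_def by (rule member_le_sum) auto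
  then have "lookup \<nu> i = 0" using single by (cases "lookup \<nu> i") auto
  then show ?case by (simp add: Diff_single)
qed (auto simp: Diff_add)

text \<open>The derivative \<open>Diff i F\<close> has weight \<open>d - W i\<close>. If \<open>W i > d\<close> it is zero, so the formula holds without this
  subtraction.\<close>
lemma weighted_part_mult_Diff:
  assumes F: "weighted_homog W d F"
  shows "weighted_part W (d + e) (p * Diff i F) = weighted_part W (e + W i) p * Diff i F"
proof (cases "W i \<le> d")
  case True
  then have "weighted_homog W (d - W i) (Diff i F)" by (intro weighted_homog_Diff) (simp add: F)
  from weighted_part_mult_weighted_homog[OF this, of "e + W i" p] True show ?thesis
    by (simp add: mult.commute)
next
  case False
  then show ?thesis using Diff_eq_0_if_heavy[OF F, of i] by simp
qed

context
  fixes W :: "'n::finite \<Rightarrow> nat" and d :: nat and F :: "'n mpoly"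
  assumes F: "weighted_homog W d F" and d: "0 < d" and W: "\<And>i. 0 < W i"
    and grad: "\<And>z. (\<forall>j. peval (Diff j F) z = 0) \<longleftrightarrow> z = 0"
begin

text \<open>The weights are scaled so that \<open>F\<close> has weight 1.\<close>

definition "alpha = (of_nat (\<Sum>i\<in>UNIV. W i) / of_nat d :: complex)"
definition "wt i = Const (of_nat (W i) / of_nat d :: complex)"

lemma alpha_plus_nonzero: "alpha + of_nat m \<noteq> 0"
proof -
  have "0 < (\<Sum>i\<in>UNIV. W i)" using W by (intro sum_pos) auto
  with d have "0 < real (\<Sum>i\<in>UNIV. W i) / real d + real m"
    by (intro add_pos_nonneg divide_pos_pos of_nat_0_less_iff[THEN iffD2] of_nat_0_le_iff)
  moreover have "alpha + of_nat m = of_real (real (\<Sum>i\<in>UNIV. W i) / real d + real m)"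
    by (simp add: alpha_def)
  ultimately show ?thesis by (metis of_real_eq_0_iff less_irrefl)
qed

lemma sum_wt: "(\<Sum>i\<in>UNIV. wt i) = (Const alpha :: 'n mpoly)"
proof -
  have "(\<Sum>i\<in>A. Const (g i) :: 'n mpoly) = Const (\<Sum>i\<in>A. g i)" for A :: "'n set" and g
    by (induction A rule: infinite_finite_induct) (auto simp: Const_simps)
  then show ?thesis by (simp add: wt_def alpha_def sum_divide_distrib)
qed

lemma euler_wt:
  assumes "weighted_homog W (d * e) p"
  shows "(\<Sum>i\<in>UNIV. wt i * Var i * Diff i p) = of_nat e * p"
proof -
  have "(\<Sum>i\<in>UNIV. wt i * Var i * Diff i p) = Const (1 / of_nat d) * (\<Sum>i\<in>UNIV. of_nat (W i) * Var i * Diff i p)"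
    unfolding sum_distrib_left wt_def of_nat_eq_Const mult.assoc[symmetric] Const_simps(4)[symmetric] by simp
  also have "\<dots> = of_nat e * p"
    unfolding euler_identity[OF assms] unfolding of_nat_eq_Const mult.assoc[symmetric] Const_simps(4)[symmetric]
    using d by simp
  finally show ?thesis .
qed

text \<open>With \<open>\<delta> = div p\<close> and \<open>w\<^sub>i = W\<^sub>i / d\<close>, Euler's identity \<open>F = \<Sum> w\<^sub>i z\<^sub>i \<partial>\<^sub>i F\<close> makes the assumed equation a syzygy \<open>\<Sum> v\<^sub>i \<partial>\<^sub>i F = 0\<close> with
  \<open>v\<^sub>i = (\<alpha> + m) p\<^sub>i - w\<^sub>i z\<^sub>i \<delta> + c w\<^sub>i z\<^sub>i F\<^sup>m\<close>. So \<open>v\<^sub>i = \<Sum> A\<^sub>i\<^sub>j \<partial>\<^sub>j F\<close> with \<open>A\<close> antisymmetric. In the divergence of \<open>v\<close> the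
  multiples of \<open>\<delta>\<close> cancel, since \<open>\<delta>\<close> has degree \<open>m\<close>, and the second derivatives of \<open>F\<close> cancel against \<open>A\<close>. The field
  \<open>B\<^sub>j = \<Sum> \<partial>\<^sub>i A\<^sub>i\<^sub>j\<close> has divergence 0, again by antisymmetry.\<close>
lemma syzygy_divergence:
  assumes p: "\<And>i. weighted_homog W (d * m + W i) (p i)"
    and eq: "Const c * F ^ Suc m = F * (\<Sum>i\<in>UNIV. Diff i (p i)) - Const (alpha + of_nat m) * (\<Sum>i\<in>UNIV. p i * Diff i F)"
  shows "\<exists>B. Const (c * (alpha + of_nat m)) * F ^ m = (\<Sum>j\<in>UNIV. B j * Diff j F) \<and> (\<Sum>j\<in>UNIV. Diff j (B j)) = 0"
proof -
  define \<delta> where "\<delta> = (\<Sum>i\<in>UNIV. Diff i (p i))"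
  define a where "a = Const (alpha + of_nat m) * (1 :: 'n mpoly)"
  have \<delta>: "weighted_homog W (d * m) \<delta>" unfolding \<delta>_def by (intro weighted_homog_sum weighted_homog_Diff p)
  have Fm: "weighted_homog W (d * m) (F ^ m)" using weighted_homog_power[OF F, of m] by (simp add: mult.commute)
  define v where "v = (\<lambda>i. a * p i - wt i * Var i * \<delta> + Const c * (wt i * Var i * F ^ m))"
  have EF: "(\<Sum>i\<in>UNIV. wt i * Var i * Diff i F) = F" using euler_wt[of 1 F] F by simp
  have "(\<Sum>i\<in>UNIV. v i * Diff i F) =
      (\<Sum>i\<in>UNIV. a * (p i * Diff i F) - \<delta> * (wt i * Var i * Diff i F) + Const c * F ^ m * (wt i * Var i * Diff i F))"
    unfolding v_def by (intro sum.cong refl) (simp add: algebra_simps)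
  also have "\<dots> = a * (\<Sum>i\<in>UNIV. p i * Diff i F) - \<delta> * F + Const c * F ^ m * F"
    unfolding sum.distrib sum_subtractf sum_distrib_left[symmetric] EF ..
  also have "\<dots> = 0" using eq by (simp add: a_def \<delta>_def algebra_simps)
  finally have "\<exists>A. (\<forall>i j. A i j = - A j i) \<and> (\<forall>i. v i = (\<Sum>j\<in>UNIV. A i j * Diff j F))"
    by (intro gradient_syzygies) (use grad in auto)
  then obtain A where A: "\<And>i j. A i j = - A j i" "\<And>i. v i = (\<Sum>j\<in>UNIV. A i j * Diff j F)" by blast
  define B where "B = (\<lambda>j. \<Sum>i\<in>UNIV. Diff i (A i j))"
  have "(\<Sum>i\<in>UNIV. Diff i (v i)) = (\<Sum>i\<in>UNIV. \<Sum>j\<in>UNIV. Diff i (A i j) * Diff j F) + (\<Sum>i\<in>UNIV. \<Sum>j\<in>UNIV. A i j * Diff i (Diff j F))"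
    unfolding A(2) Diff_sum Diff_mult by (simp add: sum.distrib)
  also have "(\<Sum>i\<in>UNIV. \<Sum>j\<in>UNIV. A i j * Diff i (Diff j F)) = 0"
  proof (rule sum_antisymmetric_mpoly)
    fix i j show "A i j * Diff i (Diff j F) = - (A j i * Diff j (Diff i F))"
      unfolding Diff_commute[of i j] by (subst A(1)) simp
  qed
  also have "(\<Sum>i\<in>UNIV. \<Sum>j\<in>UNIV. Diff i (A i j) * Diff j F) = (\<Sum>j\<in>UNIV. B j * Diff j F)"
    unfolding B_def sum_distrib_right by (rule sum.swap)
  finally have 1: "(\<Sum>i\<in>UNIV. Diff i (v i)) = (\<Sum>j\<in>UNIV. B j * Diff j F)" by simp
  have Dc: "Diff i (Const k * q) = Const k * Diff i q" for i k and q :: "'n mpoly"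
    by (simp add: Diff_mult)
  have Dw: "Diff i (wt i * Var i * q) = wt i * q + wt i * Var i * Diff i q" for i and q :: "'n mpoly"
    by (simp add: wt_def Diff_mult Diff_Var)
  have "(\<Sum>i\<in>UNIV. Diff i (v i)) =
      (\<Sum>i\<in>UNIV. a * Diff i (p i) - (wt i * \<delta> + wt i * Var i * Diff i \<delta>)
         + Const c * (wt i * F ^ m + wt i * Var i * Diff i (F ^ m)))"
    unfolding v_def Diff_add Diff_diff Dc Dw a_def mult_1_right ..
  also have "\<dots> = a * \<delta> - (Const alpha * \<delta> + of_nat m * \<delta>) + Const c * (Const alpha * F ^ m + of_nat m * F ^ m)"
    unfolding sum.distrib sum_subtractf sum_distrib_left[symmetric] sum_distrib_right[symmetric]
      euler_wt[OF \<delta>] euler_wt[OF Fm] sum_wt \<delta>_def[symmetric] ..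
  also have "\<dots> = Const (c * (alpha + of_nat m)) * F ^ m"
    unfolding a_def of_nat_eq_Const by (simp add: Const_simps algebra_simps)
  finally have 2: "Const (c * (alpha + of_nat m)) * F ^ m = (\<Sum>j\<in>UNIV. B j * Diff j F)" using 1 by simp
  have "(\<Sum>j\<in>UNIV. Diff j (B j)) = (\<Sum>j\<in>UNIV. \<Sum>i\<in>UNIV. Diff j (Diff i (A i j)))"
    by (simp add: B_def Diff_sum)
  also have "\<dots> = 0"
  proof (rule sum_antisymmetric_mpoly)
    fix i j show "Diff i (Diff j (A j i)) = - Diff j (Diff i (A i j))"
      by (subst A(1)) (simp add: Diff_uminus Diff_commute)
  qed
  finally show ?thesis using 2 by blast
qed

lemma weighted_homog_Const_power: "weighted_homog W (d + d * m) (Const k * F ^ Suc m)"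
  using weighted_homog_mult[OF weighted_homog_Const[of W k] weighted_homog_power[OF F, of "Suc m"]]
  by (simp only: add_0 mult_Suc mult.commute[of m d])

text \<open>For \<open>m > 0\<close> the field \<open>B\<close> of \<open>syzygy_divergence\<close>, suitably scaled, satisfies the same relation with \<open>m - 1\<close> in place
  of \<open>m\<close>; the divergence term is 0. For \<open>m = 0\<close> the constant \<open>c \<alpha>\<close> is in the Jacobian ideal, hence 0.\<close>
lemma homogeneous_relation_trivial:
  assumes "\<And>i. weighted_homog W (d * m + W i) (p i)"
    and "Const c * F ^ Suc m = F * (\<Sum>i\<in>UNIV. Diff i (p i)) - Const (alpha + of_nat m) * (\<Sum>i\<in>UNIV. p i * Diff i F)"
  shows "c = 0"
  using assms
proof (induction m arbitrary: p)
  case 0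
  obtain B where "Const (c * (alpha + of_nat 0)) * F ^ 0 = (\<Sum>j\<in>UNIV. B j * Diff j F)"
    using syzygy_divergence[OF 0] by blast
  from arg_cong[OF this, of "\<lambda>p. peval p 0"] have "c * alpha = 0"
    using grad[of 0] by (simp add: peval_mult peval_sum)
  then show ?case using alpha_plus_nonzero[of 0] by simp
next
  case (Suc m)
  obtain B where B: "Const (c * (alpha + of_nat (Suc m))) * F ^ Suc m = (\<Sum>j\<in>UNIV. B j * Diff j F)"
      "(\<Sum>j\<in>UNIV. Diff j (B j)) = 0"
    using syzygy_divergence[OF Suc.prems] by blast
  define B' where "B' = (\<lambda>j. weighted_part W (d * m + W j) (B j))"
  \<comment> \<open>Then \<open>-(\<alpha> + m) k (\<alpha> + m + 1) = 1\<close>.\<close>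
  define k where "k = - 1 / ((alpha + of_nat (Suc m)) * (alpha + of_nat m))"
  have part: "weighted_part W (d + d * m) (Const (c * (alpha + of_nat (Suc m))) * F ^ Suc m) = Const (c * (alpha + of_nat (Suc m))) * F ^ Suc m"
    using weighted_homog_Const_power unfolding weighted_homog_iff_weighted_part .
  have B1: "Const (c * (alpha + of_nat (Suc m))) * F ^ Suc m = (\<Sum>j\<in>UNIV. B' j * Diff j F)"
    using arg_cong[OF B(1), of "weighted_part W (d + d * m)"] unfolding part weighted_part_sum weighted_part_mult_Diff[OF F] B'_def .
  have B2: "(\<Sum>j\<in>UNIV. Diff j (B' j)) = 0"
    unfolding B'_def weighted_part_Diff[symmetric] weighted_part_sum[symmetric] B(2) by simp
  show ?case
  proof (rule Suc.IH[of "\<lambda>j. Const k * B' j"])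
    show "weighted_homog W (d * m + W j) (Const k * B' j)" for j
      using weighted_homog_mult[OF weighted_homog_Const weighted_homog_weighted_part] by (simp add: B'_def)
    have "(\<Sum>i\<in>UNIV. Diff i (Const k * B' i)) = Const k * (\<Sum>i\<in>UNIV. Diff i (B' i))"
      by (simp add: Diff_mult sum_distrib_left)
    moreover have "(\<Sum>i\<in>UNIV. Const k * B' i * Diff i F) = Const k * (\<Sum>j\<in>UNIV. B' j * Diff j F)"
      by (simp add: sum_distrib_left mult.assoc)
    moreover have "- x * (- 1 / (y * x) * (c * y)) = c" if "x \<noteq> 0" "y \<noteq> 0" for x y :: complex
      using that by simp
    then have "- (alpha + of_nat m) * (k * (c * (alpha + of_nat (Suc m)))) = c"
      unfolding k_def using alpha_plus_nonzero by blast
    then have "Const c = - Const (alpha + of_nat m) * (Const k * Const (c * (alpha + of_nat (Suc m))) :: 'n mpoly)"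
      by (metis Const_simps(4,5))
    ultimately show "Const c * F ^ Suc m = F * (\<Sum>i\<in>UNIV. Diff i (Const k * B' i)) -
        Const (alpha + of_nat m) * (\<Sum>i\<in>UNIV. Const k * B' i * Diff i F)"
      unfolding B2 by (simp add: B1[symmetric] mult.assoc del: power_Suc of_nat_Suc)
  qed
qed

text \<open>Only the part of weight \<open>m + 1\<close> (in the scale where \<open>F\<close> has weight 1) is needed. The term \<open>Q F\<^sup>m\<^sup>+\<^sup>2\<close> does
  not contribute to it.\<close>
theorem relation_trivial:
  assumes "weighted_part W (d * Suc m) (Const c * F ^ Suc m - Q * F ^ Suc (Suc m) -
      (F * (\<Sum>i\<in>UNIV. Diff i (p i)) - Const (alpha + of_nat m) * (\<Sum>i\<in>UNIV. p i * Diff i F))) = 0"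
  shows "c = 0"
proof (rule homogeneous_relation_trivial)
  show "weighted_homog W (d * m + W i) (weighted_part W (d * m + W i) (p i))" for i by (rule weighted_homog_weighted_part)
  have dm: "d * Suc m = d + d * m" by simp
  have 1: "weighted_part W (d * Suc m) (Const c * F ^ Suc m) = Const c * F ^ Suc m"
    using weighted_homog_Const_power unfolding weighted_homog_iff_weighted_part dm .
  have 2: "weighted_part W (d * Suc m) (Q * F ^ Suc (Suc m)) = 0"
    using weighted_part_mult_weighted_homog_0[OF weighted_homog_power[OF F, of "Suc (Suc m)"], of "d * Suc m" Q] d
    by (simp add: mult.commute)
  have 3: "weighted_part W (d * Suc m) (F * (\<Sum>i\<in>UNIV. Diff i (p i))) = F * (\<Sum>i\<in>UNIV. Diff i (weighted_part W (d * m + W i) (p i)))"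
    unfolding dm weighted_part_mult_weighted_homog[OF F] weighted_part_sum weighted_part_Diff ..
  have 4: "weighted_part W (d * Suc m) (Const k * (\<Sum>i\<in>UNIV. p i * Diff i F)) = Const k * (\<Sum>i\<in>UNIV. weighted_part W (d * m + W i) (p i) * Diff i F)" for k
    using weighted_part_mult_weighted_homog[OF weighted_homog_Const[of W k], of "d * Suc m" "\<Sum>i\<in>UNIV. p i * Diff i F"]
    unfolding add_0 unfolding dm weighted_part_sum weighted_part_mult_Diff[OF F] .
  show "Const c * F ^ Suc m = F * (\<Sum>i\<in>UNIV. Diff i (weighted_part W (d * m + W i) (p i))) -
      Const (alpha + of_nat m) * (\<Sum>i\<in>UNIV. weighted_part W (d * m + W i) (p i) * Diff i F)"
    using assms unfolding weighted_part_diff 1 2 3 4 by (simp only: diff_zero right_minus_eq)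
qed

end

section \<open>The module generated by powers of an equation\<close>

text \<open>The germs \<open>F f\<^sup>s\<close> in the module generated by \<open>f\<^sup>s\<^sup>+\<^sup>1\<close> over the differential operators with coefficients that are
  holomorphic on \<open>U\<close> and polynomial in \<open>s\<close>. A pair in \<open>I\<close> consists of the exponent of \<open>s\<close> and the word of derivations.\<close>
definition bs_span ::
    "(complex^'n::finite \<Rightarrow> complex) \<Rightarrow> (complex^'n) set \<Rightarrow> (complex \<Rightarrow> complex^'n \<Rightarrow> complex) \<Rightarrow> bool" where
  "bs_span f U F \<longleftrightarrow> (\<exists>I a. finite I \<and> (\<forall>p\<in>I. mv_holomorphic_on (a p) U) \<and>
     (\<forall>s. \<forall>z\<in>U. f z \<noteq> 0 \<longrightarrow>
        F s z = (\<Sum>p\<in>I. s ^ fst p * a p z * foldr (twisted_deriv f s) (snd p) f z)))"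

lemma bernstein_equation_iff_bs_span:
  "bernstein_equation f x b \<longleftrightarrow>
    (\<exists>U. open U \<and> x \<in> U \<and> mv_holomorphic_on f U \<and> bs_span f U (\<lambda>s z. poly b s))"
proof
  assume "bernstein_equation f x b"
  then obtain U N W a where U: "open U" "x \<in> U" "mv_holomorphic_on f U" and W: "finite W"
      "\<And>k w. k \<le> N \<Longrightarrow> w \<in> W \<Longrightarrow> mv_holomorphic_on (a k w) U"
    and eq: "\<And>s z. z \<in> U \<Longrightarrow> f z \<noteq> 0 \<Longrightarrow>
           (\<Sum>w\<in>W. \<Sum>k\<le>N. s ^ k * a (k::nat) w z * foldr (twisted_deriv f s) w f z) = poly b s"
    unfolding bernstein_equation_def by blast
  have "bs_span f U (\<lambda>s z. poly b s)"
    unfolding bs_span_def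
  proof (intro exI[of _ "{..N} \<times> W"] exI[of _ "\<lambda>p. a (fst p) (snd p)"] conjI allI ballI impI)
    fix s z assume z: "z \<in> U" "f z \<noteq> 0"
    have "poly b s = (\<Sum>k\<le>N. \<Sum>w\<in>W. s ^ k * a k w z * foldr (twisted_deriv f s) w f z)"
      unfolding eq[OF z, symmetric] by (rule sum.swap)
    then show "poly b s = (\<Sum>p\<in>{..N} \<times> W. s ^ fst p * a (fst p) (snd p) z * foldr (twisted_deriv f s) (snd p) f z)"
      by (simp add: sum.cartesian_product case_prod_unfold)
  qed (use W in auto)
  then show "\<exists>U. open U \<and> x \<in> U \<and> mv_holomorphic_on f U \<and> bs_span f U (\<lambda>s z. poly b s)"
    using U by blast
next
  assume "\<exists>U. open U \<and> x \<in> U \<and> mv_holomorphic_on f U \<and> bs_span f U (\<lambda>s z. poly b s)"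
  then obtain U I a where U: "open U" "x \<in> U" "mv_holomorphic_on f U" and I: "finite I"
      "\<And>p. p \<in> I \<Longrightarrow> mv_holomorphic_on (a p) U"
    and eq: "\<And>s z. z \<in> U \<Longrightarrow> f z \<noteq> 0 \<Longrightarrow>
        poly b s = (\<Sum>p\<in>I. s ^ fst p * a p z * foldr (twisted_deriv f s) (snd p) f z)"
    unfolding bs_span_def by blast
  define N where "N = Max (insert 0 (fst ` I))"
  have N: "fst p \<le> N" if "p \<in> I" for p unfolding N_def using I(1) that by (intro Max_ge) auto
  define a' where "a' = (\<lambda>k w z. if (k, w) \<in> I then a (k, w) z else 0)"
  show "bernstein_equation f x b"
    unfolding bernstein_equation_def
  proof (intro exI[of _ U] exI[of _ N] exI[of _ "snd ` I"] exI[of _ a'] conjI allI ballI impI U)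
    fix k w show "mv_holomorphic_on (a' k w) U"
      by (cases "(k, w) \<in> I") (auto simp: a'_def I(2) mv_holomorphic_on_const)
  next
    fix s z assume z: "z \<in> U" "f z \<noteq> 0"
    let ?t = "\<lambda>p. s ^ fst p * a' (fst p) (snd p) z * foldr (twisted_deriv f s) (snd p) f z"
    have "(\<Sum>w\<in>snd ` I. \<Sum>k\<le>N. s ^ k * a' k w z * foldr (twisted_deriv f s) w f z) = (\<Sum>p\<in>{..N} \<times> snd ` I. ?t p)"
      by (subst sum.swap) (simp add: sum.cartesian_product case_prod_unfold)
    also have "\<dots> = (\<Sum>p\<in>I. ?t p)"
      by (rule sum.mono_neutral_right) (use I(1) N in \<open>force simp: a'_def mem_Times_iff\<close>)+
    also have "\<dots> = (\<Sum>p\<in>I. s ^ fst p * a p z * foldr (twisted_deriv f s) (snd p) f z)"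
      by (rule sum.cong) (auto simp: a'_def)
    finally show "(\<Sum>w\<in>snd ` I. \<Sum>k\<le>N. s ^ k * a' k w z * foldr (twisted_deriv f s) w f z) = poly b s"
      using eq[OF z] by simp
  qed (use I in auto)
qed

lemma bs_span_cong:
  assumes "bs_span f U F" "\<And>s z. z \<in> U \<Longrightarrow> f z \<noteq> 0 \<Longrightarrow> G s z = F s z"
  shows "bs_span f U G"
proof -
  obtain I a where I: "finite I" "\<forall>p\<in>I. mv_holomorphic_on (a p) U"
    and F: "\<And>s z. z \<in> U \<Longrightarrow> f z \<noteq> 0 \<Longrightarrow>
        F s z = (\<Sum>p\<in>I. s ^ fst p * a p z * foldr (twisted_deriv f s) (snd p) f z)"
    using assms(1) unfolding bs_span_def by blast
  show ?thesis unfolding bs_span_def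
    by (intro exI[of _ I] exI[of _ a] conjI I allI ballI impI, rule trans[OF assms(2) F])
qed

lemma bs_span_subset: "bs_span f U F \<Longrightarrow> V \<subseteq> U \<Longrightarrow> bs_span f V F"
  unfolding bs_span_def by (blast intro: mv_holomorphic_on_subset)

lemma bs_span_term:
  "mv_holomorphic_on a U \<Longrightarrow> bs_span f U (\<lambda>s z. s ^ k * a z * foldr (twisted_deriv f s) w f z)"
  unfolding bs_span_def by (intro exI[of _ "{(k, w)}"] exI[of _ "\<lambda>p. a"]) auto

lemma bs_span_zero: "bs_span f U (\<lambda>s z. 0)"
  unfolding bs_span_def by (intro exI[of _ "{}"]) auto

lemma bs_span_add:
  assumes "bs_span f U F" "bs_span f U G"
  shows "bs_span f U (\<lambda>s z. F s z + G s z)"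
proof -
  obtain I a where I: "finite I" "\<And>p. p \<in> I \<Longrightarrow> mv_holomorphic_on (a p) U"
    and F: "\<And>s z. z \<in> U \<Longrightarrow> f z \<noteq> 0 \<Longrightarrow>
        F s z = (\<Sum>p\<in>I. s ^ fst p * a p z * foldr (twisted_deriv f s) (snd p) f z)"
    using assms(1) unfolding bs_span_def by blast
  obtain J b where J: "finite J" "\<And>p. p \<in> J \<Longrightarrow> mv_holomorphic_on (b p) U"
    and G: "\<And>s z. z \<in> U \<Longrightarrow> f z \<noteq> 0 \<Longrightarrow>
        G s z = (\<Sum>p\<in>J. s ^ fst p * b p z * foldr (twisted_deriv f s) (snd p) f z)"
    using assms(2) unfolding bs_span_def by blast
  define a' where "a' = (\<lambda>p z. if p \<in> I then a p z else 0)"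
  define b' where "b' = (\<lambda>p z. if p \<in> J then b p z else 0)"
  have hol: "mv_holomorphic_on (a' p) U" "mv_holomorphic_on (b' p) U" for p
    by (cases "p \<in> I"; cases "p \<in> J"; simp add: a'_def b'_def I J mv_holomorphic_on_const)+
  show ?thesis
    unfolding bs_span_def
  proof (intro exI[of _ "I \<union> J"] exI[of _ "\<lambda>p z. a' p z + b' p z"] conjI ballI allI impI)
    fix s z assume z: "z \<in> U" "f z \<noteq> 0"
    have "F s z = (\<Sum>p\<in>I. s ^ fst p * a' p z * foldr (twisted_deriv f s) (snd p) f z)"
      unfolding F[OF z] by (rule sum.cong) (auto simp: a'_def)
    also have "\<dots> = (\<Sum>p\<in>I \<union> J. s ^ fst p * a' p z * foldr (twisted_deriv f s) (snd p) f z)"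
      by (rule sum.mono_neutral_left) (use I J in \<open>auto simp: a'_def\<close>)
    finally have 1: "F s z = (\<Sum>p\<in>I \<union> J. s ^ fst p * a' p z * foldr (twisted_deriv f s) (snd p) f z)" .
    have "G s z = (\<Sum>p\<in>J. s ^ fst p * b' p z * foldr (twisted_deriv f s) (snd p) f z)"
      unfolding G[OF z] by (rule sum.cong) (auto simp: b'_def)
    also have "\<dots> = (\<Sum>p\<in>I \<union> J. s ^ fst p * b' p z * foldr (twisted_deriv f s) (snd p) f z)"
      by (rule sum.mono_neutral_left) (use I J in \<open>auto simp: b'_def\<close>)
    finally have 2: "G s z = (\<Sum>p\<in>I \<union> J. s ^ fst p * b' p z * foldr (twisted_deriv f s) (snd p) f z)" .
    show "F s z + G s z = (\<Sum>p\<in>I \<union> J. s ^ fst p * (a' p z + b' p z) * foldr (twisted_deriv f s) (snd p) f z)"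
      unfolding 1 2 by (simp add: sum.distrib distrib_left distrib_right)
  qed (use I J hol in \<open>auto intro: mv_holomorphic_on_add\<close>)
qed

lemma bs_span_sum:
  "(\<And>k. k \<in> A \<Longrightarrow> bs_span f U (F k)) \<Longrightarrow> bs_span f U (\<lambda>s z. \<Sum>k\<in>A. F k s z)"
  by (induction A rule: infinite_finite_induct) (auto intro: bs_span_zero bs_span_add)

lemma bs_span_mult:
  assumes "bs_span f U F" "mv_holomorphic_on b U"
  shows "bs_span f U (\<lambda>s z. b z * F s z)"
proof -
  obtain I a where I: "finite I" "\<And>p. p \<in> I \<Longrightarrow> mv_holomorphic_on (a p) U"
    and F: "\<And>s z. z \<in> U \<Longrightarrow> f z \<noteq> 0 \<Longrightarrow>
        F s z = (\<Sum>p\<in>I. s ^ fst p * a p z * foldr (twisted_deriv f s) (snd p) f z)"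
    using assms(1) unfolding bs_span_def by blast
  have "bs_span f U (\<lambda>s z. \<Sum>p\<in>I. s ^ fst p * (b z * a p z) * foldr (twisted_deriv f s) (snd p) f z)"
    by (intro bs_span_sum bs_span_term mv_holomorphic_on_mult assms I)
  then show ?thesis
    by (rule bs_span_cong) (simp add: F sum_distrib_left mult_ac)
qed

lemma bs_span_times_s:
  assumes "bs_span f U F"
  shows "bs_span f U (\<lambda>s z. s * F s z)"
proof -
  obtain I a where I: "finite I" "\<And>p. p \<in> I \<Longrightarrow> mv_holomorphic_on (a p) U"
    and F: "\<And>s z. z \<in> U \<Longrightarrow> f z \<noteq> 0 \<Longrightarrow>
        F s z = (\<Sum>p\<in>I. s ^ fst p * a p z * foldr (twisted_deriv f s) (snd p) f z)"
    using assms(1) unfolding bs_span_def by blast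
  have "bs_span f U (\<lambda>s z. \<Sum>p\<in>I. s ^ Suc (fst p) * a p z * foldr (twisted_deriv f s) (snd p) f z)"
    by (intro bs_span_sum bs_span_term I)
  then show ?thesis
    by (rule bs_span_cong) (simp add: F sum_distrib_left mult_ac)
qed

lemma bs_span_times_poly:
  assumes "bs_span f U F"
  shows "bs_span f U (\<lambda>s z. poly q s * F s z)"
proof (induction q)
  case (pCons c q)
  have "bs_span f U (\<lambda>s z. c * F s z + s * (poly q s * F s z))"
    by (intro bs_span_add bs_span_mult[OF assms, of "\<lambda>z. c"] bs_span_times_s pCons mv_holomorphic_on_const)
  then show ?case by (rule bs_span_cong) (simp add: algebra_simps)
qed (simp add: bs_span_zero)

lemma open_nonzero:
  "open U \<Longrightarrow> mv_holomorphic_on f U \<Longrightarrow> open {z \<in> U. f z \<noteq> 0}"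
  using continuous_open_preimage[of U f "- {0}"] mv_holomorphic_on_imp_continuous_on[of f U]
  by (auto simp: vimage_def Int_def)

lemma twisted_deriv_holomorphic:
  assumes "open U" "mv_holomorphic_on f U" "mv_holomorphic_on h {z \<in> U. f z \<noteq> 0}"
  shows "mv_holomorphic_on (twisted_deriv f s i h) {z \<in> U. f z \<noteq> 0}"
proof -
  let ?V = "{z \<in> U. f z \<noteq> 0}"
  have V: "open ?V" using assms by (intro open_nonzero)
  have "mv_holomorphic_on (\<lambda>z. partial_deriv i h z + s * (partial_deriv i f z * inverse (f z)) * h z) ?V"
    using assms V
    by (intro mv_holomorphic_on_add mv_holomorphic_on_mult mv_holomorphic_on_const mv_holomorphic_on_inverse
          mv_holomorphic_on_partial_deriv mv_holomorphic_on_subset[OF mv_holomorphic_on_partial_deriv[OF assms(2)]]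
          mv_holomorphic_on_subset[OF assms(2)]) auto
  then show ?thesis
    by (rule mv_holomorphic_on_cong[OF _ V]) (simp add: twisted_deriv_def divide_inverse)
qed

lemma twisted_word_holomorphic:
  assumes "open U" "mv_holomorphic_on f U"
  shows "mv_holomorphic_on (foldr (twisted_deriv f s) w f) {z \<in> U. f z \<noteq> 0}"
  by (induction w)
     (use assms in \<open>auto intro: twisted_deriv_holomorphic mv_holomorphic_on_subset[OF assms(2)]\<close>)

lemma twisted_deriv_cong:
  assumes "open U" "z \<in> U" "\<And>w. w \<in> U \<Longrightarrow> h w = h' w"
  shows "twisted_deriv f s i h z = twisted_deriv f s i h' z"
  using partial_deriv_cong[OF assms(1,2), of h h' i] assms(2,3) by (simp add: twisted_deriv_def)

lemma twisted_deriv_mult: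
  assumes "mv_holomorphic_on a V" "mv_holomorphic_on h V" "z \<in> V"
  shows "twisted_deriv f s i (\<lambda>z. a z * h z) z = partial_deriv i a z * h z + a z * twisted_deriv f s i h z"
  by (simp add: twisted_deriv_def partial_deriv_mult[OF assms] algebra_simps)

lemma twisted_deriv_sum:
  assumes "\<And>k. k \<in> A \<Longrightarrow> mv_holomorphic_on (h k) V" "z \<in> V"
  shows "twisted_deriv f s i (\<lambda>z. \<Sum>k\<in>A. h k z) z = (\<Sum>k\<in>A. twisted_deriv f s i (h k) z)"
  using partial_deriv_sum[where A = A and f = h and i = i, OF assms]
  by (simp add: twisted_deriv_def sum.distrib sum_distrib_left)

text \<open>By the Leibniz rule a derivation of a term is a sum of two terms, one with the derivative of the coefficient and one
  with a longer word. The coefficients stay holomorphic because partial derivatives are holomorphic.\<close>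
lemma bs_span_twisted_deriv:
  assumes U: "open U" and f: "mv_holomorphic_on f U" and "bs_span f U F"
  shows "bs_span f U (\<lambda>s. twisted_deriv f s i (F s))"
proof -
  obtain I a where I: "finite I" "\<And>p. p \<in> I \<Longrightarrow> mv_holomorphic_on (a p) U"
    and F: "\<And>s z. z \<in> U \<Longrightarrow> f z \<noteq> 0 \<Longrightarrow>
        F s z = (\<Sum>p\<in>I. s ^ fst p * a p z * foldr (twisted_deriv f s) (snd p) f z)"
    using assms(3) unfolding bs_span_def by blast
  let ?V = "{z \<in> U. f z \<noteq> 0}"
  have V: "open ?V" by (rule open_nonzero[OF U f])
  have "bs_span f U (\<lambda>s z. \<Sum>p\<in>I. s ^ fst p * partial_deriv i (a p) z * foldr (twisted_deriv f s) (snd p) f z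
      + s ^ fst p * a p z * foldr (twisted_deriv f s) (i # snd p) f z)"
    by (intro bs_span_sum bs_span_add bs_span_term I mv_holomorphic_on_partial_deriv U)
  then show ?thesis
  proof (rule bs_span_cong)
    fix s z assume "z \<in> U" "f z \<noteq> 0"
    then have z: "z \<in> ?V" by simp
    have aV: "mv_holomorphic_on (\<lambda>z. s ^ fst p * a p z) ?V" if "p \<in> I" for p
      by (intro mv_holomorphic_on_mult mv_holomorphic_on_const mv_holomorphic_on_subset[OF I(2)[OF that]]) auto
    have "twisted_deriv f s i (F s) z = twisted_deriv f s i (\<lambda>z. \<Sum>p\<in>I. s ^ fst p * a p z * foldr (twisted_deriv f s) (snd p) f z) z"
      by (rule twisted_deriv_cong[OF V z]) (simp add: F)
    also have "\<dots> = (\<Sum>p\<in>I. twisted_deriv f s i (\<lambda>z. s ^ fst p * a p z * foldr (twisted_deriv f s) (snd p) f z) z)"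
      by (rule twisted_deriv_sum[OF _ z]) (intro mv_holomorphic_on_mult[OF aV] twisted_word_holomorphic U f)
    also have "\<dots> = (\<Sum>p\<in>I. s ^ fst p * partial_deriv i (a p) z * foldr (twisted_deriv f s) (snd p) f z
      + s ^ fst p * a p z * foldr (twisted_deriv f s) (i # snd p) f z)"
    proof (rule sum.cong[OF refl])
      fix p assume p: "p \<in> I"
      have "partial_deriv i (\<lambda>z. s ^ fst p * a p z) z = s ^ fst p * partial_deriv i (a p) z"
        using partial_deriv_mult[OF mv_holomorphic_on_const[of "s ^ fst p"] I(2)[OF p] \<open>z \<in> U\<close>, where i = i]
        by (simp add: partial_deriv_const)
      then show "twisted_deriv f s i (\<lambda>z. s ^ fst p * a p z * foldr (twisted_deriv f s) (snd p) f z) z =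
        s ^ fst p * partial_deriv i (a p) z * foldr (twisted_deriv f s) (snd p) f z
        + s ^ fst p * a p z * foldr (twisted_deriv f s) (i # snd p) f z"
        using twisted_deriv_mult[OF aV[OF p] twisted_word_holomorphic[OF U f, of s "snd p"] z, where f = f and s = s and i = i]
        by simp
    qed
    finally show "twisted_deriv f s i (F s) z = (\<Sum>p\<in>I. s ^ fst p * partial_deriv i (a p) z * foldr (twisted_deriv f s) (snd p) f z
      + s ^ fst p * a p z * foldr (twisted_deriv f s) (i # snd p) f z)" .
  qed
qed

lemma bs_span_start: "mv_holomorphic_on a U \<Longrightarrow> bs_span f U (\<lambda>s z. a z * f z)"
  using bs_span_term[of a U f 0 "[]"] by simp

section \<open>Change of coordinates\<close>

text \<open>By the chain rule the twisted derivatives of the pullback are combinations of the pullbacks of the twisted derivatives, with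
  coefficients in the Jacobian matrix of \<open>\<phi>\<close> and a correction from the logarithmic derivative of the unit \<open>e\<close>. The
  Jacobian matrix of \<open>\<psi>\<close> inverts this relation.\<close>
lemma bs_span_word_transfer:
  fixes \<phi> :: "complex^'n::finite \<Rightarrow> complex^'m::finite" and \<psi> :: "complex^'m \<Rightarrow> complex^'n"
  assumes U: "open U" and V: "open V" and \<phi>: "holomorphic_map_on \<phi> U" and \<psi>: "holomorphic_map_on \<psi> V"
    and im: "\<phi> ` U \<subseteq> V" "\<psi> ` V \<subseteq> U" and inv: "\<And>z. z \<in> U \<Longrightarrow> \<psi> (\<phi> z) = z" "\<And>v. v \<in> V \<Longrightarrow> \<phi> (\<psi> v) = v"
    and e: "mv_holomorphic_on e U" "\<And>z. z \<in> U \<Longrightarrow> e z \<noteq> 0"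
    and f: "\<And>z. z \<in> U \<Longrightarrow> f z = e z * g (\<phi> z)" and g: "mv_holomorphic_on g V"
  shows "bs_span f U (\<lambda>s z. foldr (twisted_deriv g s) w g (\<phi> z))"
proof -
  have "mv_holomorphic_on (\<lambda>z. e z * g (\<phi> z)) U"
    by (intro mv_holomorphic_on_mult e mv_holomorphic_on_compose[OF \<phi> g im(1)])
  then have fU: "mv_holomorphic_on f U"
    by (rule mv_holomorphic_on_cong[OF _ U]) (simp add: f)
  have g\<phi>: "has_gradient (\<lambda>z. \<phi> z $ j) (\<lambda>l. partial_deriv l (\<lambda>z. \<phi> z $ j) z) z" if "z \<in> U" for j z
    using \<phi> that by (auto simp: holomorphic_map_on_def mv_holomorphic_on_iff)
  have g\<psi>: "has_gradient (\<lambda>z. \<psi> z $ j) (\<lambda>l. partial_deriv l (\<lambda>z. \<psi> z $ j) z) z" if "z \<in> V" for j z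
    using \<psi> that by (auto simp: holomorphic_map_on_def mv_holomorphic_on_iff)
  have jac: "(\<Sum>l\<in>UNIV. partial_deriv i (\<lambda>v. \<psi> v $ l) (\<phi> z) * partial_deriv l (\<lambda>z. \<phi> z $ j) z) = (if i = j then 1 else 0)"
    if z: "z \<in> U" for z i j
  proof -
    have \<phi>z: "\<phi> z \<in> V" using im z by auto
    have "has_gradient (\<lambda>v. \<phi> (\<psi> v) $ j)
       (\<lambda>i. \<Sum>l\<in>UNIV. partial_deriv i (\<lambda>v. \<psi> v $ l) (\<phi> z) * partial_deriv l (\<lambda>z. \<phi> z $ j) z) (\<phi> z)"
      by (rule has_gradient_compose[where h = "\<lambda>z. \<phi> z $ j"]) (use g\<phi>[OF z] g\<psi>[OF \<phi>z] inv(1)[OF z] in auto)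
    then have "has_gradient (\<lambda>v. v $ j)
       (\<lambda>i. \<Sum>l\<in>UNIV. partial_deriv i (\<lambda>v. \<psi> v $ l) (\<phi> z) * partial_deriv l (\<lambda>z. \<phi> z $ j) z) (\<phi> z)"
      by (rule has_gradient_transform[OF _ V \<phi>z]) (simp add: inv)
    from has_gradient_imp_partial_deriv[OF this, of i] has_gradient_imp_partial_deriv[OF has_gradient_coord, of i j "\<phi> z"]
    show ?thesis by simp
  qed
  show ?thesis
  proof (induction w)
    case Nil
    have "bs_span f U (\<lambda>s z. inverse (e z) * f z)"
      by (intro bs_span_start mv_holomorphic_on_inverse e)
    then show ?case by (rule bs_span_cong) (simp add: f e(2))
  next
    case (Cons i w)
    let ?H = "\<lambda>s. foldr (twisted_deriv g s) w g"
    let ?V' = "{v \<in> V. g v \<noteq> 0}"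
    let ?R = "\<lambda>l s z. twisted_deriv f s l (\<lambda>z. ?H s (\<phi> z)) z - s * (partial_deriv l e z * inverse (e z) * ?H s (\<phi> z))"
    have R: "?R l s z = (\<Sum>j\<in>UNIV. partial_deriv l (\<lambda>z. \<phi> z $ j) z * twisted_deriv g s j (?H s) (\<phi> z))"
      if z: "z \<in> U" "f z \<noteq> 0" for l s z
    proof -
      have \<phi>z: "\<phi> z \<in> V" "g (\<phi> z) \<noteq> 0" using im z f by auto
      have "has_gradient (?H s) (\<lambda>j. partial_deriv j (?H s) (\<phi> z)) (\<phi> z)"
        by (rule mv_holomorphic_onD[OF twisted_word_holomorphic[OF V g]]) (use \<phi>z in simp)
      from has_gradient_imp_partial_deriv[OF has_gradient_compose[OF this g\<phi>[OF z(1)]]]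
      have 1: "partial_deriv l (\<lambda>z. ?H s (\<phi> z)) z = (\<Sum>j\<in>UNIV. partial_deriv l (\<lambda>z. \<phi> z $ j) z * partial_deriv j (?H s) (\<phi> z))" .
      have gg: "has_gradient (\<lambda>z. g (\<phi> z)) (\<lambda>l. \<Sum>j\<in>UNIV. partial_deriv l (\<lambda>z. \<phi> z $ j) z * partial_deriv j g (\<phi> z)) z"
        by (rule has_gradient_compose[OF mv_holomorphic_onD[OF g \<phi>z(1)] g\<phi>[OF z(1)]])
      have "partial_deriv l f z = partial_deriv l (\<lambda>z. e z * g (\<phi> z)) z"
        by (rule partial_deriv_cong[OF U z(1)]) (rule f)
      also have "\<dots> = partial_deriv l e z * g (\<phi> z) + e z * (\<Sum>j\<in>UNIV. partial_deriv l (\<lambda>z. \<phi> z $ j) z * partial_deriv j g (\<phi> z))"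
        by (rule has_gradient_imp_partial_deriv[OF has_gradient_mult[OF mv_holomorphic_onD[OF e(1) z(1)] gg]])
      finally have "partial_deriv l f z / f z = partial_deriv l e z * inverse (e z) +
          (\<Sum>j\<in>UNIV. partial_deriv l (\<lambda>z. \<phi> z $ j) z * partial_deriv j g (\<phi> z)) / g (\<phi> z)"
        using e(2)[OF z(1)] \<phi>z(2) by (simp add: f[OF z(1)] field_simps)
      then have "?R l s z = (\<Sum>j\<in>UNIV. partial_deriv l (\<lambda>z. \<phi> z $ j) z * partial_deriv j (?H s) (\<phi> z)) +
          s * ((\<Sum>j\<in>UNIV. partial_deriv l (\<lambda>z. \<phi> z $ j) z * partial_deriv j g (\<phi> z)) / g (\<phi> z)) * ?H s (\<phi> z)"
        unfolding twisted_deriv_def[of f] 1 by (simp add: algebra_simps)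
      then show ?thesis
        by (simp add: twisted_deriv_def[of g] sum.distrib sum_distrib_left sum_distrib_right sum_divide_distrib algebra_simps)
    qed
    have "bs_span f U (\<lambda>s z. (-1) * (s * (partial_deriv l e z * inverse (e z) * ?H s (\<phi> z))))" for l
      by (intro bs_span_mult[where b = "\<lambda>z. -1"] bs_span_times_s bs_span_mult[where b = "\<lambda>z. partial_deriv l e z * inverse (e z)"]
          Cons mv_holomorphic_on_const mv_holomorphic_on_mult mv_holomorphic_on_inverse mv_holomorphic_on_partial_deriv e U)
    from bs_span_add[OF bs_span_twisted_deriv[OF U fU Cons] this]
    have span: "bs_span f U (?R l)" for l by simp
    have "bs_span f U (\<lambda>s z. \<Sum>l\<in>UNIV. partial_deriv i (\<lambda>v. \<psi> v $ l) (\<phi> z) * ?R l s z)"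
    proof (intro bs_span_sum bs_span_mult span)
      fix l show "mv_holomorphic_on (\<lambda>z. partial_deriv i (\<lambda>v. \<psi> v $ l) (\<phi> z)) U"
        using \<psi> by (intro mv_holomorphic_on_compose[OF \<phi> _ im(1)] mv_holomorphic_on_partial_deriv V)
          (auto simp: holomorphic_map_on_def)
    qed
    then show ?case
    proof (rule bs_span_cong)
      fix s z assume z: "z \<in> U" "f z \<noteq> 0"
      let ?T = "\<lambda>j. twisted_deriv g s j (?H s) (\<phi> z)"
      have "(\<Sum>l\<in>UNIV. partial_deriv i (\<lambda>v. \<psi> v $ l) (\<phi> z) * ?R l s z) =
          (\<Sum>l\<in>UNIV. \<Sum>j\<in>UNIV. partial_deriv i (\<lambda>v. \<psi> v $ l) (\<phi> z) * partial_deriv l (\<lambda>z. \<phi> z $ j) z * ?T j)"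
        unfolding R[OF z] by (simp add: sum_distrib_left mult.assoc)
      also have "\<dots> = (\<Sum>j\<in>UNIV. \<Sum>l\<in>UNIV. partial_deriv i (\<lambda>v. \<psi> v $ l) (\<phi> z) * partial_deriv l (\<lambda>z. \<phi> z $ j) z * ?T j)"
        by (rule sum.swap)
      also have "\<dots> = (\<Sum>j\<in>UNIV. (if i = j then 1 else 0) * ?T j)"
        unfolding sum_distrib_right[symmetric] jac[OF z(1)] ..
      also have "\<dots> = ?T i" by (simp add: if_distrib[of "\<lambda>x. x * _"] cong: if_cong)
      finally show "foldr (twisted_deriv g s) (i # w) g (\<phi> z) = (\<Sum>l\<in>UNIV. partial_deriv i (\<lambda>v. \<psi> v $ l) (\<phi> z) * ?R l s z)"
        by simp
    qed
  qed
qed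

lemma holomorphic_map_on_subset: "holomorphic_map_on \<phi> U \<Longrightarrow> V \<subseteq> U \<Longrightarrow> holomorphic_map_on \<phi> V"
  unfolding holomorphic_map_on_def using mv_holomorphic_on_subset by blast

lemma holomorphic_map_on_imp_continuous_on:
  assumes "holomorphic_map_on \<phi> U"
  shows "continuous_on U \<phi>"
proof -
  have "continuous_on U (\<lambda>z. \<chi> j. \<phi> z $ j)"
    using assms by (intro continuous_on_vec_lambda mv_holomorphic_on_imp_continuous_on)
      (auto simp: holomorphic_map_on_def)
  then show ?thesis by simp
qed

lemma analytically_equivalentE:
  assumes "analytically_equivalent f x g y"
  obtains U V \<phi> \<psi> e where "open U" "x \<in> U" "open V" "y \<in> V"
    "holomorphic_map_on \<phi> U" "holomorphic_map_on \<psi> V" "\<phi> ` U = V" "\<psi> ` V = U"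
    "\<forall>z\<in>U. \<psi> (\<phi> z) = z" "\<forall>w\<in>V. \<phi> (\<psi> w) = w" "\<phi> x = y"
    "mv_holomorphic_on e U" "\<forall>z\<in>U. e z \<noteq> 0" "\<forall>z\<in>U. f z = e z * g (\<phi> z)"
  using assms unfolding analytically_equivalent_def by (elim exE conjE) (rule that)

theorem bernstein_equation_transfer:
  fixes f :: "complex^'n::finite \<Rightarrow> complex" and g :: "complex^'m::finite \<Rightarrow> complex"
  assumes "analytically_equivalent f x g y" "bernstein_equation g y b"
  shows "bernstein_equation f x b"
proof -
  obtain U V \<phi> \<psi> e where U: "open U" "x \<in> U" and V: "open V" "y \<in> V"
    and hol: "holomorphic_map_on \<phi> U" "holomorphic_map_on \<psi> V"
    and im: "\<phi> ` U = V" "\<psi> ` V = U" and inv0: "\<forall>z\<in>U. \<psi> (\<phi> z) = z" "\<forall>w\<in>V. \<phi> (\<psi> w) = w"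
    and x: "\<phi> x = y" and e0: "mv_holomorphic_on e U" "\<forall>z\<in>U. e z \<noteq> 0"
    and f0: "\<forall>z\<in>U. f z = e z * g (\<phi> z)"
    by (rule analytically_equivalentE[OF assms(1)])
  note inv = bspec[OF inv0(1)] bspec[OF inv0(2)] and e = e0(1) bspec[OF e0(2)] and f = bspec[OF f0]
  obtain V0 where V0: "open V0" "y \<in> V0" "mv_holomorphic_on g V0" "bs_span g V0 (\<lambda>s z. poly b s)"
    using assms(2) unfolding bernstein_equation_iff_bs_span by blast
  define V1 where "V1 = V \<inter> V0"
  define U1 where "U1 = U \<inter> \<phi> -` V1"
  have V1: "open V1" "y \<in> V1" "V1 \<subseteq> V" "V1 \<subseteq> V0" using V V0 by (auto simp: V1_def)
  have U1: "open U1" "x \<in> U1" "U1 \<subseteq> U"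
    using continuous_open_preimage[OF holomorphic_map_on_imp_continuous_on[OF hol(1)] U(1) V1(1)] U V1 x
    by (auto simp: U1_def)
  have im1: "\<phi> ` U1 \<subseteq> V1" "\<psi> ` V1 \<subseteq> U1" using im inv V1(3) by (auto simp: U1_def)
  have hol1: "holomorphic_map_on \<phi> U1" "holomorphic_map_on \<psi> V1"
    using hol U1 V1 by (auto intro: holomorphic_map_on_subset)
  have e1: "mv_holomorphic_on e U1" using e(1) U1(3) by (rule mv_holomorphic_on_subset)
  have g1: "mv_holomorphic_on g V1" using V0(3) V1(4) by (rule mv_holomorphic_on_subset)
  have "mv_holomorphic_on (\<lambda>z. e z * g (\<phi> z)) U1"
    by (intro mv_holomorphic_on_mult e1 mv_holomorphic_on_compose[OF hol1(1) g1 im1(1)])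
  then have f1: "mv_holomorphic_on f U1"
    by (rule mv_holomorphic_on_cong[OF _ U1(1)]) (use f U1(3) in auto)
  have word: "bs_span f U1 (\<lambda>s z. foldr (twisted_deriv g s) w g (\<phi> z))" for w
    by (rule bs_span_word_transfer[OF U1(1) V1(1) hol1 im1 _ _ e1 _ _ g1]) (use inv e f U1 V1 in auto)
  obtain I a where I: "finite I" "\<And>p. p \<in> I \<Longrightarrow> mv_holomorphic_on (a p) V1"
    and b: "\<And>s z. z \<in> V1 \<Longrightarrow> g z \<noteq> 0 \<Longrightarrow>
        poly b s = (\<Sum>p\<in>I. s ^ fst p * a p z * foldr (twisted_deriv g s) (snd p) g z)"
    using bs_span_subset[OF V0(4) V1(4)] unfolding bs_span_def by blast
  have "bs_span f U1 (\<lambda>s z. \<Sum>p\<in>I. poly (monom 1 (fst p)) s * (a p (\<phi> z) * foldr (twisted_deriv g s) (snd p) g (\<phi> z)))"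
    by (intro bs_span_sum bs_span_times_poly bs_span_mult word mv_holomorphic_on_compose[OF hol1(1) I(2) im1(1)])
  then have "bs_span f U1 (\<lambda>s z. poly b s)"
  proof (rule bs_span_cong)
    fix s z assume z: "z \<in> U1" "f z \<noteq> 0"
    then have "\<phi> z \<in> V1" "g (\<phi> z) \<noteq> 0" using im1 f[of z] U1(3) by auto
    then show "poly b s = (\<Sum>p\<in>I. poly (monom 1 (fst p)) s * (a p (\<phi> z) * foldr (twisted_deriv g s) (snd p) g (\<phi> z)))"
      using b by (simp add: poly_monom mult.assoc)
  qed
  with U1(1,2) f1 show ?thesis unfolding bernstein_equation_iff_bs_span
    by (intro exI[of _ U1] conjI)
qed

lemma analytically_equivalent_sym:
  fixes f :: "complex^'n::finite \<Rightarrow> complex" and g :: "complex^'m::finite \<Rightarrow> complex"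
  assumes "analytically_equivalent f x g y"
  shows "analytically_equivalent g y f x"
proof -
  obtain U V \<phi> \<psi> e where U: "open U" "x \<in> U" and V: "open V" "y \<in> V"
    and hol: "holomorphic_map_on \<phi> U" "holomorphic_map_on \<psi> V"
    and im: "\<phi> ` U = V" "\<psi> ` V = U" and inv0: "\<forall>z\<in>U. \<psi> (\<phi> z) = z" "\<forall>w\<in>V. \<phi> (\<psi> w) = w"
    and x: "\<phi> x = y" and e0: "mv_holomorphic_on e U" "\<forall>z\<in>U. e z \<noteq> 0"
    and f0: "\<forall>z\<in>U. f z = e z * g (\<phi> z)"
    by (rule analytically_equivalentE[OF assms])
  note inv = bspec[OF inv0(1)] bspec[OF inv0(2)] and e = e0(1) bspec[OF e0(2)] and f = bspec[OF f0]
  have \<psi>: "\<psi> w \<in> U" if "w \<in> V" for w using im(2) that by blast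
  have eV: "mv_holomorphic_on (\<lambda>w. inverse (e (\<psi> w))) V"
    by (intro mv_holomorphic_on_inverse mv_holomorphic_on_compose[OF hol(2) e(1)]) (use e im in auto)
  show ?thesis
    unfolding analytically_equivalent_def
  proof (rule exI[of _ V], rule exI[of _ U], rule exI[of _ \<psi>], rule exI[of _ \<phi>],
      rule exI[of _ "\<lambda>w. inverse (e (\<psi> w))"], intro conjI ballI)
    show "g w = inverse (e (\<psi> w)) * f (\<psi> w)" if "w \<in> V" for w
      using f[OF \<psi>[OF that]] e(2)[OF \<psi>[OF that]] inv(2)[OF that] by simp
    show "inverse (e (\<psi> w)) \<noteq> 0" if "w \<in> V" for w using e(2)[OF \<psi>[OF that]] by simp
    show "\<psi> y = x" using inv(1)[OF U(2)] x by simp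
  qed (use U V hol im inv eV in auto)
qed

corollary bernstein_equation_iff:
  "analytically_equivalent f x g y \<Longrightarrow> bernstein_equation f x = bernstein_equation g y"
  by (rule ext) (metis bernstein_equation_transfer analytically_equivalent_sym)

corollary minimal_exponent_analytically_equivalent:
  "analytically_equivalent f x g y \<Longrightarrow> minimal_exponent f x = minimal_exponent g y"
  by (simp add: minimal_exponent_def reduced_bernstein_sato_poly_def bernstein_sato_poly_def bernstein_equation_iff)

section \<open>Approximation by Taylor polynomials\<close>

text \<open>The origin is left out because Cauchy's estimate for a derivative at \<open>z\<close> uses a disc of radius \<open>norm z / 2\<close>.\<close>
definition vanishes_to_order :: "nat \<Rightarrow> (complex^'n::finite \<Rightarrow> complex) \<Rightarrow> bool" where
  "vanishes_to_order K r \<longleftrightarrow>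
     (\<exists>C \<epsilon>. 0 < \<epsilon> \<and> (\<forall>z. 0 < norm z \<and> norm z < \<epsilon> \<longrightarrow> norm (r z) \<le> C * norm z ^ K))"

lemma vanishes_to_orderI:
  "0 < \<epsilon> \<Longrightarrow> (\<And>z. 0 < norm z \<Longrightarrow> norm z < \<epsilon> \<Longrightarrow> norm (r z) \<le> C * norm z ^ K) \<Longrightarrow> vanishes_to_order K r"
  unfolding vanishes_to_order_def by blast

lemma vanishes_to_order_add:
  assumes "vanishes_to_order K r" "vanishes_to_order K s"
  shows "vanishes_to_order K (\<lambda>z. r z + s z)"
proof -
  obtain C \<epsilon> where C: "0 < \<epsilon>" "\<And>z. 0 < norm z \<Longrightarrow> norm z < \<epsilon> \<Longrightarrow> norm (r z) \<le> C * norm z ^ K"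
    using assms(1) unfolding vanishes_to_order_def by blast
  obtain D \<delta> where D: "0 < \<delta>" "\<And>z. 0 < norm z \<Longrightarrow> norm z < \<delta> \<Longrightarrow> norm (s z) \<le> D * norm z ^ K"
    using assms(2) unfolding vanishes_to_order_def by blast
  show ?thesis
  proof (rule vanishes_to_orderI)
    show "0 < min \<epsilon> \<delta>" using C D by simp
    fix z :: "complex^'a" assume z: "0 < norm z" "norm z < min \<epsilon> \<delta>"
    have "norm (r z + s z) \<le> norm (r z) + norm (s z)" by (rule norm_triangle_ineq)
    also have "\<dots> \<le> C * norm z ^ K + D * norm z ^ K" using C(2) D(2) z by (intro add_mono) auto
    finally show "norm (r z + s z) \<le> (C + D) * norm z ^ K" by (simp add: algebra_simps)
  qed
qed

lemma vanishes_to_order_zero: "vanishes_to_order K (\<lambda>z. 0)"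
  by (rule vanishes_to_orderI[of 1 _ 0]) auto

lemma vanishes_to_order_sum:
  "(\<And>k. k \<in> A \<Longrightarrow> vanishes_to_order K (r k)) \<Longrightarrow> vanishes_to_order K (\<lambda>z. \<Sum>k\<in>A. r k z)"
  by (induction A rule: infinite_finite_induct) (auto intro: vanishes_to_order_add vanishes_to_order_zero)

lemma holomorphic_bounded_near_0:
  assumes "mv_holomorphic_on a U" "open U" "0 \<in> U"
  obtains B \<epsilon> where "0 < \<epsilon>" "0 \<le> B" "cball 0 \<epsilon> \<subseteq> U" "\<And>z. norm z \<le> \<epsilon> \<Longrightarrow> norm (a z) \<le> B"
proof -
  obtain \<epsilon> where e: "0 < \<epsilon>" "cball 0 \<epsilon> \<subseteq> U" using assms open_contains_cball by blast
  have "continuous_on (cball 0 \<epsilon>) a"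
    using mv_holomorphic_on_imp_continuous_on[OF assms(1)] e(2) continuous_on_subset by blast
  then have "bounded (a ` cball 0 \<epsilon>)"
    by (intro compact_imp_bounded compact_continuous_image compact_cball)
  then obtain B where B: "\<And>z. z \<in> cball 0 \<epsilon> \<Longrightarrow> norm (a z) \<le> B" unfolding bounded_iff by blast
  have "0 \<le> B" using B[of 0] e(1) norm_ge_zero order_trans by (metis centre_in_cball less_imp_le)
  then show ?thesis using that[of \<epsilon> B] e B by auto
qed

lemma vanishes_to_order_mult:
  assumes "mv_holomorphic_on a U" "open U" "0 \<in> U" "vanishes_to_order K r"
  shows "vanishes_to_order K (\<lambda>z. a z * r z)"
proof -
  obtain B \<epsilon> where B: "0 < \<epsilon>" "0 \<le> B" "\<And>z. norm z \<le> \<epsilon> \<Longrightarrow> norm (a z) \<le> B"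
    using holomorphic_bounded_near_0[OF assms(1-3)] by metis
  obtain C \<delta> where C: "0 < \<delta>" "\<And>z. 0 < norm z \<Longrightarrow> norm z < \<delta> \<Longrightarrow> norm (r z) \<le> C * norm z ^ K"
    using assms(4) unfolding vanishes_to_order_def by blast
  show ?thesis
  proof (rule vanishes_to_orderI)
    show "0 < min \<epsilon> \<delta>" using C B by simp
    fix z :: "complex^'a" assume z: "0 < norm z" "norm z < min \<epsilon> \<delta>"
    have "norm (a z * r z) \<le> B * (C * norm z ^ K)"
      unfolding norm_mult using B C z by (intro mult_mono) auto
    then show "norm (a z * r z) \<le> (B * C) * norm z ^ K" by (simp add: mult.assoc)
  qed
qed

lemma vanishes_to_order_Suc:
  assumes "vanishes_to_order (Suc K) r"
  shows "vanishes_to_order K r"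
proof -
  obtain C \<epsilon> where C: "0 < \<epsilon>" "\<And>z. 0 < norm z \<Longrightarrow> norm z < \<epsilon> \<Longrightarrow> norm (r z) \<le> C * norm z ^ Suc K"
    using assms(1) unfolding vanishes_to_order_def by blast
  show ?thesis
  proof (rule vanishes_to_orderI)
    show "0 < \<epsilon>" by (rule C)
    fix z :: "complex^'a" assume z: "0 < norm z" "norm z < \<epsilon>"
    have "0 \<le> C * norm z ^ Suc K" using C(2)[OF z] norm_ge_zero order_trans by blast
    then have "0 \<le> C" using zero_less_power[OF z(1), of "Suc K"] unfolding zero_le_mult_iff by linarith
    have "norm (r z) \<le> C * norm z ^ Suc K" by (rule C(2)[OF z])
    also have "\<dots> = C * norm z * norm z ^ K" by simp
    also have "\<dots> \<le> C * \<epsilon> * norm z ^ K"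
      using \<open>0 \<le> C\<close> z by (intro mult_right_mono mult_left_mono) auto
    finally show "norm (r z) \<le> (C * \<epsilon>) * norm z ^ K" .
  qed
qed

lemma vanishes_to_order_partial_deriv:
  assumes r: "mv_holomorphic_on r U" and U: "open U" "0 \<in> U" and "vanishes_to_order (Suc K) r"
  shows "vanishes_to_order K (partial_deriv i r)"
proof -
  obtain C \<epsilon> where C: "0 < \<epsilon>" "\<And>z. 0 < norm z \<Longrightarrow> norm z < \<epsilon> \<Longrightarrow> norm (r z) \<le> C * norm z ^ Suc K"
    using assms(4) unfolding vanishes_to_order_def by blast
  obtain \<delta> where \<delta>: "0 < \<delta>" "ball 0 \<delta> \<subseteq> U" using U open_contains_ball by blast
  define \<rho> where "\<rho> = min \<epsilon> \<delta> / 2"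
  show ?thesis
  proof (rule vanishes_to_orderI)
    show "0 < \<rho>" using C \<delta> by (simp add: \<rho>_def)
    fix z :: "complex^'a" assume z: "0 < norm z" "norm z < \<rho>"
    have n: "norm (z + axis i t) \<le> 3 / 2 * norm z" "0 < norm (z + axis i t)" if t: "norm t \<le> norm z / 2" for t
    proof -
      show "norm (z + axis i t) \<le> 3 / 2 * norm z"
        using norm_triangle_ineq[of z "axis i t"] t by (simp add: norm_axis_complex)
      have "norm z - norm (axis i t) \<le> norm (z + axis i t)" by (rule norm_diff_ineq)
      then show "0 < norm (z + axis i t)" using t z(1) unfolding norm_axis_complex by linarith
    qed
    have "0 \<le> C * norm z ^ Suc K"
    proof (rule order_trans[OF norm_ge_zero C(2)[OF z(1)]])
      show "norm z < \<epsilon>" using z C(1) \<delta>(1) by (simp add: \<rho>_def)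
    qed
    then have C0: "0 \<le> C" using zero_less_power[OF z(1), of "Suc K"] unfolding zero_le_mult_iff by linarith
    have "norm (partial_deriv i r z) \<le> C * (3 / 2 * norm z) ^ Suc K / (norm z / 2)"
    proof (rule norm_partial_deriv_le[OF r])
      fix t :: complex assume t: "norm t \<le> norm z / 2"
      have less: "norm (z + axis i t) < \<epsilon>" "norm (z + axis i t) < \<delta>"
        using n(1)[OF t] z C(1) \<delta>(1) by (auto simp: \<rho>_def)
      then show "z + axis i t \<in> U" using \<delta>(2) by auto
      have "norm (r (z + axis i t)) \<le> C * norm (z + axis i t) ^ Suc K"
        by (rule C(2)[OF n(2)[OF t] less(1)])
      also have "\<dots> \<le> C * (3 / 2 * norm z) ^ Suc K"
        by (intro mult_left_mono power_mono n(1)[OF t] norm_ge_zero C0)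
      finally show "norm (r (z + axis i t)) \<le> C * (3 / 2 * norm z) ^ Suc K" .
    qed (use z in simp)
    also have "\<dots> = (3 * C * (3 / 2) ^ K) * norm z ^ K"
      unfolding power_mult_distrib using z(1) by simp
    finally show "norm (partial_deriv i r z) \<le> (3 * C * (3 / 2) ^ K) * norm z ^ K" .
  qed
qed

lemma vanishes_at_0:
  assumes "mv_holomorphic_on r U" "open U" "0 \<in> U" "vanishes_to_order (Suc K) r"
  shows "r 0 = 0"
proof -
  obtain C \<epsilon> where C: "0 < \<epsilon>" "\<And>z. 0 < norm z \<Longrightarrow> norm z < \<epsilon> \<Longrightarrow> norm (r z) \<le> C * norm z ^ Suc K"
    using assms(4) unfolding vanishes_to_order_def by blast
  let ?z = "\<lambda>n. axis undefined (complex_of_real (1 / (real n + 1))) :: complex^'a"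
  have nz: "norm (?z n) = 1 / (real n + 1)" for n by (simp only: norm_axis_complex norm_of_real) simp
  have z0: "?z \<longlonglongrightarrow> 0"
    by (rule tendsto_norm_zero_cancel, unfold nz) real_asymp
  have "isCont r 0"
    using mv_holomorphic_on_imp_continuous_on[OF assms(1)] assms(2,3) by (simp add: continuous_on_eq_continuous_at)
  then have "(\<lambda>n. r (?z n)) \<longlonglongrightarrow> r 0" using z0 by (rule isCont_tendsto_compose)
  moreover have "(\<lambda>n. r (?z n)) \<longlonglongrightarrow> 0"
  proof (rule Lim_null_comparison)
    show "(\<lambda>n. C * (1 / (real n + 1)) ^ Suc K) \<longlonglongrightarrow> 0"
      by (intro tendsto_mult_right_zero tendsto_null_power) (real_asymp, simp)
    have "eventually (\<lambda>n. 1 / (real n + 1) < \<epsilon>) sequentially" using C(1) by real_asymp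
    then show "eventually (\<lambda>n. norm (r (?z n)) \<le> C * (1 / (real n + 1)) ^ Suc K) sequentially"
      by eventually_elim (use C(2)[of "?z _"] in \<open>simp only: nz, simp\<close>)
  qed
  ultimately show ?thesis by (rule LIMSEQ_unique)
qed

lemma word_deriv_holomorphic:
  "mv_holomorphic_on A U \<Longrightarrow> open U \<Longrightarrow> mv_holomorphic_on (foldr partial_deriv w A) U"
  by (induction w) (auto intro: mv_holomorphic_on_partial_deriv)

text \<open>Taylor's formula on the complex line through \<open>z\<close> and the origin. Its coefficients are sums over words of
  coordinate directions, so they are homogeneous polynomials in \<open>z\<close>.\<close>
lemma taylor_polynomial:
  assumes A: "mv_holomorphic_on A U" and U: "open U" "0 \<in> U"
  shows "\<exists>p. vanishes_to_order (Suc n) (\<lambda>z. A z - peval p z)"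
proof -
  let ?D = "\<lambda>w. foldr partial_deriv w A"
  let ?m = "\<lambda>w z. prod_list (map (($) z) w) :: complex"
  let ?W = "\<lambda>k. {w :: 'a list. length w = k}"
  have finW: "finite (?W k)" for k using finite_lists_length_eq[of "UNIV :: 'a set" k] by simp
  have W_Suc: "?W (Suc k) = (\<lambda>(j, w). j # w) ` (UNIV \<times> ?W k)" for k
    by (auto simp: length_Suc_conv image_iff)
  obtain \<epsilon> where e: "0 < \<epsilon>" "cball 0 \<epsilon> \<subseteq> U" using U open_contains_cball by blast
  have "\<exists>B. \<forall>z\<in>cball 0 \<epsilon>. norm (?D w z) \<le> B" for w
  proof -
    have "continuous_on (cball 0 \<epsilon>) (?D w)"
      using mv_holomorphic_on_imp_continuous_on[OF word_deriv_holomorphic[OF A U(1)]] e(2) continuous_on_subset by blast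
    then have "bounded (?D w ` cball 0 \<epsilon>)"
      by (intro compact_imp_bounded compact_continuous_image compact_cball)
    then show ?thesis unfolding bounded_iff by blast
  qed
  then obtain B where B: "\<And>w z. z \<in> cball 0 \<epsilon> \<Longrightarrow> norm (?D w z) \<le> B w" by metis
  have m_le: "norm (?m w z) \<le> norm z ^ length w" for w z
  proof (induction w)
    case (Cons j w)
    then show ?case by (simp add: norm_mult mult_mono Finite_Cartesian_Product.norm_nth_le)
  qed simp
  define p where "p = (\<Sum>k\<le>n. \<Sum>w\<in>?W k. Const (?D w 0 / fact k) * prod_list (map Var w))"
  have evm: "peval (prod_list (map Var w)) z = ?m w z" for w z
    by (induction w) (auto simp: peval_mult)
  have evp: "peval p z = (\<Sum>k\<le>n. (\<Sum>w\<in>?W k. ?m w z * ?D w 0) / fact k)" for z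
    by (simp add: p_def peval_sum peval_mult evm sum_divide_distrib mult.commute)
  have "vanishes_to_order (Suc n) (\<lambda>z. A z - peval p z)"
  proof (rule vanishes_to_orderI[OF e(1)])
    fix z :: "complex^'a" assume z: "0 < norm z" "norm z < \<epsilon>"
    define g where "g = (\<lambda>k t. \<Sum>w\<in>?W k. ?m w z * ?D w (t *s z))"
    have tz: "t *s z \<in> cball 0 \<epsilon>" if "t \<in> cball 0 1" for t :: complex
    proof -
      have "norm (t *s z) = norm t * norm z" by (simp add: norm_vec_def norm_mult L2_set_right_distrib)
      also have "\<dots> \<le> 1 * \<epsilon>" using that z by (intro mult_mono) auto
      finally show ?thesis by simp
    qed
    have "norm (g 0 1 - (\<Sum>k\<le>n. g k 0 * (1 - 0) ^ k / fact k)) \<le>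
        ((\<Sum>w\<in>?W (Suc n). B w) * norm z ^ Suc n) * norm ((1::complex) - 0) ^ Suc n / fact n"
    proof (rule complex_Taylor[OF convex_cball])
      fix k and t :: complex assume t: "t \<in> cball 0 1"
      have "((\<lambda>t. ?D w (t *s z)) has_field_derivative (\<Sum>j\<in>UNIV. z $ j * ?D (j # w) (t *s z))) (at t)" for w
        using has_gradient_line[OF mv_holomorphic_onD[OF word_deriv_holomorphic[OF A U(1), of w]], of 0 t z] tz[OF t] e(2)
        by (auto simp: subset_iff)
      then have "(g k has_field_derivative (\<Sum>w\<in>?W k. ?m w z * (\<Sum>j\<in>UNIV. z $ j * ?D (j # w) (t *s z)))) (at t)"
        unfolding g_def by (intro DERIV_sum DERIV_cmult)
      also have "(\<Sum>w\<in>?W k. ?m w z * (\<Sum>j\<in>UNIV. z $ j * ?D (j # w) (t *s z))) =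
          (\<Sum>j\<in>UNIV. \<Sum>w\<in>?W k. ?m (j # w) z * ?D (j # w) (t *s z))"
        by (subst sum.swap) (simp add: sum_distrib_left mult_ac)
      also have "\<dots> = g (Suc k) t"
        unfolding g_def W_Suc
        by (subst sum.reindex) (auto simp: inj_on_def sum.cartesian_product case_prod_unfold)
      finally show "(g k has_field_derivative g (Suc k) t) (at t within cball 0 1)"
        by (rule DERIV_subset) simp
    next
      fix t :: complex assume t: "t \<in> cball 0 1"
      have "norm (g (Suc n) t) \<le> (\<Sum>w\<in>?W (Suc n). norm z ^ Suc n * B w)"
        unfolding g_def
      proof (rule order_trans[OF norm_sum], rule sum_mono)
        fix w assume "w \<in> ?W (Suc n)"
        then show "norm (?m w z * ?D w (t *s z)) \<le> norm z ^ Suc n * B w"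
          unfolding norm_mult using m_le[of z w] B[OF tz[OF t], of w] by (intro mult_mono) auto
      qed
      then show "norm (g (Suc n) t) \<le> (\<Sum>w\<in>?W (Suc n). B w) * norm z ^ Suc n"
        unfolding sum_distrib_left[symmetric] by (subst mult.commute)
    qed auto
    moreover have "g 0 1 = A z" by (simp add: g_def)
    moreover have "(\<Sum>k\<le>n. g k 0 * (1 - 0) ^ k / fact k) = peval p z"
      by (simp add: evp g_def)
    ultimately show "norm (A z - peval p z) \<le> ((\<Sum>w\<in>?W (Suc n). B w) / fact n) * norm z ^ Suc n"
      by simp
  qed
  then show ?thesis ..
qed

lemma word_Diff_vanishes:
  assumes "vanishes_to_order (K + length w) (peval p)"
  shows "vanishes_to_order K (peval (foldr Diff w p))"
  using assms
proof (induction w arbitrary: K)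
  case (Cons i w)
  then have "vanishes_to_order (Suc K) (peval (foldr Diff w p))" by simp
  then have "vanishes_to_order K (partial_deriv i (peval (foldr Diff w p)))"
    by (rule vanishes_to_order_partial_deriv[OF peval_holomorphic open_UNIV UNIV_I])
  moreover have "partial_deriv i (peval (foldr Diff w p)) = peval (foldr Diff (i # w) p)"
    by (rule ext) (simp add: partial_deriv_peval)
  ultimately show ?case by simp
qed simp

text \<open>As all weights are positive, a monomial of weight \<open>e\<close> has degree at most \<open>e\<close>.\<close>
lemma weighted_part_vanishes:
  fixes W :: "'n::finite \<Rightarrow> nat"
  assumes "vanishes_to_order (Suc e) (peval p)" "\<And>i. 0 < W i"
  shows "weighted_part W e p = 0"
proof (rule poly_mapping_eqI)
  fix \<nu>
  have "lookup p \<nu> = 0" if \<nu>: "weighted_deg W \<nu> = e"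
  proof (rule lookup_eq_0_if_Diff_vanish)
    have "weighted_deg (\<lambda>_. 1) \<nu> \<le> weighted_deg W \<nu>" unfolding weighted_deg_def using assms(2)
      by (intro sum_mono mult_right_mono) (auto simp: Suc_le_eq)
    then show "weighted_deg (\<lambda>_. 1) \<nu> < Suc e" using \<nu> by simp
    fix w :: "'n list" assume "length w < Suc e"
    then have "Suc e = Suc (e - length w) + length w" by simp
    then have "vanishes_to_order (Suc (e - length w)) (peval (foldr Diff w p))"
      using assms(1) by (intro word_Diff_vanishes) simp
    then show "peval (foldr Diff w p) 0 = 0"
      by (rule vanishes_at_0[OF peval_holomorphic open_UNIV UNIV_I])
  qed
  then show "lookup (weighted_part W e p) \<nu> = lookup 0 \<nu>" by (simp add: lookup_weighted_part)
qed

section \<open>Integration by parts\<close>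

lemma twisted_deriv_power_quotient:
  assumes U: "open U" and f: "mv_holomorphic_on f U" and p: "mv_holomorphic_on p U"
    and z: "z \<in> U" "f z \<noteq> 0"
  shows "twisted_deriv f s i (\<lambda>z. p z / f z ^ m) z =
    (f z * partial_deriv i p z - (of_nat m - s) * p z * partial_deriv i f z) / f z ^ Suc m"
proof (induction m)
  case 0
  show ?case using z(2) by (simp add: twisted_deriv_def field_simps)
next
  case (Suc m)
  let ?V = "{z \<in> U. f z \<noteq> 0}"
  have V: "open ?V" by (rule open_nonzero[OF U f])
  have zV: "z \<in> ?V" using z by simp
  have fV: "mv_holomorphic_on f ?V" and pV: "mv_holomorphic_on p ?V"
    using f p by (auto intro: mv_holomorphic_on_subset)
  have inv: "mv_holomorphic_on (\<lambda>z. inverse (f z)) ?V"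
    by (rule mv_holomorphic_on_inverse[OF fV]) simp
  have q: "mv_holomorphic_on (\<lambda>z. p z / f z ^ m) ?V"
    using mv_holomorphic_on_mult[OF pV mv_holomorphic_on_power[OF inv, of m]]
    by (simp add: divide_inverse power_inverse)
  have "twisted_deriv f s i (\<lambda>z. p z / f z ^ Suc m) z = twisted_deriv f s i (\<lambda>z. inverse (f z) * (p z / f z ^ m)) z"
    by (rule twisted_deriv_cong[OF V zV]) (simp add: field_simps)
  also have "\<dots> = - partial_deriv i f z / (f z)^2 * (p z / f z ^ m) + inverse (f z) *
      ((f z * partial_deriv i p z - (of_nat m - s) * p z * partial_deriv i f z) / f z ^ Suc m)"
    unfolding twisted_deriv_mult[OF inv q zV] partial_deriv_inverse[OF fV zV z(2)] Suc ..
  also have "\<dots> = (f z * partial_deriv i p z - (of_nat (Suc m) - s) * p z * partial_deriv i f z) / f z ^ Suc (Suc m)"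
    using z(2) by (simp add: divide_simps power2_eq_square) (simp add: algebra_simps)
  finally show ?case .
qed

lemma power_quotient_holomorphic:
  assumes "mv_holomorphic_on f U" "mv_holomorphic_on p U"
  shows "mv_holomorphic_on (\<lambda>z. p z / f z ^ m) {z \<in> U. f z \<noteq> 0}"
proof -
  have fV: "mv_holomorphic_on f {z \<in> U. f z \<noteq> 0}" and pV: "mv_holomorphic_on p {z \<in> U. f z \<noteq> 0}"
    using assms by (auto intro: mv_holomorphic_on_subset)
  have inv: "mv_holomorphic_on (\<lambda>z. inverse (f z)) {z \<in> U. f z \<noteq> 0}"
    by (rule mv_holomorphic_on_inverse[OF fV]) simp
  show ?thesis
    using mv_holomorphic_on_mult[OF pV mv_holomorphic_on_power[OF inv, of m]]
    by (simp add: divide_inverse power_inverse)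
qed

lemma twisted_word_power_quotient:
  assumes U: "open U" and f: "mv_holomorphic_on f U"
  shows "\<exists>p m. mv_holomorphic_on p U \<and> (\<forall>z\<in>U. f z \<noteq> 0 \<longrightarrow> foldr (twisted_deriv f s) w f z = p z / f z ^ m)"
proof (induction w)
  case Nil
  show ?case by (intro exI[of _ f] exI[of _ 0]) (simp add: f)
next
  case (Cons i w)
  then obtain p m where p: "mv_holomorphic_on p U"
    and eq: "\<And>z. z \<in> U \<Longrightarrow> f z \<noteq> 0 \<Longrightarrow> foldr (twisted_deriv f s) w f z = p z / f z ^ m" by blast
  let ?q = "\<lambda>z. f z * partial_deriv i p z - (of_nat m - s) * p z * partial_deriv i f z"
  have "mv_holomorphic_on ?q U"
    by (intro mv_holomorphic_on_diff mv_holomorphic_on_mult mv_holomorphic_on_const mv_holomorphic_on_partial_deriv f p U)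
  moreover have "foldr (twisted_deriv f s) (i # w) f z = ?q z / f z ^ Suc m" if z: "z \<in> U" "f z \<noteq> 0" for z
  proof -
    have "twisted_deriv f s i (foldr (twisted_deriv f s) w f) z = twisted_deriv f s i (\<lambda>z. p z / f z ^ m) z"
      by (rule twisted_deriv_cong[OF open_nonzero[OF U f]]) (use z eq in auto)
    then show ?thesis using twisted_deriv_power_quotient[OF U f p z, of s i m] by simp
  qed
  ultimately show ?case by blast
qed

text \<open>The germs \<open>h f\<^sup>s\<close>, for a fixed value of \<open>s\<close>, that are a multiple of \<open>f\<^sup>s\<^sup>+\<^sup>1\<close> plus a sum of partial derivatives
  of germs \<open>p\<^sub>i f\<^sup>s\<^sup>-\<^sup>m\<close>.\<close>
definition total_derivative ::
    "(complex^'n::finite \<Rightarrow> complex) \<Rightarrow> complex \<Rightarrow> (complex^'n) set \<Rightarrow> (complex^'n \<Rightarrow> complex) \<Rightarrow> bool" where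
  "total_derivative f s U h \<longleftrightarrow> (\<exists>Q p m. mv_holomorphic_on Q U \<and> (\<forall>i. mv_holomorphic_on (p i) U) \<and>
     (\<forall>z\<in>U. f z \<noteq> 0 \<longrightarrow> h z = Q z * f z + (\<Sum>i\<in>UNIV. twisted_deriv f s i (\<lambda>z. p i z / f z ^ m) z)))"

lemma total_derivativeE:
  assumes "total_derivative f s U h"
  obtains Q p m where "mv_holomorphic_on Q U" "\<forall>i. mv_holomorphic_on (p i) U"
    "\<forall>z\<in>U. f z \<noteq> 0 \<longrightarrow> h z = Q z * f z + (\<Sum>i\<in>UNIV. twisted_deriv f s i (\<lambda>z. p i z / f z ^ m) z)"
  using assms unfolding total_derivative_def by (elim exE conjE) (rule that)

lemma total_derivativeI:
  assumes "mv_holomorphic_on Q U" "\<And>i. mv_holomorphic_on (p i) U"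
    "\<And>z. z \<in> U \<Longrightarrow> f z \<noteq> 0 \<Longrightarrow> h z = Q z * f z + (\<Sum>i\<in>UNIV. twisted_deriv f s i (\<lambda>z. p i z / f z ^ m) z)"
  shows "total_derivative f s U h"
  unfolding total_derivative_def using assms by (intro exI[of _ Q] exI[of _ p] exI[of _ m]) simp

lemma total_derivative_add:
  assumes U: "open U" and f: "mv_holomorphic_on f U"
    and "total_derivative f s U h" "total_derivative f s U k"
  shows "total_derivative f s U (\<lambda>z. h z + k z)"
proof -
  obtain Q p m where X1: "mv_holomorphic_on Q U" "\<forall>i. mv_holomorphic_on (p i) U"
    "\<forall>z\<in>U. f z \<noteq> 0 \<longrightarrow> h z = Q z * f z + (\<Sum>i\<in>UNIV. twisted_deriv f s i (\<lambda>z. p i z / f z ^ m) z)"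
    using assms(3) by (rule total_derivativeE)
  note 1 = X1(1) spec[OF X1(2)] mp[OF bspec[OF X1(3)]]
  obtain R q n where X2: "mv_holomorphic_on R U" "\<forall>i. mv_holomorphic_on (q i) U"
    "\<forall>z\<in>U. f z \<noteq> 0 \<longrightarrow> k z = R z * f z + (\<Sum>i\<in>UNIV. twisted_deriv f s i (\<lambda>z. q i z / f z ^ n) z)"
    using assms(4) by (rule total_derivativeE)
  note 2 = X2(1) spec[OF X2(2)] mp[OF bspec[OF X2(3)]]
  let ?V = "{z \<in> U. f z \<noteq> 0}"
  show ?thesis
  proof (rule total_derivativeI[where Q = "\<lambda>z. Q z + R z" and p = "\<lambda>i z. p i z * f z ^ n + q i z * f z ^ m" and m = "m + n"])
    fix z assume z: "z \<in> U" "f z \<noteq> 0"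
    then have zV: "z \<in> ?V" by simp
    have "twisted_deriv f s i (\<lambda>z. (p i z * f z ^ n + q i z * f z ^ m) / f z ^ (m + n)) z =
        twisted_deriv f s i (\<lambda>z. p i z / f z ^ m) z + twisted_deriv f s i (\<lambda>z. q i z / f z ^ n) z" for i
    proof -
      have "twisted_deriv f s i (\<lambda>z. (p i z * f z ^ n + q i z * f z ^ m) / f z ^ (m + n)) z =
          twisted_deriv f s i (\<lambda>z. p i z / f z ^ m + q i z / f z ^ n) z"
        by (rule twisted_deriv_cong[OF open_nonzero[OF U f] zV]) (auto simp: power_add add_divide_distrib)
      also have "\<dots> = twisted_deriv f s i (\<lambda>z. p i z / f z ^ m) z + twisted_deriv f s i (\<lambda>z. q i z / f z ^ n) z"
        using partial_deriv_add[OF power_quotient_holomorphic[OF f 1(2)] power_quotient_holomorphic[OF f 2(2)] zV]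
        by (simp add: twisted_deriv_def algebra_simps)
      finally show ?thesis .
    qed
    then show "h z + k z = (Q z + R z) * f z +
       (\<Sum>i\<in>UNIV. twisted_deriv f s i (\<lambda>z. (p i z * f z ^ n + q i z * f z ^ m) / f z ^ (m + n)) z)"
      by (simp add: 1(3)[OF z] 2(3)[OF z] sum.distrib algebra_simps)
  qed (intro mv_holomorphic_on_add mv_holomorphic_on_mult mv_holomorphic_on_power 1 2 f)+
qed

lemma twisted_deriv_zero: "twisted_deriv f s i (\<lambda>z. 0) z = 0"
  by (simp add: twisted_deriv_def partial_deriv_const)

lemma total_derivative_zero: "total_derivative f s U (\<lambda>z. 0)"
  by (rule total_derivativeI[where Q = "\<lambda>z. 0" and p = "\<lambda>i z. 0" and m = 0])
     (simp_all add: mv_holomorphic_on_const twisted_deriv_zero)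

lemma total_derivative_sum:
  assumes "open U" "mv_holomorphic_on f U" "\<And>k. k \<in> A \<Longrightarrow> total_derivative f s U (h k)"
  shows "total_derivative f s U (\<lambda>z. \<Sum>k\<in>A. h k z)"
  using assms(3)
  by (induction A rule: infinite_finite_induct)
     (auto intro: total_derivative_zero total_derivative_add[OF assms(1,2)])

lemma total_derivative_twisted_deriv:
  assumes "mv_holomorphic_on q U"
  shows "total_derivative f s U (twisted_deriv f s i (\<lambda>z. q z / f z ^ m))"
proof (rule total_derivativeI[where Q = "\<lambda>z. 0" and p = "\<lambda>j. if j = i then q else (\<lambda>z. 0)" and m = m])
  fix z
  have "(\<Sum>j\<in>UNIV. twisted_deriv f s j (\<lambda>z. (if j = i then q else (\<lambda>z. 0)) z / f z ^ m) z) =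
      (\<Sum>j\<in>UNIV. if j = i then twisted_deriv f s i (\<lambda>z. q z / f z ^ m) z else 0)"
    by (rule sum.cong) (auto simp: twisted_deriv_zero)
  then show "twisted_deriv f s i (\<lambda>z. q z / f z ^ m) z = 0 * f z +
      (\<Sum>j\<in>UNIV. twisted_deriv f s j (\<lambda>z. (if j = i then q else (\<lambda>z. 0)) z / f z ^ m) z)" by simp
qed (auto simp: assms mv_holomorphic_on_const)

lemma total_derivative_cong:
  assumes "total_derivative f s U h" "\<And>z. z \<in> U \<Longrightarrow> f z \<noteq> 0 \<Longrightarrow> k z = h z"
  shows "total_derivative f s U k"
proof -
  obtain Q p m where X1: "mv_holomorphic_on Q U" "\<forall>i. mv_holomorphic_on (p i) U"
    "\<forall>z\<in>U. f z \<noteq> 0 \<longrightarrow> h z = Q z * f z + (\<Sum>i\<in>UNIV. twisted_deriv f s i (\<lambda>z. p i z / f z ^ m) z)"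
    using assms(1) by (rule total_derivativeE)
  note 1 = X1(1) spec[OF X1(2)] mp[OF bspec[OF X1(3)]]
  show ?thesis by (rule total_derivativeI[OF 1(1,2)], rule trans[OF assms(2) 1(3)])
qed

text \<open>Integration by parts moves one derivation after the other from \<open>f\<^sup>s\<^sup>+\<^sup>1\<close> to the coefficient \<open>A\<close>.\<close>
lemma total_derivative_word:
  assumes U: "open U" and f: "mv_holomorphic_on f U" and "mv_holomorphic_on A U"
  shows "total_derivative f s U (\<lambda>z. A z * foldr (twisted_deriv f s) w f z)"
  using assms(3)
proof (induction w arbitrary: A)
  case Nil
  show ?case
    by (rule total_derivativeI[where Q = A and p = "\<lambda>i z. 0" and m = 0])
       (simp_all add: Nil mv_holomorphic_on_const twisted_deriv_zero)
next
  case (Cons i w)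
  let ?H = "foldr (twisted_deriv f s) w f"
  let ?V = "{z \<in> U. f z \<noteq> 0}"
  obtain p m where p: "mv_holomorphic_on p U"
    and eq: "\<And>z. z \<in> U \<Longrightarrow> f z \<noteq> 0 \<Longrightarrow> ?H z = p z / f z ^ m"
    using twisted_word_power_quotient[OF U f] by metis
  have AV: "mv_holomorphic_on A ?V" using Cons.prems by (rule mv_holomorphic_on_subset) auto
  have "total_derivative f s U (\<lambda>z. twisted_deriv f s i (\<lambda>z. (A z * p z) / f z ^ m) z + ((-1) * partial_deriv i A z) * ?H z)"
    by (intro total_derivative_add[OF U f] total_derivative_twisted_deriv Cons.IH mv_holomorphic_on_mult
          mv_holomorphic_on_const mv_holomorphic_on_partial_deriv Cons.prems p U)
  then show ?case
  proof (rule total_derivative_cong)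
    fix z assume "z \<in> U" "f z \<noteq> 0"
    then have z: "z \<in> ?V" by simp
    have "twisted_deriv f s i (\<lambda>z. (A z * p z) / f z ^ m) z = twisted_deriv f s i (\<lambda>z. A z * ?H z) z"
      by (rule twisted_deriv_cong[OF open_nonzero[OF U f] z]) (simp add: eq)
    then show "A z * foldr (twisted_deriv f s) (i # w) f z =
        twisted_deriv f s i (\<lambda>z. (A z * p z) / f z ^ m) z + ((-1) * partial_deriv i A z) * ?H z"
      unfolding twisted_deriv_mult[OF AV twisted_word_holomorphic[OF U f] z] by (simp add: algebra_simps)
  qed
qed

lemma bernstein_equation_total_derivative:
  assumes U: "open U" and f: "mv_holomorphic_on f U" and "bs_span f U (\<lambda>s z. poly b s)"
  shows "total_derivative f s U (\<lambda>z. poly b s)"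
proof -
  obtain I a where I: "finite I" "\<And>p. p \<in> I \<Longrightarrow> mv_holomorphic_on (a p) U"
    and b: "\<And>s z. z \<in> U \<Longrightarrow> f z \<noteq> 0 \<Longrightarrow>
        poly b s = (\<Sum>p\<in>I. s ^ fst p * a p z * foldr (twisted_deriv f s) (snd p) f z)"
    using assms(3) unfolding bs_span_def by blast
  have "total_derivative f s U (\<lambda>z. \<Sum>p\<in>I. s ^ fst p * a p z * foldr (twisted_deriv f s) (snd p) f z)"
    by (intro total_derivative_sum[OF U f] total_derivative_word[OF U f] mv_holomorphic_on_mult mv_holomorphic_on_const I)
  then show ?thesis by (rule total_derivative_cong) (rule b)
qed

text \<open>The zeros of a nonzero polynomial on a line through a point where it does not vanish are isolated, so its
  nonvanishing locus is dense.\<close>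
lemma zero_where_polynomial_nonzero:
  assumes E: "mv_holomorphic_on E U" and U: "open U" and "z \<in> U"
    and 0: "\<And>z. z \<in> U \<Longrightarrow> peval F z \<noteq> 0 \<Longrightarrow> E z = 0" and z1: "peval F z1 \<noteq> 0"
  shows "E z = 0"
proof (cases "peval F z = 0")
  case True
  let ?l = "\<lambda>t. z + t *s (z1 - z)"
  have l1: "?l 1 = z1" and l0: "?l 0 = z" by (simp_all add: vec_eq_iff)
  have "(\<lambda>t. peval F (?l t)) holomorphic_on UNIV"
    unfolding holomorphic_on_def field_differentiable_def
    by (intro ballI exI, rule has_gradient_line, rule peval_has_gradient)
  then obtain r where r: "0 < r" "\<And>t. t \<in> ball 0 r - {0} \<Longrightarrow> peval F (?l t) \<noteq> 0"
    by (rule isolated_zeros[where \<xi> = 0 and \<beta> = 1]) (use True z1 l0 l1 in auto)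
  have "((\<lambda>t. E (?l t)) has_field_derivative (\<Sum>i\<in>UNIV. (z1 - z) $ i * partial_deriv i E z)) (at 0)"
    by (rule has_gradient_line) (use mv_holomorphic_onD[OF E \<open>z \<in> U\<close>] l0 in simp)
  then have "isCont (\<lambda>t. E (?l t)) 0" by (rule DERIV_isCont)
  then have lim: "((\<lambda>t. E (?l t)) \<longlongrightarrow> E z) (at 0)" by (simp add: isCont_def)
  have "((\<lambda>t. ?l t $ i) \<longlongrightarrow> z $ i) (at 0)" for i
    by (auto intro!: tendsto_eq_intros)
  then have "(?l \<longlongrightarrow> z) (at 0)" by (intro vec_tendstoI)
  then have "eventually (\<lambda>t. ?l t \<in> U) (at 0)" using U \<open>z \<in> U\<close> by (rule topological_tendstoD)
  moreover have "eventually (\<lambda>t. t \<in> ball 0 r - {0}) (at (0::complex))"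
    using r(1) eventually_at[of "\<lambda>t. t \<in> ball 0 r - {0}" "0::complex" UNIV] by (auto simp: dist_commute)
  ultimately have "eventually (\<lambda>t. E (?l t) = 0) (at 0)"
    by eventually_elim (use 0 r(2) in blast)
  then have "((\<lambda>t. E (?l t)) \<longlongrightarrow> 0) (at 0)" by (rule tendsto_eventually)
  with lim show ?thesis by (metis tendsto_unique trivial_limit_at)
qed (use 0 \<open>z \<in> U\<close> in blast)

lemma vanishes_to_order_cong:
  assumes "vanishes_to_order K r" "open U" "0 \<in> U" "\<And>z. z \<in> U \<Longrightarrow> r z = q z"
  shows "vanishes_to_order K q"
proof -
  obtain C \<epsilon> where C: "0 < \<epsilon>" "\<And>z. 0 < norm z \<Longrightarrow> norm z < \<epsilon> \<Longrightarrow> norm (r z) \<le> C * norm z ^ K"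
    using assms(1) unfolding vanishes_to_order_def by blast
  obtain \<delta> where \<delta>: "0 < \<delta>" "ball 0 \<delta> \<subseteq> U" using assms(2,3) open_contains_ball by blast
  show ?thesis
  proof (rule vanishes_to_orderI)
    show "0 < min \<epsilon> \<delta>" using C \<delta> by simp
    fix z :: "complex^'a" assume z: "0 < norm z" "norm z < min \<epsilon> \<delta>"
    then have "z \<in> U" using \<delta> by auto
    then show "norm (q z) \<le> C * norm z ^ K" using C(2)[of z] z assms(4) by simp
  qed
qed

lemma exists_peval_nonzero:
  fixes F :: "'n::finite mpoly"
  assumes grad: "\<And>z. (\<forall>j. peval (Diff j F) z = 0) \<longleftrightarrow> z = 0"
  shows "\<exists>z. peval F z \<noteq> 0"
proof (rule ccontr)
  assume "\<nexists>z. peval F z \<noteq> 0"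
  then have "peval F = (\<lambda>z. 0)" by auto
  then have "peval (Diff j F) z = 0" for j z
    by (simp flip: partial_deriv_peval add: partial_deriv_const)
  then have "(\<chi> i. 1) = (0 :: complex^'n)" using grad by blast
  then show False by (simp add: vec_eq_iff)
qed

text \<open>At \<open>s = -\<alpha>\<close> integration by parts gives a relation of holomorphic germs. Replacing the germs by Taylor polynomials of high
  order does not change the part of weight \<open>d (m + 1)\<close>, and \<open>relation_trivial\<close> applies.\<close>
theorem bernstein_root_alpha:
  fixes W :: "'n::finite \<Rightarrow> nat" and F :: "'n mpoly"
  assumes F: "weighted_homog W d F" and d: "0 < d" and W: "\<And>i. 0 < W i"
    and grad: "\<And>z. (\<forall>j. peval (Diff j F) z = 0) \<longleftrightarrow> z = 0"
    and b: "bernstein_equation (peval F) 0 b"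
  shows "poly b (- alpha W d) = 0"
proof -
  define s where "s = - alpha W d"
  define c where "c = poly b s"
  obtain U where U: "open U" "0 \<in> U" and span: "bs_span (peval F) U (\<lambda>s z. poly b s)"
    using b unfolding bernstein_equation_iff_bs_span by blast
  note fU = peval_holomorphic[of F U]
  obtain Q p m where Q: "mv_holomorphic_on Q U" and p0: "\<forall>i. mv_holomorphic_on (p i) U"
    and rel0: "\<forall>z\<in>U. peval F z \<noteq> 0 \<longrightarrow>
       c = Q z * peval F z + (\<Sum>i\<in>UNIV. twisted_deriv (peval F) s i (\<lambda>z. p i z / peval F z ^ m) z)"
    unfolding c_def by (rule total_derivativeE[OF bernstein_equation_total_derivative[OF U(1) fU span, of s]])
  note p = spec[OF p0] and rel = mp[OF bspec[OF rel0]]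
  let ?f = "peval F"
  let ?k = "of_nat m - s"
  define E where "E = (\<lambda>z. c * ?f z ^ Suc m - (Q z * ?f z ^ Suc (Suc m) +
      (\<Sum>i\<in>UNIV. ?f z * partial_deriv i (p i) z - ?k * p i z * partial_deriv i ?f z)))"
  have "mv_holomorphic_on E U"
    unfolding E_def
    by (intro mv_holomorphic_on_diff mv_holomorphic_on_add mv_holomorphic_on_mult mv_holomorphic_on_const
        mv_holomorphic_on_power mv_holomorphic_on_sum mv_holomorphic_on_partial_deriv fU p Q U)
  moreover have "E z = 0" if z: "z \<in> U" "?f z \<noteq> 0" for z
  proof -
    have "c = Q z * ?f z + (\<Sum>i\<in>UNIV. (?f z * partial_deriv i (p i) z - ?k * p i z * partial_deriv i ?f z) / ?f z ^ Suc m)"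
      using rel[OF z] unfolding twisted_deriv_power_quotient[OF U(1) fU p z] .
    then have "c * ?f z ^ Suc m = Q z * ?f z ^ Suc (Suc m) +
        (\<Sum>i\<in>UNIV. ?f z * partial_deriv i (p i) z - ?k * p i z * partial_deriv i ?f z)"
      unfolding sum_divide_distrib[symmetric] using z(2) by (simp add: field_simps)
    then show ?thesis by (simp add: E_def)
  qed
  moreover obtain z1 where "peval F z1 \<noteq> 0" using exists_peval_nonzero[OF grad] by blast
  ultimately have E0: "E z = 0" if "z \<in> U" for z
    using zero_where_polynomial_nonzero[of E U z F z1] U(1) that by blast
  \<comment> \<open>An error of order \<open>K\<close> has no part of weight \<open>d (m + 1)\<close>.\<close>
  define K where "K = Suc (d * Suc m)"
  obtain Q' where Q': "vanishes_to_order K (\<lambda>z. Q z - peval Q' z)"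
    using taylor_polynomial[OF Q U] unfolding K_def by blast
  have "\<forall>i. \<exists>q. vanishes_to_order (Suc K) (\<lambda>z. p i z - peval q z)"
    using taylor_polynomial[OF p U] by blast
  then obtain p' where p': "\<And>i. vanishes_to_order (Suc K) (\<lambda>z. p i z - peval (p' i) z)"
    unfolding choice_iff by blast
  \<comment> \<open>The relation for the Taylor polynomials in place of the germs fails only by terms of high order.\<close>
  define Err where "Err = Const c * F ^ Suc m - Q' * F ^ Suc (Suc m) -
      (F * (\<Sum>i\<in>UNIV. Diff i (p' i)) - Const (alpha W d + of_nat m) * (\<Sum>i\<in>UNIV. p' i * Diff i F))"
  have k: "alpha W d + of_nat m = ?k" by (simp add: s_def)
  have hr: "mv_holomorphic_on (\<lambda>z. p i z - peval (p' i) z) U" for i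
    by (intro mv_holomorphic_on_diff p peval_holomorphic)
  have "vanishes_to_order K (\<lambda>z. ?f z ^ Suc (Suc m) * (Q z - peval Q' z) +
      (\<Sum>i\<in>UNIV. ?f z * partial_deriv i (\<lambda>z. p i z - peval (p' i) z) z +
        (- ?k * partial_deriv i ?f z) * (p i z - peval (p' i) z)))"
    by (intro vanishes_to_order_add vanishes_to_order_sum vanishes_to_order_mult[OF _ U] Q'
        vanishes_to_order_partial_deriv[OF hr U p'] vanishes_to_order_Suc[OF p']
        mv_holomorphic_on_power mv_holomorphic_on_mult mv_holomorphic_on_const mv_holomorphic_on_partial_deriv fU U)
  moreover have "?f z ^ Suc (Suc m) * (Q z - peval Q' z) +
      (\<Sum>i\<in>UNIV. ?f z * partial_deriv i (\<lambda>z. p i z - peval (p' i) z) z +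
        (- ?k * partial_deriv i ?f z) * (p i z - peval (p' i) z)) = peval Err z" if z: "z \<in> U" for z
  proof -
    have d1: "partial_deriv i (\<lambda>z. p i z - peval (p' i) z) z = partial_deriv i (p i) z - peval (Diff i (p' i)) z" for i
      using partial_deriv_add[OF p mv_holomorphic_on_mult[OF mv_holomorphic_on_const[of "-1"] peval_holomorphic[of "p' i"]] z, of i i]
        partial_deriv_mult[OF mv_holomorphic_on_const[of "-1"] peval_holomorphic[of "p' i" U] z, of i]
      by (simp add: partial_deriv_const partial_deriv_peval)
    let ?P = "\<Sum>i\<in>UNIV. partial_deriv i (p i) z" and ?P' = "\<Sum>i\<in>UNIV. peval (Diff i (p' i)) z"
    let ?S = "\<Sum>i\<in>UNIV. p i z * partial_deriv i ?f z" and ?S' = "\<Sum>i\<in>UNIV. peval (p' i) z * partial_deriv i ?f z"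
    have "(\<Sum>i\<in>UNIV. ?f z * partial_deriv i (p i) z - ?k * p i z * partial_deriv i ?f z) = ?f z * ?P - ?k * ?S"
      unfolding sum_subtractf sum_distrib_left mult.assoc ..
    then have 1: "c * ?f z ^ Suc m = Q z * ?f z ^ Suc (Suc m) + (?f z * ?P - ?k * ?S)"
      using E0[OF z] by (simp add: E_def)
    have 2: "peval Err z = c * ?f z ^ Suc m - peval Q' z * ?f z ^ Suc (Suc m) - (?f z * ?P' - ?k * ?S')"
      unfolding Err_def k by (simp only: peval_diff peval_mult peval_power peval_sum partial_deriv_peval peval_Const)
    have "(\<Sum>i\<in>UNIV. ?f z * (partial_deriv i (p i) z - peval (Diff i (p' i)) z) +
        (- ?k * partial_deriv i ?f z) * (p i z - peval (p' i) z)) =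
        (\<Sum>i\<in>UNIV. ?f z * partial_deriv i (p i) z - ?f z * peval (Diff i (p' i)) z
          - (?k * (p i z * partial_deriv i ?f z) - ?k * (peval (p' i) z * partial_deriv i ?f z)))"
      by (intro sum.cong refl) (simp add: algebra_simps)
    also have "\<dots> = ?f z * ?P - ?f z * ?P' - (?k * ?S - ?k * ?S')"
      unfolding sum_subtractf sum_distrib_left ..
    finally show ?thesis
      unfolding d1 2 1 by (simp only:) (simp add: algebra_simps)
  qed
  ultimately have "vanishes_to_order K (peval Err)"
    by (rule vanishes_to_order_cong[OF _ U])
  then have "weighted_part W (d * Suc m) Err = 0"
    unfolding K_def by (rule weighted_part_vanishes[OF _ W])
  then have "c = 0"
    unfolding Err_def by (rule relation_trivial[OF F d W grad])
  then show ?thesis by (simp add: c_def s_def)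
qed

section \<open>A functional equation with known roots\<close>

context
  fixes W :: "'n::finite \<Rightarrow> nat" and d :: nat and F :: "'n mpoly"
  assumes F: "weighted_homog W d F" and d: "0 < d" and W: "\<And>i. 0 < W i"
    and grad: "\<And>z. (\<forall>j. peval (Diff j F) z = 0) \<longleftrightarrow> z = 0"
begin

abbreviation "\<alpha> \<equiv> real (\<Sum>i\<in>UNIV. W i) / real d"

text \<open>\<open>c(s) u f\<^sup>s\<close> lies in the module generated by \<open>f\<^sup>s\<^sup>+\<^sup>1\<close>.\<close>
definition "spans c u = bs_span (peval F) UNIV (\<lambda>s z. poly c s * peval u z)"

definition "roots_below (q :: complex poly) \<longleftrightarrow> q \<noteq> 0 \<and> (\<forall>r. poly q r = 0 \<longrightarrow> (\<exists>x::real. r = of_real x \<and> x \<le> - \<alpha>))"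

lemma alpha_real: "alpha W d = of_real \<alpha>"
  by (simp add: alpha_def[OF F d W grad])

lemma roots_below_mult: "roots_below p \<Longrightarrow> roots_below q \<Longrightarrow> roots_below (p * q)"
  by (auto simp: roots_below_def)

lemma roots_below_1: "roots_below 1"
  by (simp add: roots_below_def)

lemma roots_below_prod: "(\<And>k. k \<in> A \<Longrightarrow> roots_below (q k)) \<Longrightarrow> roots_below (\<Prod>k\<in>A. q k)"
  by (induction A rule: infinite_finite_induct) (auto intro: roots_below_mult roots_below_1)

lemma roots_below_linear: "roots_below [:of_real (\<alpha> + real e / real d), 1:]"
  unfolding roots_below_def
proof (intro conjI allI impI)
  fix r :: complex assume r: "poly [:of_real (\<alpha> + real e / real d), 1:] r = 0"
  have "r = - c" if "poly [:c, 1:] r = 0" for c using that by (simp add: add_eq_0_iff)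
  then have "r = of_real (- (\<alpha> + real e / real d))" using r unfolding of_real_minus by blast
  then show "\<exists>x. r = of_real x \<and> x \<le> - \<alpha>" by (intro exI[of _ "- (\<alpha> + real e / real d)"]) simp
qed simp

lemma spans_mult: "spans c u \<Longrightarrow> spans c (r * u)"
proof -
  assume "spans c u"
  then have "bs_span (peval F) UNIV (\<lambda>s z. peval r z * (poly c s * peval u z))"
    unfolding spans_def by (rule bs_span_mult) (rule peval_holomorphic)
  then show ?thesis unfolding spans_def by (rule bs_span_cong) (simp add: peval_mult)
qed

lemma spans_add: "spans c u \<Longrightarrow> spans c v \<Longrightarrow> spans c (u + v)"
  unfolding spans_def
  by (rule bs_span_cong[OF bs_span_add], assumption, assumption) (simp add: peval_add algebra_simps)

lemma spans_0: "spans c 0"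
  by (simp add: spans_def bs_span_zero)

lemma spans_sum: "(\<And>k. k \<in> A \<Longrightarrow> spans c (u k)) \<Longrightarrow> spans c (\<Sum>k\<in>A. u k)"
  by (induction A rule: infinite_finite_induct) (auto intro: spans_add spans_0)

lemma spans_dvd: "spans c u \<Longrightarrow> c dvd c' \<Longrightarrow> spans c' u"
proof -
  assume "spans c u" "c dvd c'"
  then obtain k where k: "c' = c * k" by blast
  have "bs_span (peval F) UNIV (\<lambda>s z. poly k s * (poly c s * peval u z))"
    using \<open>spans c u\<close> unfolding spans_def by (rule bs_span_times_poly)
  then show ?thesis unfolding spans_def by (rule bs_span_cong) (simp add: k)
qed

lemma spans_Diff: "spans [:1, 1:] (Diff i F)"
  unfolding spans_def
proof (rule bs_span_cong)
  show "bs_span (peval F) UNIV (\<lambda>s z. s ^ 0 * 1 * foldr (twisted_deriv (peval F) s) [i] (peval F) z)"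
    by (intro bs_span_term mv_holomorphic_on_const)
  show "poly [:1, 1:] s * peval (Diff i F) z = s ^ 0 * 1 * foldr (twisted_deriv (peval F) s) [i] (peval F) z"
    if "peval F z \<noteq> 0" for s z
    using that by (simp add: twisted_deriv_def partial_deriv_peval algebra_simps)
qed

lemma spans_jacobian: "u \<in> jacobian_ideal F \<Longrightarrow> spans [:1, 1:] u"
  unfolding jacobian_ideal_def by (auto intro!: spans_sum spans_mult spans_Diff)

text \<open>\<open>\<Sum> \<partial>\<^sub>i (w\<^sub>i z\<^sub>i u f\<^sup>s) = (s + \<alpha> + \<rho>) u f\<^sup>s\<close> for \<open>u\<close> of weight \<open>\<rho> = e / d\<close>, by Euler's identity for \<open>u\<close> and for \<open>F\<close>.\<close>
lemma spans_euler_step: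
  assumes u: "weighted_homog W e u" and c: "\<And>i. spans c (Var i * u)"
  shows "spans ([:of_real (\<alpha> + real e / real d), 1:] * c) u"
proof -
  let ?f = "peval F"
  let ?w = "\<lambda>i. of_nat (W i) / of_nat d :: complex"
  let ?T = "\<lambda>i s z. twisted_deriv ?f s i (\<lambda>z. poly c s * peval (Const (?w i) * (Var i * u)) z) z"
  have "bs_span ?f UNIV (\<lambda>s z. \<Sum>i\<in>UNIV. ?T i s z)"
    by (intro bs_span_sum bs_span_twisted_deriv open_UNIV peval_holomorphic)
       (rule spans_mult[OF c, unfolded spans_def])
  then show ?thesis
    unfolding spans_def
  proof (rule bs_span_cong)
    fix s z assume z: "?f z \<noteq> 0"
    have T: "?T i s z = poly c s * (?w i * peval u z + ?w i * z $ i * peval (Diff i u) z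
        + s * (?w i * z $ i * peval (Diff i F) z / ?f z) * peval u z)" for i
    proof -
      have "partial_deriv i (\<lambda>z. poly c s * peval (Const (?w i) * (Var i * u)) z) z =
          partial_deriv i (peval (Const (poly c s) * (Const (?w i) * (Var i * u)))) z"
        by (intro arg_cong[of _ _ "\<lambda>h. partial_deriv i h z"] ext) (simp add: peval_mult)
      also have "\<dots> = poly c s * (?w i * peval u z + ?w i * z $ i * peval (Diff i u) z)"
        unfolding partial_deriv_peval by (simp add: Diff_mult Diff_Var peval_mult peval_add algebra_simps)
      finally show ?thesis by (simp add: twisted_deriv_def partial_deriv_peval peval_mult algebra_simps)
    qed
    have sw: "(\<Sum>i\<in>UNIV. ?w i) = of_real \<alpha>" by (simp add: sum_divide_distrib)
    have eu: "(\<Sum>i\<in>UNIV. ?w i * z $ i * peval (Diff i p) z) = of_nat k / of_nat d * peval p z" if "weighted_homog W k p" for k p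
    proof -
      have "(\<Sum>i\<in>UNIV. of_nat (W i) * z $ i * peval (Diff i p) z) = of_nat k * peval p z"
        using arg_cong[OF euler_identity[OF that], of "\<lambda>p. peval p z"] by (simp add: peval_sum peval_mult)
      then show ?thesis by (simp add: sum_divide_distrib[symmetric])
    qed
    have "(\<Sum>i\<in>UNIV. ?T i s z) = poly c s * ((\<Sum>i\<in>UNIV. ?w i) * peval u z + (\<Sum>i\<in>UNIV. ?w i * z $ i * peval (Diff i u) z)
        + s * ((\<Sum>i\<in>UNIV. ?w i * z $ i * peval (Diff i F) z) / ?f z) * peval u z)"
      unfolding T sum_distrib_left[symmetric] sum.distrib
      by (simp only: sum_distrib_left sum_distrib_right sum_divide_distrib)
    also have "\<dots> = poly c s * (of_real \<alpha> * peval u z + of_nat e / of_nat d * peval u z + s * peval u z)"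
      unfolding sw eu[OF u] eu[OF F] using z d by simp
    finally show "poly ([:of_real (\<alpha> + real e / real d), 1:] * c) s * peval u z = (\<Sum>i\<in>UNIV. ?T i s z)"
      by (simp add: algebra_simps)
  qed
qed

text \<open>A monomial of sufficiently large degree is divisible by one of the powers provided by the Nullstellensatz.\<close>
lemma large_monomials_in_jacobian:
  "\<exists>M. \<forall>\<nu>. M \<le> weighted_deg (\<lambda>_. 1) \<nu> \<longrightarrow> Poly_Mapping.single \<nu> 1 \<in> jacobian_ideal F"
proof -
  have "\<forall>i. \<exists>N. Var i ^ N \<in> jacobian_ideal F"
    using Var_power_in_jacobian grad by blast
  then obtain N where N: "\<And>i. Var i ^ N i \<in> jacobian_ideal F" unfolding choice_iff by blast
  have "Poly_Mapping.single \<nu> 1 \<in> jacobian_ideal F" if \<nu>: "(\<Sum>i\<in>UNIV. N i) \<le> weighted_deg (\<lambda>_. 1) \<nu>" for \<nu>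
  proof -
    have "\<exists>i. N i \<le> lookup \<nu> i"
    proof (rule ccontr)
      assume "\<nexists>i. N i \<le> lookup \<nu> i"
      then have "(\<Sum>i\<in>UNIV. lookup \<nu> i) < (\<Sum>i\<in>UNIV. N i)"
        by (intro sum_strict_mono) (auto simp: not_le)
      with \<nu> show False by (simp add: weighted_deg_def)
    qed
    then obtain i where i: "N i \<le> lookup \<nu> i" ..
    let ?e = "Poly_Mapping.single i (N i)"
    have "(\<nu> - ?e) + ?e = \<nu>"
      by (rule poly_mapping_eqI) (use i in \<open>auto simp: lookup_add lookup_minus lookup_single when_def\<close>)
    then have "Poly_Mapping.single \<nu> 1 = Poly_Mapping.single (\<nu> - ?e) 1 * Var i ^ N i"
      by (simp add: Var_power mult_single)
    then show ?thesis using is_idealD(3)[OF is_ideal_jacobian N] by simp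
  qed
  then show ?thesis by blast
qed

text \<open>Downward induction on the degree of the monomial. The step multiplies the factors \<open>q\<close> that belong to the products of
  the monomial with the variables, but takes \<open>s + 1\<close> only once.\<close>
lemma spans_monomial:
  assumes M: "\<And>\<nu>. M \<le> weighted_deg (\<lambda>_. 1) \<nu> \<Longrightarrow> Poly_Mapping.single \<nu> 1 \<in> jacobian_ideal F"
    and "M \<le> weighted_deg (\<lambda>_. 1) \<nu> + k"
  shows "\<exists>q. roots_below q \<and> spans ([:1, 1:] * q) (Poly_Mapping.single \<nu> 1)"
  using assms(2)
proof (induction k arbitrary: \<nu>)
  case 0
  then show ?case using spans_jacobian[OF M] roots_below_1 by (intro exI[of _ 1]) simp
next
  case (Suc k)
  have V: "Var i * Poly_Mapping.single \<nu> 1 = Poly_Mapping.single (Poly_Mapping.single i 1 + \<nu>) 1" for i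
    by (simp add: Var_def mult_single)
  have "\<exists>q. roots_below q \<and> spans ([:1, 1:] * q) (Var i * Poly_Mapping.single \<nu> 1)" for i
    unfolding V by (rule Suc.IH) (use Suc.prems in \<open>simp add: weighted_deg_add weighted_deg_single\<close>)
  then obtain q where q: "\<And>i. roots_below (q i)" "\<And>i. spans ([:1, 1:] * q i) (Var i * Poly_Mapping.single \<nu> 1)"
    by metis
  let ?l = "[:of_real (\<alpha> + real (weighted_deg W \<nu>) / real d), 1:]"
  have "spans (?l * ([:1, 1:] * (\<Prod>i\<in>UNIV. q i))) (Poly_Mapping.single \<nu> 1)"
  proof (rule spans_euler_step)
    show "weighted_homog W (weighted_deg W \<nu>) (Poly_Mapping.single \<nu> 1)" by (simp add: weighted_homog_def)
    show "spans ([:1, 1:] * (\<Prod>i\<in>UNIV. q i)) (Var i * Poly_Mapping.single \<nu> 1)" for i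
      by (rule spans_dvd[OF q(2)[of i]]) (intro mult_dvd_mono dvd_refl dvd_prodI, auto)
  qed
  moreover have "?l * ([:1, 1:] * (\<Prod>i\<in>UNIV. q i)) = [:1, 1:] * (?l * (\<Prod>i\<in>UNIV. q i))"
    by (simp only: mult_ac)
  moreover have "roots_below (?l * (\<Prod>i\<in>UNIV. q i))"
    by (intro roots_below_mult roots_below_linear roots_below_prod q)
  ultimately show ?case by metis
qed

lemma bernstein_equation_exists:
  "\<exists>q. roots_below q \<and> bernstein_equation (peval F) 0 ([:1, 1:] * q)"
proof -
  obtain M where M: "\<And>\<nu>. M \<le> weighted_deg (\<lambda>_. 1) \<nu> \<Longrightarrow> Poly_Mapping.single \<nu> 1 \<in> jacobian_ideal F"
    using large_monomials_in_jacobian by blast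
  obtain q where q: "roots_below q" "spans ([:1, 1:] * q) (Poly_Mapping.single 0 1)"
    using spans_monomial[where M = M and \<nu> = 0 and k = M, OF M] by auto
  then have "bs_span (peval F) UNIV (\<lambda>s z. poly ([:1, 1:] * q) s)"
    unfolding spans_def by simp
  then have "bernstein_equation (peval F) 0 ([:1, 1:] * q)"
    unfolding bernstein_equation_iff_bs_span
    by (intro exI[of _ UNIV] conjI open_UNIV UNIV_I peval_holomorphic)
  with q show ?thesis by blast
qed

text \<open>At \<open>s = -1\<close> the generator \<open>f\<^sup>s\<^sup>+\<^sup>1\<close> is the constant function 1.\<close>
lemma twisted_word_minus_1:
  assumes U: "open U" and f: "mv_holomorphic_on f U" and z: "z \<in> U" "f z \<noteq> 0"
  shows "foldr (twisted_deriv f (- 1)) w f z = (if w = [] then f z else 0)"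
  using z
proof (induction w arbitrary: z)
  case (Cons i w)
  let ?V = "{z \<in> U. f z \<noteq> 0}"
  have "twisted_deriv f (- 1) i (foldr (twisted_deriv f (- 1)) w f) z =
      twisted_deriv f (- 1) i (\<lambda>z. if w = [] then f z else 0) z"
    by (rule twisted_deriv_cong[OF open_nonzero[OF U f]]) (use Cons in auto)
  also have "\<dots> = 0"
    using Cons.prems by (cases "w = []") (simp_all add: twisted_deriv_def partial_deriv_const)
  finally show ?case by simp
qed simp

lemma peval_F_0: "peval F 0 = 0"
  using arg_cong[OF euler_identity[OF F], of "\<lambda>p. peval p 0"] d by (simp add: peval_sum peval_mult)

text \<open>At \<open>s = -1\<close> only the empty word contributes, so \<open>b(-1)\<close> is a holomorphic multiple of \<open>f\<close>, and \<open>f\<close> vanishes at the origin.\<close>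
lemma bernstein_root_minus_1:
  assumes "bernstein_equation (peval F) 0 b"
  shows "poly b (- 1) = 0"
proof -
  obtain U where U: "open U" "0 \<in> U" and span: "bs_span (peval F) U (\<lambda>s z. poly b s)"
    using assms unfolding bernstein_equation_iff_bs_span by blast
  obtain I a where I: "finite I" "\<And>p. p \<in> I \<Longrightarrow> mv_holomorphic_on (a p) U"
    and b: "\<And>s z. z \<in> U \<Longrightarrow> peval F z \<noteq> 0 \<Longrightarrow>
        poly b s = (\<Sum>p\<in>I. s ^ fst p * a p z * foldr (twisted_deriv (peval F) s) (snd p) (peval F) z)"
    using span unfolding bs_span_def by blast
  define G where "G = (\<lambda>z. \<Sum>p\<in>I. (- 1) ^ fst p * a p z * (if snd p = [] then 1 else 0))"
  have "mv_holomorphic_on (\<lambda>z. poly b (- 1) - G z * peval F z) U"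
    unfolding G_def
    by (intro mv_holomorphic_on_diff mv_holomorphic_on_mult mv_holomorphic_on_sum mv_holomorphic_on_const peval_holomorphic I)
  moreover have "poly b (- 1) - G z * peval F z = 0" if z: "z \<in> U" "peval F z \<noteq> 0" for z
  proof -
    have "poly b (- 1) = (\<Sum>p\<in>I. (- 1) ^ fst p * a p z * (if snd p = [] then peval F z else 0))"
      unfolding b[OF z] by (intro sum.cong refl) (simp add: twisted_word_minus_1[OF U(1) peval_holomorphic z])
    also have "\<dots> = G z * peval F z"
      unfolding G_def sum_distrib_right by (intro sum.cong refl) simp
    finally show ?thesis by simp
  qed
  moreover obtain z1 where "peval F z1 \<noteq> 0" using exists_peval_nonzero[OF grad] by blast
  ultimately have "poly b (- 1) - G 0 * peval F 0 = 0"
    using zero_where_polynomial_nonzero[of "\<lambda>z. poly b (- 1) - G z * peval F z" U 0 F z1] U by blast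
  then show ?thesis by (simp add: peval_F_0)
qed

end

section \<open>The Bernstein-Sato polynomial generates the ideal of functional equations\<close>

lemma bernstein_equation_add:
  assumes "bernstein_equation f x b" "bernstein_equation f x c"
  shows "bernstein_equation f x (b + c)"
proof -
  obtain U where U: "open U" "x \<in> U" "mv_holomorphic_on f U" "bs_span f U (\<lambda>s z. poly b s)"
    using assms(1) unfolding bernstein_equation_iff_bs_span by blast
  obtain V where V: "open V" "x \<in> V" "bs_span f V (\<lambda>s z. poly c s)"
    using assms(2) unfolding bernstein_equation_iff_bs_span by blast
  have "bs_span f (U \<inter> V) (\<lambda>s z. poly b s + poly c s)"
    by (intro bs_span_add bs_span_subset[OF U(4)] bs_span_subset[OF V(3)]) auto
  moreover have "mv_holomorphic_on f (U \<inter> V)" using U(3) by (rule mv_holomorphic_on_subset) auto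
  ultimately show ?thesis
    unfolding bernstein_equation_iff_bs_span using U V by (intro exI[of _ "U \<inter> V"]) (auto simp: open_Int)
qed

lemma bernstein_equation_mult:
  assumes "bernstein_equation f x b"
  shows "bernstein_equation f x (q * b)"
proof -
  obtain U where U: "open U" "x \<in> U" "mv_holomorphic_on f U" "bs_span f U (\<lambda>s z. poly b s)"
    using assms(1) unfolding bernstein_equation_iff_bs_span by blast
  from bs_span_times_poly[OF U(4), of q] U(1-3) show ?thesis
    unfolding bernstein_equation_iff_bs_span by (intro exI[of _ U]) auto
qed

lemma bernstein_equation_diff:
  "bernstein_equation f x b \<Longrightarrow> bernstein_equation f x c \<Longrightarrow> bernstein_equation f x (b - c)"
  using bernstein_equation_add[of f x b "[:- 1:] * c"] bernstein_equation_mult[of f x c "[:- 1:]"] by simp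

text \<open>The polynomials that admit a functional equation form an ideal, and division with remainder shows that a monic element of least
  degree is unique and generates it.\<close>
lemma bernstein_sato_poly_props:
  assumes "bernstein_equation f x b0" "b0 \<noteq> 0"
  defines "B \<equiv> bernstein_sato_poly f x"
  shows "lead_coeff B = 1" "bernstein_equation f x B" "\<And>c. bernstein_equation f x c \<Longrightarrow> B dvd c"
proof -
  let ?P = "\<lambda>b. lead_coeff b = 1 \<and> bernstein_equation f x b \<and>
        (\<forall>c. c \<noteq> 0 \<and> bernstein_equation f x c \<longrightarrow> Polynomial.degree b \<le> Polynomial.degree c)"
  obtain b1 where b1: "bernstein_equation f x b1" "b1 \<noteq> 0"
    and min: "\<And>c. c \<noteq> 0 \<Longrightarrow> bernstein_equation f x c \<Longrightarrow> Polynomial.degree b1 \<le> Polynomial.degree c"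
    using ex_has_least_nat[of "\<lambda>b. bernstein_equation f x b \<and> b \<noteq> 0" b0 Polynomial.degree] assms by blast
  let ?b = "[:inverse (lead_coeff b1):] * b1"
  have Pb: "?P ?b"
    using b1 min by (auto intro: bernstein_equation_mult simp del: mult_pCons_left)
       (auto intro: min)
  have unique: "b = b'" if b: "?P b" and b': "?P b'" for b b'
  proof (rule ccontr)
    assume ne: "b \<noteq> b'"
    have "b \<noteq> 0" "b' \<noteq> 0" using b b' by auto
    then have deg: "Polynomial.degree b = Polynomial.degree b'" using b b' by (meson antisym)
    have "bernstein_equation f x (b - b')" using b b' by (intro bernstein_equation_diff) auto
    then have "Polynomial.degree b \<le> Polynomial.degree (b - b')" using b ne by auto
    moreover have "Polynomial.degree (b - b') \<le> Polynomial.degree b" using degree_diff_le_max[of b b'] deg by simp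
    ultimately have "Polynomial.degree (b - b') = Polynomial.degree b" by simp
    then have "lead_coeff (b - b') = 0" using b b' deg by simp
    then show False using ne unfolding leading_coeff_0_iff by simp
  qed
  have P: "?P B"
    unfolding B_def bernstein_sato_poly_def
    by (rule theI[where P = ?P, OF Pb]) (erule unique[OF _ Pb])
  then show "lead_coeff B = 1" "bernstein_equation f x B" by auto
  show "B dvd c" if c: "bernstein_equation f x c" for c
  proof (rule ccontr)
    assume "\<not> B dvd c"
    then have ne: "c mod B \<noteq> 0" by (simp add: dvd_eq_mod_eq_0)
    have "bernstein_equation f x (c - (c div B) * B)"
      using P c by (intro bernstein_equation_diff bernstein_equation_mult) auto
    then have "bernstein_equation f x (c mod B)" by (simp add: minus_div_mult_eq_mod)
    then have "Polynomial.degree B \<le> Polynomial.degree (c mod B)" using P ne by blast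
    moreover have "B \<noteq> 0" using P by auto
    then have "Polynomial.degree (c mod B) < Polynomial.degree B" using ne degree_mod_less[of B c] by blast
    ultimately show False by simp
  qed
qed

text \<open>Since \<open>\<alpha> > 1\<close>, the roots \<open>-1\<close> and \<open>-\<alpha>\<close> are different, so \<open>-\<alpha>\<close> remains a root after division by \<open>s + 1\<close>. Because
  \<open>-1\<close> is a simple root of the explicit equation, all roots of the quotient are at most \<open>-\<alpha>\<close>.\<close>
theorem minimal_exponent_weighted_homogeneous:
  fixes W :: "'n::finite \<Rightarrow> nat" and F :: "'n mpoly"
  assumes F: "weighted_homog W d F" and d: "0 < d" and W: "\<And>i. 0 < W i"
    and grad: "\<And>z. (\<forall>j. peval (Diff j F) z = 0) \<longleftrightarrow> z = 0"
    and gt1: "1 < real (\<Sum>i\<in>UNIV. W i) / real d"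
  shows "minimal_exponent (peval F) 0 = real (\<Sum>i\<in>UNIV. W i) / real d"
proof -
  note H = F d W grad
  let ?a = "real (\<Sum>i\<in>UNIV. W i) / real d"
  obtain q where q: "roots_below W d q" "bernstein_equation (peval F) 0 ([:1, 1:] * q)"
    using bernstein_equation_exists[OF H] by blast
  have q0: "q \<noteq> 0" using q(1) by (simp add: roots_below_def[OF H])
  define B where "B = bernstein_sato_poly (peval F) 0"
  have "[:1, 1:] * q \<noteq> 0" using q0 by (simp del: mult_pCons_left)
  note B = bernstein_sato_poly_props[OF q(2) this, folded B_def]
  have "poly B (- 1) = 0" by (rule bernstein_root_minus_1[OF H B(2)])
  then obtain R where R: "B = [:1, 1:] * R" by (auto simp: poly_eq_0_iff_dvd elim: dvdE)
  have red: "reduced_bernstein_sato_poly (peval F) 0 = R"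
    unfolding reduced_bernstein_sato_poly_def B_def[symmetric] R by (rule nonzero_mult_div_cancel_left) simp
  have "[:1, 1:] * R dvd [:1, 1:] * q" using B(3)[OF q(2)] unfolding R .
  then have "R dvd q" by (simp del: mult_pCons_left)
  then have R0: "R \<noteq> 0" using q0 by auto
  have below: "x \<le> - ?a" if "poly R (of_real x) = 0" for x :: real
  proof -
    have "poly q (of_real x) = 0" using \<open>R dvd q\<close> that by (auto elim: dvdE)
    then obtain y :: real where "complex_of_real x = of_real y" "y \<le> - ?a"
      using q(1) unfolding roots_below_def[OF H] by blast
    then show ?thesis by simp
  qed
  have "poly B (- of_real ?a) = 0"
    using bernstein_root_alpha[OF H B(2)] unfolding alpha_real[OF H] .
  then have "(1 - of_real ?a) * poly R (- of_real ?a) = (0 :: complex)" by (simp add: R algebra_simps)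
  moreover have "(1 - of_real ?a :: complex) \<noteq> 0"
  proof
    assume "(1 - of_real ?a :: complex) = 0"
    then have "complex_of_real ?a = of_real 1" by simp
    then have "?a = 1" unfolding of_real_eq_iff .
    with gt1 show False by simp
  qed
  ultimately have root: "poly R (of_real (- ?a)) = 0" unfolding of_real_minus mult_eq_0_iff by blast
  have fin: "finite {x::real. poly R (of_real x) = 0}"
  proof (rule finite_imageD)
    show "finite (complex_of_real ` {x. poly R (of_real x) = 0})"
      by (rule finite_subset[OF _ poly_roots_finite[OF R0]]) auto
  qed (simp add: inj_on_def)
  have "Max {x::real. poly R (of_real x) = 0} = - ?a"
    by (rule Max_eqI[OF fin]) (use below root in auto)
  then show ?thesis unfolding minimal_exponent_def red by simp
qed

section \<open>Adding squares\<close>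

definition embed :: "'c::finite mpoly \<Rightarrow> ('k::finite + 'c) mpoly" where
  "embed G = (\<Sum>\<nu>\<in>keys G. Const (lookup G \<nu>) * (\<Prod>j\<in>UNIV. Var (Inr j) ^ lookup \<nu> j))"

lemma peval_embed: "peval (embed G) z = peval G (\<chi> j. z $ Inr j)"
  by (simp add: embed_def peval_sum peval_mult peval_prod peval_power peval_def[of G] peval_monom_def)

lemma weighted_homog_prod: "(\<And>k. k \<in> A \<Longrightarrow> weighted_homog W (e k) (p k)) \<Longrightarrow> weighted_homog W (\<Sum>k\<in>A. e k) (\<Prod>k\<in>A. p k)"
  using weighted_homog_Const[of W 1]
  by (induction A rule: infinite_finite_induct) (auto intro: weighted_homog_mult simp: Const_simps)

lemma weighted_homog_embed:
  assumes "weighted_homog (\<lambda>j. W (Inr j)) d G"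
  shows "weighted_homog W d (embed G)"
  unfolding embed_def
proof (rule weighted_homog_sum)
  fix \<nu> assume "\<nu> \<in> keys G"
  then have "(\<Sum>j\<in>UNIV. lookup \<nu> j * W (Inr j)) = d"
    using assms by (auto simp: weighted_homog_def weighted_deg_def mult.commute)
  moreover have "weighted_homog W (0 + (\<Sum>j\<in>UNIV. lookup \<nu> j * W (Inr j))) (Const (lookup G \<nu>) * (\<Prod>j\<in>UNIV. Var (Inr j) ^ lookup \<nu> j))"
    by (intro weighted_homog_mult weighted_homog_Const weighted_homog_prod weighted_homog_power weighted_homog_Var)
  ultimately show "weighted_homog W d (Const (lookup G \<nu>) * (\<Prod>j\<in>UNIV. Var (Inr j) ^ lookup \<nu> j))" by simp
qed

text \<open>The zero set of the gradient is invariant under the weighted scaling \<open>y\<^sub>j \<mapsto> t\<^sup>w\<^sup>j y\<^sub>j\<close>, which moves any point into a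
  given neighbourhood of the origin. There \<open>G\<close> vanishes too, by Euler's identity.\<close>
lemma gradient_zero_only_at_0:
  fixes w :: "'c::finite \<Rightarrow> nat"
  assumes G: "weighted_homog w d G" "0 < d" and w: "\<And>j. 0 < w j" and iso: "isolated_singularity (peval G) 0"
  shows "(\<forall>j. peval (Diff j G) y = 0) \<longleftrightarrow> y = 0"
proof
  assume "y = 0"
  then show "\<forall>j. peval (Diff j G) y = 0"
    using iso by (simp add: isolated_singularity_def partial_deriv_peval)
next
  assume y: "\<forall>j. peval (Diff j G) y = 0"
  obtain U where U: "open U" "0 \<in> U" "\<And>z. z \<in> U \<Longrightarrow> peval G z = 0 \<Longrightarrow> (\<forall>i. peval (Diff i G) z = 0) \<Longrightarrow> z = 0"
    using iso unfolding isolated_singularity_def partial_deriv_peval by blast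
  let ?s = "\<lambda>t::complex. \<chi> j. t ^ w j * y $ j"
  have grad: "peval (Diff j G) (?s t) = 0" for j t
  proof (cases "w j \<le> d")
    case True
    then have "weighted_homog w (d - w j) (Diff j G)" by (intro weighted_homog_Diff) (simp add: G)
    from peval_weighted_scale[OF this, of t y] show ?thesis using y by simp
  qed (simp add: Diff_eq_0_if_heavy[OF G(1)])
  have "peval G z = 0" if "\<And>j. peval (Diff j G) z = 0" for z
    using arg_cong[OF euler_identity[OF G(1)], of "\<lambda>p. peval p z"] that G(2) by (simp add: peval_sum peval_mult)
  then have zero: "?s t = 0" if "?s t \<in> U" for t using U(3)[OF that] grad by blast
  have "((\<lambda>t. ?s t $ j) \<longlongrightarrow> 0 $ j) (at 0)" for j
    using w[of j] by (auto intro!: tendsto_eq_intros simp: zero_power)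
  then have "(?s \<longlongrightarrow> 0) (at 0)" by (rule vec_tendstoI)
  then have "eventually (\<lambda>t. ?s t \<in> U) (at 0)" using U(1,2) by (rule topological_tendstoD)
  moreover have "eventually (\<lambda>t::complex. t \<noteq> 0) (at 0)" by (simp add: eventually_at_filter)
  ultimately have "eventually (\<lambda>t. ?s t \<in> U \<and> t \<noteq> 0) (at 0)" by (rule eventually_conj)
  then obtain t where "?s t \<in> U" "t \<noteq> 0" using eventually_happens'[OF trivial_limit_at] by blast
  then have "t ^ w j * y $ j = 0" for j using zero[of t] by (metis vec_lambda_beta zero_index)
  then show "y = 0" using \<open>t \<noteq> 0\<close> by (simp add: vec_eq_iff)
qed

text \<open>A square \<open>u\<^sub>i\<^sup>2\<close> has weight \<open>2 e\<close> if \<open>u\<^sub>i\<close> has weight \<open>e\<close>; this is why the degree of \<open>G\<close> is taken to be even.\<close>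
theorem minimal_exponent_add_squares:
  fixes w :: "'c::finite \<Rightarrow> nat"
  assumes G: "weighted_homog w (2 * e) G" and e: "0 < e" and w: "\<And>j. 0 < w j"
    and iso: "isolated_singularity (peval G) 0"
    and gt1: "2 * e < CARD('k::finite) * e + (\<Sum>j\<in>UNIV. w j)"
  shows "minimal_exponent (add_squares (peval G) :: complex^('k + 'c) \<Rightarrow> complex) 0 =
    real (CARD('k) * e + (\<Sum>j\<in>UNIV. w j)) / real (2 * e)"
proof -
  define F :: "('k + 'c) mpoly" where "F = (\<Sum>i\<in>UNIV. Var (Inl i) ^ 2) + embed G"
  define W :: "'k + 'c \<Rightarrow> nat" where "W = case_sum (\<lambda>_. e) w"
  have evF: "peval F = add_squares (peval G)"
    by (rule ext) (simp add: F_def add_squares_def peval_add peval_sum peval_power peval_embed)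
  have F: "weighted_homog W (2 * e) F"
    unfolding F_def
  proof (intro weighted_homog_add weighted_homog_sum weighted_homog_embed)
    show "weighted_homog W (2 * e) (Var (Inl i) ^ 2)" for i
      using weighted_homog_power[OF weighted_homog_Var[of W "Inl i"], of 2] by (simp add: W_def)
    show "weighted_homog (\<lambda>j. W (Inr j)) (2 * e) G" using G by (simp add: W_def)
  qed
  have W: "0 < W i" for i by (cases i) (auto simp: W_def e w)
  let ?\<pi> = "\<lambda>z :: complex^('k + 'c). \<chi> j. z $ Inr j"
  have g: "has_gradient (peval F) (\<lambda>i. (\<Sum>k\<in>UNIV. (if i = Inl k then 1 else 0) * z $ Inl k + z $ Inl k * (if i = Inl k then 1 else 0))
      + (\<Sum>j\<in>UNIV. (if i = Inr j then 1 else 0) * peval (Diff j G) (?\<pi> z))) z" for z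
  proof -
    have "has_gradient (\<lambda>z. (\<Sum>k\<in>UNIV. z $ Inl k * z $ Inl k) + peval G (?\<pi> z))
      (\<lambda>i. (\<Sum>k\<in>UNIV. (if i = Inl k then 1 else 0) * z $ Inl k + z $ Inl k * (if i = Inl k then 1 else 0))
      + (\<Sum>j\<in>UNIV. (if i = Inr j then 1 else 0) * peval (Diff j G) (?\<pi> z))) z"
      by (intro has_gradient_add has_gradient_sum has_gradient_mult has_gradient_coord
          has_gradient_compose[where \<phi> = ?\<pi>] peval_has_gradient)
         (simp add: has_gradient_coord)
    then show ?thesis by (simp add: evF add_squares_def[abs_def] power2_eq_square)
  qed
  have DF: "peval (Diff (Inl k) F) z = 2 * z $ Inl k" "peval (Diff (Inr j) F) z = peval (Diff j G) (?\<pi> z)" for k j z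
    using has_gradient_imp_partial_deriv[OF g, of "Inl k" z] has_gradient_imp_partial_deriv[OF g, of "Inr j" z]
    by (simp_all add: partial_deriv_peval sum.distrib if_distrib[of "\<lambda>x. x * _"] if_distrib[of "\<lambda>x. _ * x"] cong: if_cong)
  have "(\<forall>i. peval (Diff i F) z = 0) \<longleftrightarrow> z = 0" for z
  proof -
    have "(\<forall>i. peval (Diff i F) z = 0) \<longleftrightarrow> (\<forall>k. z $ Inl k = 0) \<and> (\<forall>j. peval (Diff j G) (?\<pi> z) = 0)"
      by (auto simp: DF split_sum_all)
    also have "\<dots> \<longleftrightarrow> (\<forall>k. z $ Inl k = 0) \<and> ?\<pi> z = 0"
      using gradient_zero_only_at_0[OF G _ w iso] e by simp
    also have "\<dots> \<longleftrightarrow> z = 0"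
      by (auto simp: vec_eq_iff) (metis sum.exhaust)
    finally show ?thesis .
  qed
  moreover have "(\<Sum>i\<in>UNIV. W i) = CARD('k) * e + (\<Sum>j\<in>UNIV. w j)"
    unfolding UNIV_Plus_UNIV[symmetric] by (subst sum.Plus) (auto simp: W_def)
  moreover from gt1 e have "1 < real (CARD('k) * e + (\<Sum>j\<in>UNIV. w j)) / real (2 * e)"
    by (subst less_divide_eq_1_pos) (auto simp only: of_nat_less_iff of_nat_0_less_iff)
  ultimately show ?thesis
    using minimal_exponent_weighted_homogeneous[OF F _ W] e unfolding evF by simp
qed

lemma minimal_exponent_has_type:
  fixes w :: "'c::finite \<Rightarrow> nat" and f :: "complex^'n::finite \<Rightarrow> complex"
  assumes "has_type TYPE('k::finite) S f x"
    and S: "\<And>g. g \<in> S \<Longrightarrow> \<exists>G. g = peval G \<and> weighted_homog w (2 * e) G"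
    and e: "0 < e" and w: "\<And>j. 0 < w j"
    and sum: "3 * (CARD('k) * e + (\<Sum>j\<in>UNIV. w j)) = 14 * e"
  shows "minimal_exponent f x = 7 / 3"
proof -
  obtain g where g: "g \<in> S" "isolated_singularity g 0"
      "analytically_equivalent f x (add_squares g :: complex^('k + 'c) \<Rightarrow> complex) 0"
    using assms(1) unfolding has_type_def by blast
  obtain G where G: "g = peval G" "weighted_homog w (2 * e) G" using S[OF g(1)] by blast
  have "minimal_exponent f x = minimal_exponent (add_squares g :: complex^('k + 'c) \<Rightarrow> complex) 0"
    by (rule minimal_exponent_analytically_equivalent[OF g(3)])
  also have "\<dots> = real (CARD('k) * e + (\<Sum>j\<in>UNIV. w j)) / real (2 * e)"
    unfolding G(1) by (rule minimal_exponent_add_squares[OF G(2) e w]) (use g(2) G(1) sum e in auto)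
  also have "\<dots> = 7 / 3"
  proof -
    have "3 * real (CARD('k) * e + (\<Sum>j\<in>UNIV. w j)) = 14 * real e"
      using arg_cong[OF sum, of real] by simp
    then show ?thesis using e by (simp add: field_simps)
  qed
  finally show ?thesis .
qed

section \<open>The six analytic types\<close>

lemma weighted_homog_mult_eq: "weighted_homog W a p \<Longrightarrow> weighted_homog W b q \<Longrightarrow> a + b = e \<Longrightarrow> weighted_homog W e (p * q)"
  using weighted_homog_mult by blast

lemma weighted_homog_power_eq: "weighted_homog W a p \<Longrightarrow> k * a = e \<Longrightarrow> weighted_homog W e (p ^ k)"
  using weighted_homog_power by blast

lemma weighted_homog_Var_eq: "W i = e \<Longrightarrow> weighted_homog W e (Var i)"
  using weighted_homog_Var by blast

lemmas weighted_homog_intros = weighted_homog_add weighted_homog_mult_eq weighted_homog_power_eq weighted_homog_Var_eq weighted_homog_Const refl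

lemmas peval_simps = peval_add peval_mult peval_power peval_sum peval_prod peval_Const peval_Var

definition weights3 :: "nat \<Rightarrow> nat \<Rightarrow> nat \<Rightarrow> 3 \<Rightarrow> nat" where
  "weights3 a b c i = (if i = 1 then a else if i = 2 then b else c)"

lemma weights3_simps [simp]: "weights3 a b c 1 = a" "weights3 a b c 2 = b" "weights3 a b c 3 = c"
  by (simp_all add: weights3_def)

lemma weights3_pos: "0 < a \<Longrightarrow> 0 < b \<Longrightarrow> 0 < c \<Longrightarrow> 0 < weights3 a b c i"
  by (simp add: weights3_def)

lemma E19_weighted_homogeneous:
  assumes "g \<in> E19"
  shows "\<exists>G. g = peval G \<and> weighted_homog (weights3 9 6 5) (2 * 12) G"
proof (intro exI conjI)
  let ?G = "Var 1 ^ 2 * Var 2 + Var 2 ^ 4 + Var 1 * Var 3 ^ 3 :: 3 mpoly"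
  show "g = peval ?G" using assms by (auto simp: E19_def Let_def peval_simps fun_eq_iff)
  show "weighted_homog (weights3 9 6 5) (2 * 12) ?G" by (intro weighted_homog_intros) (auto intro: weighted_homog_Const)
qed

lemma E21_weighted_homogeneous:
  assumes "g \<in> E21"
  shows "\<exists>G. g = peval G \<and> weighted_homog (weights3 2 3 5) (2 * 6) G"
proof -
  obtain t where g: "g = (\<lambda>v. let X = v $ 1; Y = v $ 2; Z = v $ 3 in
      t * X^6 + X^3 * Y^2 + X^2 * Y * Z + X * Z^2 + Y^4)"
    using assms unfolding E21_def by blast
  let ?G = "Const t * Var 1 ^ 6 + Var 1 ^ 3 * Var 2 ^ 2 + Var 1 ^ 2 * Var 2 * Var 3 + Var 1 * Var 3 ^ 2 + Var 2 ^ 4 :: 3 mpoly"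
  have "g = peval ?G" by (simp add: g Let_def peval_simps fun_eq_iff)
  moreover have "weighted_homog (weights3 2 3 5) (2 * 6) ?G" by (intro weighted_homog_intros) (auto intro: weighted_homog_Const)
  ultimately show ?thesis by blast
qed

lemma E18_weighted_homogeneous:
  assumes "g \<in> E18"
  shows "\<exists>G. g = peval G \<and> weighted_homog (weights3 3 3 4) (2 * 6) G"
proof -
  obtain t where g: "g = (\<lambda>v. let X = v $ 1; Y = v $ 2; Z = v $ 3 in Z^3 + X^4 + t * X^2 * Y^2 + Y^4)"
    using assms unfolding E18_def by blast
  let ?G = "Var 3 ^ 3 + Var 1 ^ 4 + Const t * Var 1 ^ 2 * Var 2 ^ 2 + Var 2 ^ 4 :: 3 mpoly"
  have "g = peval ?G" by (simp add: g Let_def peval_simps fun_eq_iff)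
  moreover have "weighted_homog (weights3 3 3 4) (2 * 6) ?G" by (intro weighted_homog_intros) (auto intro: weighted_homog_Const)
  ultimately show ?thesis by blast
qed

lemma E20_weighted_homogeneous:
  assumes "g \<in> E20"
  shows "\<exists>G. g = peval G \<and> weighted_homog (weights3 1 2 2) (2 * 3) G"
proof -
  obtain t1 t2 t3 t4 t5 where g: "g = (\<lambda>v. let X = v $ 1; Y = v $ 2; Z = v $ 3 in
      Y^3 + Z^3 + X^6 + t1 * X^2 * Y^2 + t2 * X^2 * Y * Z + t3 * Y^2 * Z + t4 * X^4 * Y + t5 * X^4 * Z)"
    using assms unfolding E20_def by blast
  let ?G = "Var 2 ^ 3 + Var 3 ^ 3 + Var 1 ^ 6 + Const t1 * Var 1 ^ 2 * Var 2 ^ 2 + Const t2 * Var 1 ^ 2 * Var 2 * Var 3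
      + Const t3 * Var 2 ^ 2 * Var 3 + Const t4 * Var 1 ^ 4 * Var 2 + Const t5 * Var 1 ^ 4 * Var 3 :: 3 mpoly"
  have "g = peval ?G" by (simp add: g Let_def peval_simps fun_eq_iff)
  moreover have "weighted_homog (weights3 1 2 2) (2 * 3) ?G" by (intro weighted_homog_intros) (auto intro: weighted_homog_Const)
  ultimately show ?thesis by blast
qed

definition linear_poly :: "complex^'c::finite \<Rightarrow> 'c mpoly" where
  "linear_poly l = (\<Sum>j\<in>UNIV. Const (l $ j) * Var j)"

lemma peval_linear_poly: "peval (linear_poly l) = linear_form l"
  by (rule ext) (simp add: linear_poly_def linear_form_def peval_simps)

lemma weighted_homog_linear_poly: "weighted_homog (\<lambda>_. a) a (linear_poly l)"
  unfolding linear_poly_def by (intro weighted_homog_sum weighted_homog_mult_eq[OF weighted_homog_Const weighted_homog_Var]) simp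

lemma O6_weighted_homogeneous:
  assumes "g \<in> O6"
  shows "\<exists>G. g = peval G \<and> weighted_homog (\<lambda>_. 1) (2 * 3) G"
proof -
  obtain L :: "nat \<Rightarrow> complex^2" where g: "g = (\<lambda>v. \<Prod>i\<in>{1..6}. linear_form (L i) v)"
    using assms unfolding O6_def by blast
  let ?G = "\<Prod>i\<in>{1..6}. linear_poly (L i)"
  have "g = peval ?G" by (simp add: g fun_eq_iff peval_prod peval_linear_poly)
  moreover have "weighted_homog (\<lambda>_. 1) (\<Sum>i\<in>{1..6::nat}. 1) ?G" by (intro weighted_homog_prod weighted_homog_linear_poly)
  ultimately show ?thesis by auto
qed

text \<open>The weights are doubled to make the degree even.\<close>
lemma Ccub_weighted_homogeneous:
  assumes "g \<in> Ccub"
  shows "\<exists>G. g = peval G \<and> weighted_homog (\<lambda>_. 2) (2 * 3) G"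
proof -
  obtain c :: "nat \<Rightarrow> complex" and L :: "nat \<Rightarrow> complex^4"
    where g: "g = (\<lambda>v. \<Sum>i\<le>4. c i * (linear_form (L i) v)^3)"
    using assms unfolding Ccub_def by blast
  let ?G = "\<Sum>i\<le>4. Const (c i) * linear_poly (L i) ^ 3"
  have "g = peval ?G" by (simp add: g fun_eq_iff peval_simps peval_linear_poly)
  moreover have "weighted_homog (\<lambda>_. 2) (2 * 3) ?G"
    by (intro weighted_homog_sum weighted_homog_mult_eq[OF weighted_homog_Const weighted_homog_power[OF weighted_homog_linear_poly]]) simp
  ultimately show ?thesis by blast
qed

theorem theorem6p1:
  fixes f :: "complex^6 \<Rightarrow> complex" and x :: "complex^6"
  assumes "isolated_singularity f x"
    and "has_type TYPE(3) E19 f x \<or> has_type TYPE(3) E21 f x \<or> has_type TYPE(3) E18 f x \<or>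
         has_type TYPE(4) O6 f x \<or> has_type TYPE(2) Ccub f x \<or> has_type TYPE(3) E20 f x"
  shows "minimal_exponent f x = 7 / 3"
  using assms(2)
proof (elim disjE)
  assume "has_type TYPE(3) E19 f x"
  then show ?thesis
    by (rule minimal_exponent_has_type[OF _ E19_weighted_homogeneous]) (simp_all add: sum_3 weights3_pos)
next
  assume "has_type TYPE(3) E21 f x"
  then show ?thesis
    by (rule minimal_exponent_has_type[OF _ E21_weighted_homogeneous]) (simp_all add: sum_3 weights3_pos)
next
  assume "has_type TYPE(3) E18 f x"
  then show ?thesis
    by (rule minimal_exponent_has_type[OF _ E18_weighted_homogeneous]) (simp_all add: sum_3 weights3_pos)
next
  assume "has_type TYPE(4) O6 f x"
  then show ?thesis
    by (rule minimal_exponent_has_type[OF _ O6_weighted_homogeneous]) simp_all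
next
  assume "has_type TYPE(2) Ccub f x"
  then show ?thesis
    by (rule minimal_exponent_has_type[OF _ Ccub_weighted_homogeneous]) simp_all
next
  assume "has_type TYPE(3) E20 f x"
  then show ?thesis
    by (rule minimal_exponent_has_type[OF _ E20_weighted_homogeneous]) (simp_all add: sum_3 weights3_pos)
qed

end
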